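(* Let $a,b,c,d,e,f$ be nonzero complex numbers and $s=\dfrac{a^3q^3}{bcdef}$. With $W_1,W_{1+},S_1,T_1,W_3,W_{3+},S_3,T_3,L_3'$ as in the context, $$L_3'(1-q)\bigl[(S_1-S_3)W_1W_3-T_1W_{1+}W_3+T_3W_1W_{3+}\bigr]$$ $$=-\frac{aq^2}{s}\,\frac{(aq,\frac{s}{bq},\frac{bq^2}{s},\frac{aq}{de},\frac{aq}{ce},\frac{aq}{cd},\frac{aq}{cf},\frac{aq}{df},\frac{aq}{ef})_\infty}{(\frac{aq}{b},\frac{aq}{c},\frac{aq}{d},\frac{aq}{e},\frac{aq}{f},\frac{bc}{a},\frac{bd}{a},\frac{be}{a},\frac{bf}{a})_\infty}.$$
   Context: Throughout $q\in\mathbb C$, $0<|q|<1$; $(x)_0=1$, $(x)_k=\prod_{j=0}^{k-1}(1-xq^j)$, $(x)_\infty=\prod_{j\ge 0}(1-xq^j)$, $(x_1,\dots,x_r)_k=\prod_i (x_i)_k$. The very-well-poised series is $${}_8W_7(a;p_1,\dots,p_5;z)=\sum_{k=0}^\infty \frac{1-aq^{2k}}{1-a}\,\frac{(a,p_1,\dots,p_5)_k}{(q,aq/p_1,\dots,aq/p_5)_k}\,z^k,\qquad z=\frac{a^2q^2}{p_1\cdots p_5},$$ for $|z|<1$, and its analytic continuation in the parameters otherwise. Put $$W_1={}_8W_7\bigl(a;b,c,d,e,f;\tfrac{s}{aq}\bigr),\qquad W_{1+}={}_8W_7\bigl(aq^2;bq,cq,dq,eq,fq;\tfrac{s}{aq^2}\bigr),$$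 $$S_1=\frac1{1-q}\Bigl(\frac sq+\frac{s}{aq}+\frac{aq}{b}+\frac{aq}{c}+\frac{aq}{d}+\frac{aq}{e}+\frac{aq}{f}-aq\Bigr),$$ $$T_1=\frac{\frac{s}{aq}(1-\frac{s}{aq^2})(1-aq)(1-aq^2)(1-b)(1-c)(1-d)(1-e)(1-f)}{(1-q)(1-\frac{aq}{b})(1-\frac{aq}{c})(1-\frac{aq}{d})(1-\frac{aq}{e})(1-\frac{aq}{f})},$$ $$W_3={}_8W_7\bigl(\tfrac{b^2}{a};b,\tfrac{bc}{a},\tfrac{bd}{a},\tfrac{be}{a},\tfrac{bf}{a};\tfrac{s}{aq}\bigr),\qquad W_{3+}={}_8W_7\bigl(\tfrac{b^2q^2}{a};bq,\tfrac{bcq}{a},\tfrac{bdq}{a},\tfrac{beq}{a},\tfrac{bfq}{a};\tfrac{s}{aq^2}\bigr),$$ $$S_3=\frac1{1-q}\Bigl(\frac{aq}{c}+\frac{aq}{d}+\frac{aq}{e}+\frac{aq}{f}+\frac{bs}{aq}+q+\frac{s}{bq}-bq\Bigr),$$ $$T_3=\frac{\frac{s}{bq}(1-\frac{s}{aq^2})(1-\frac{b^2q}{a})(1-\frac{b^2q^2}{a})(1-\frac{bc}{a})(1-\frac{bd}{a})(1-\frac{be}{a})(1-\frac{bf}{a})(1-b)}{(1-q)(1-\frac{bq}{c})(1-\frac{bq}{d})(1-\frac{bq}{e})(1-\frac{bq}{f})(1-\frac{bq}{a})},$$ $$L_3'=\frac{(\frac{s}{aq},\frac{bq}{c},\frac{bq}{d},\frac{bq}{e},\frac{bq}{f},\frac{bq}{a},\frac{bq}{s},\frac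 sb)_\infty}{(\frac{b^2q}{a},\frac{bc}{a},\frac{bd}{a},\frac{be}{a},\frac{bf}{a},b,\frac ba,\frac{aq}{b})_\infty}.$$ Standing assumption: parameters are such that no zero denominators (singularities) occur. *)

theory Defs
  imports "HOL-Analysis.Analysis"
begin

definition qpoch :: "complex \<Rightarrow> complex \<Rightarrow> nat \<Rightarrow> complex" where
  "qpoch q x k = (\<Prod>j<k. 1 - x * q ^ j)"

definition qpoch_inf :: "complex \<Rightarrow> complex \<Rightarrow> complex" where
  "qpoch_inf q x = (\<Prod>j. 1 - x * q ^ j)"

definition qpochs :: "complex \<Rightarrow> complex list \<Rightarrow> nat \<Rightarrow> complex" where
  "qpochs q xs k = (\<Prod>x\<leftarrow>xs. qpoch q x k)"

definition qpochs_inf :: "complex \<Rightarrow> complex list \<Rightarrow> complex" where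
  "qpochs_inf q xs = (\<Prod>x\<leftarrow>xs. qpoch_inf q x)"

text \<open>The argument of the series is determined by its parameters.\<close>

definition vwp_arg :: "complex \<Rightarrow> complex \<Rightarrow> complex list \<Rightarrow> complex" where
  "vwp_arg q a ps = a\<^sup>2 * q\<^sup>2 / prod_list ps"

definition vwp_series :: "complex \<Rightarrow> complex \<Rightarrow> complex list \<Rightarrow> complex" where
  "vwp_series q a ps =
     (\<Sum>k. (1 - a * q ^ (2 * k)) / (1 - a)
          * (qpochs q (a # ps) k / qpochs q (q # map (\<lambda>p. a * q / p) ps) k)
          * vwp_arg q a ps ^ k)"

type_synonym params = "complex \<times> complex \<times> complex \<times> complex \<times> complex \<times> complex"

text \<open>
  The open set of parameters at which the continued series has no singularity: no factor in a
  denominator of a term vanishes, and the argument \<open>z\<close> avoids \<open>1, 1/q, 1/q\<^sup>2, \<dots>\<close>,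
  the poles of the continuation in \<open>z\<close>. Indeed, by expanding the \<open>k\<close>-th term in powers
  of \<open>q ^ k\<close>, a tail of the series is \<open>\<Sum>j. c j / (1 - z * q ^ j)\<close>.
\<close>

definition W87_dom :: "complex \<Rightarrow> params set" where
  "W87_dom q = {(a, b, c, d, e, f).
     a \<noteq> 0 \<and> a \<noteq> 1 \<and>
     (\<forall>p\<in>{b, c, d, e, f}. p \<noteq> 0 \<and> (\<forall>n. (a * q / p) * q ^ n \<noteq> 1)) \<and>
     (\<forall>n. vwp_arg q a [b, c, d, e, f] * q ^ n \<noteq> 1)}"

text \<open>
  Holomorphy in several variables is expressed as continuity together with complex
  differentiability in each variable (Osgood's lemma). Since every slice of \<open>W87_dom q\<close> in
  \<open>f\<close> is a connected open set that meets \<open>norm z < 1\<close>, a continuation is unique on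
  \<open>W87_dom q\<close>.
\<close>

definition holomorphic6_on :: "(params \<Rightarrow> complex) \<Rightarrow> params set \<Rightarrow> bool" where
  "holomorphic6_on g D \<longleftrightarrow> continuous_on D g \<and>
     (\<forall>(a, b, c, d, e, f)\<in>D.
        (\<lambda>w. g (w, b, c, d, e, f)) field_differentiable (at a) \<and>
        (\<lambda>w. g (a, w, c, d, e, f)) field_differentiable (at b) \<and>
        (\<lambda>w. g (a, b, w, d, e, f)) field_differentiable (at c) \<and>
        (\<lambda>w. g (a, b, c, w, e, f)) field_differentiable (at d) \<and>
        (\<lambda>w. g (a, b, c, d, w, f)) field_differentiable (at e) \<and>
        (\<lambda>w. g (a, b, c, d, e, w)) field_differentiable (at f))"

definition is_W87_continuation :: "complex \<Rightarrow> (params \<Rightarrow> complex) \<Rightarrow> bool" where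
  "is_W87_continuation q g \<longleftrightarrow>
     holomorphic6_on g (W87_dom q) \<and>
     (\<forall>(a, b, c, d, e, f)\<in>W87_dom q.
        norm (vwp_arg q a [b, c, d, e, f]) < 1 \<longrightarrow>
          g (a, b, c, d, e, f) = vwp_series q a [b, c, d, e, f])"

definition W87 :: "complex \<Rightarrow> params \<Rightarrow> complex" where
  "W87 q = (SOME g. is_W87_continuation q g)"

definition params1 :: "complex \<Rightarrow> complex \<Rightarrow> complex \<Rightarrow> complex \<Rightarrow> complex \<Rightarrow> complex \<Rightarrow> complex \<Rightarrow> params" where
  "params1 q a b c d e f = (a, b, c, d, e, f)"

definition params1p :: "complex \<Rightarrow> complex \<Rightarrow> complex \<Rightarrow> complex \<Rightarrow> complex \<Rightarrow> complex \<Rightarrow> complex \<Rightarrow> params" where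
  "params1p q a b c d e f = (a * q\<^sup>2, b * q, c * q, d * q, e * q, f * q)"

definition params3 :: "complex \<Rightarrow> complex \<Rightarrow> complex \<Rightarrow> complex \<Rightarrow> complex \<Rightarrow> complex \<Rightarrow> complex \<Rightarrow> params" where
  "params3 q a b c d e f = (b\<^sup>2 / a, b, b * c / a, b * d / a, b * e / a, b * f / a)"

definition params3p :: "complex \<Rightarrow> complex \<Rightarrow> complex \<Rightarrow> complex \<Rightarrow> complex \<Rightarrow> complex \<Rightarrow> complex \<Rightarrow> params" where
  "params3p q a b c d e f =
     (b\<^sup>2 * q\<^sup>2 / a, b * q, b * c * q / a, b * d * q / a, b * e * q / a, b * f * q / a)"

lemma vwp_args:
  fixes q a b c d e f s :: complex
  assumes "q \<noteq> 0" "a \<noteq> 0" "b \<noteq> 0" "c \<noteq> 0" "d \<noteq> 0" "e \<noteq> 0" "f \<noteq> 0"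
    and s: "s = a ^ 3 * q ^ 3 / (b * c * d * e * f)"
  shows "vwp_arg q a [b, c, d, e, f] = s / (a * q)"
    and "vwp_arg q (a * q\<^sup>2) [b * q, c * q, d * q, e * q, f * q] = s / (a * q\<^sup>2)"
    and "vwp_arg q (b\<^sup>2 / a) [b, b * c / a, b * d / a, b * e / a, b * f / a] = s / (a * q)"
    and "vwp_arg q (b\<^sup>2 * q\<^sup>2 / a)
           [b * q, b * c * q / a, b * d * q / a, b * e * q / a, b * f * q / a] = s / (a * q\<^sup>2)"
  using assms by (simp_all add: vwp_arg_def field_simps power2_eq_square power3_eq_cube)

definition S1 :: "complex \<Rightarrow> complex \<Rightarrow> complex \<Rightarrow> complex \<Rightarrow> complex \<Rightarrow> complex \<Rightarrow> complex \<Rightarrow> complex \<Rightarrow> complex" where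
  "S1 q a b c d e f s = 1 / (1 - q) *
     (s / q + s / (a * q) + a * q / b + a * q / c + a * q / d + a * q / e + a * q / f - a * q)"

definition T1 :: "complex \<Rightarrow> complex \<Rightarrow> complex \<Rightarrow> complex \<Rightarrow> complex \<Rightarrow> complex \<Rightarrow> complex \<Rightarrow> complex \<Rightarrow> complex" where
  "T1 q a b c d e f s =
     (s / (a * q) * (1 - s / (a * q\<^sup>2)) * (1 - a * q) * (1 - a * q\<^sup>2)
        * (1 - b) * (1 - c) * (1 - d) * (1 - e) * (1 - f))
     / ((1 - q) * (1 - a * q / b) * (1 - a * q / c) * (1 - a * q / d) * (1 - a * q / e)
        * (1 - a * q / f))"

definition S3 :: "complex \<Rightarrow> complex \<Rightarrow> complex \<Rightarrow> complex \<Rightarrow> complex \<Rightarrow> complex \<Rightarrow> complex \<Rightarrow> complex \<Rightarrow> complex" where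
  "S3 q a b c d e f s = 1 / (1 - q) *
     (a * q / c + a * q / d + a * q / e + a * q / f + b * s / (a * q) + q + s / (b * q) - b * q)"

definition T3 :: "complex \<Rightarrow> complex \<Rightarrow> complex \<Rightarrow> complex \<Rightarrow> complex \<Rightarrow> complex \<Rightarrow> complex \<Rightarrow> complex \<Rightarrow> complex" where
  "T3 q a b c d e f s =
     (s / (b * q) * (1 - s / (a * q\<^sup>2)) * (1 - b\<^sup>2 * q / a) * (1 - b\<^sup>2 * q\<^sup>2 / a)
        * (1 - b * c / a) * (1 - b * d / a) * (1 - b * e / a) * (1 - b * f / a) * (1 - b))
     / ((1 - q) * (1 - b * q / c) * (1 - b * q / d) * (1 - b * q / e) * (1 - b * q / f)
        * (1 - b * q / a))"

definition L3_denom :: "complex \<Rightarrow> complex \<Rightarrow> complex \<Rightarrow> complex \<Rightarrow> complex \<Rightarrow> complex \<Rightarrow> complex \<Rightarrow> complex list" where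
  "L3_denom q a b c d e f =
     [b\<^sup>2 * q / a, b * c / a, b * d / a, b * e / a, b * f / a, b, b / a, a * q / b]"

definition L3' :: "complex \<Rightarrow> complex \<Rightarrow> complex \<Rightarrow> complex \<Rightarrow> complex \<Rightarrow> complex \<Rightarrow> complex \<Rightarrow> complex \<Rightarrow> complex" where
  "L3' q a b c d e f s =
     qpochs_inf q [s / (a * q), b * q / c, b * q / d, b * q / e, b * q / f, b * q / a,
                   b * q / s, s / b]
     / qpochs_inf q (L3_denom q a b c d e f)"

text \<open>
  No zero denominators: the four series are taken at nonsingular parameters, and the infinite
  product in the denominator of \<open>L3'\<close> has no vanishing factor. The other denominators
  (those of \<open>S1\<close>, \<open>T1\<close>, \<open>S3\<close>, \<open>T3\<close> and of the right-hand side of the identity)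
  consist of factors that are already covered.
\<close>

definition nonsingular :: "complex \<Rightarrow> complex \<Rightarrow> complex \<Rightarrow> complex \<Rightarrow> complex \<Rightarrow> complex \<Rightarrow> complex \<Rightarrow> bool" where
  "nonsingular q a b c d e f \<longleftrightarrow>
     params1 q a b c d e f \<in> W87_dom q \<and> params1p q a b c d e f \<in> W87_dom q \<and>
     params3 q a b c d e f \<in> W87_dom q \<and> params3p q a b c d e f \<in> W87_dom q \<and>
     (\<forall>x\<in>set (L3_denom q a b c d e f). \<forall>n. x * q ^ n \<noteq> 1)"

end

(*
  Let t k and u k be the terms of W1 and W3, put x k = q^-k + a q^k and y k = (a/b) q^-k + b q^k, and
  z = s/(aq). Shifting the summation index in W1+ and W3+ turns the bracket of the theorem, times
  1 - q, into (z - q) D with D = Sum t j u k (x j - y k), provided |z| < |q|. For c replaced by c/q,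
  the terms t k and u k change by factors that are linear in x k and y k, and the moments of both
  sequences satisfy one and the same telescoping relation of degree two. Reducing modulo this
  relation gives D(c) as an explicit multiple of D(c/q), hence D(c) as an explicit product times a
  limit D(infinity) that does not depend on c. The same holds for d, and the constants are
  determined at c = 1, d = a/b, where both series reduce to their first term.

  This proves the identity for large f and generic a, c, d. The identity theorem in f and a
  perturbation of a, c, d extend it to all nonsingular parameters. The continuation of the series
  Sum (a,p)_k / (q,aq/p)_k z^k exists because its q-difference equation in z expresses its value at z,
  up to the factor 1/(1 - z), through those at q z, q^2 z, ....
*)
theory Submission
  imports Defs "HOL-Complex_Analysis.Complex_Analysis"
begin

subsection \<open>Classes of functions closed under locally uniform limits\<close>

text \<open>A step from c to c/q is computable because D is a 2x2 determinant: the zeroth and first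
  moments of t and u are values of two functionals on polynomials modulo one quadratic p(X), and the
  step inserts the factor X - phi, phi = c/q + a q/c, into both. On the two-dimensional quotient,
  multiplication by X - phi has determinant p(phi) over the leading coefficient, and p(phi) factors
  completely because phi is 1/y + a y at y = q/c, a zero of one of the two telescoped products. The
  quadratic arises since y -> 1/(a y), with invariant 1/y + a y, exchanges these products; it serves
  both series since the six numerator parameters of W3 are those of W1 times b/a. Going from c to
  c/q multiplies the argument by q, so convergence improves along the iteration. It is anchored at c
  = 1, d = a/b because c = 1 stops W1 and b d/a = 1 stops W3. Each step cancels factors that vanish
  for c = q or b c = a q: this is where genericity enters. As \<open>W87\<close> is chosen by its
  specification, only continuity and differentiability in single variables carry the result to all
  parameters.\<close>

text \<open>The common interface of continuity and holomorphy: \<open>H S f\<close> stands for \<open>continuous_on S f\<close> and for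
  \<open>f holomorphic_on S\<close>.\<close>

locale regular_functions =
  fixes H :: "'x::t2_space set \<Rightarrow> ('x \<Rightarrow> complex) \<Rightarrow> bool"
  assumes const: "H S (\<lambda>x. c)"
    and add: "H S f \<Longrightarrow> H S g \<Longrightarrow> H S (\<lambda>x. f x + g x)"
    and mult: "H S f \<Longrightarrow> H S g \<Longrightarrow> H S (\<lambda>x. f x * g x)"
    and inverse: "H S f \<Longrightarrow> (\<And>x. x \<in> S \<Longrightarrow> f x \<noteq> 0) \<Longrightarrow> H S (\<lambda>x. inverse (f x))"
    and cong: "H S f \<Longrightarrow> (\<And>x. x \<in> S \<Longrightarrow> f x = g x) \<Longrightarrow> H S g"
    and subset: "H S f \<Longrightarrow> T \<subseteq> S \<Longrightarrow> H T f"
    and local: "(\<And>x. x \<in> S \<Longrightarrow> \<exists>T. open T \<and> x \<in> T \<and> T \<subseteq> S \<and> H T f) \<Longrightarrow> H S f"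
    and continuous: "H S f \<Longrightarrow> continuous_on S f"
    and ulim: "open S \<Longrightarrow> (\<And>n. H S (F n)) \<Longrightarrow> uniform_limit S F g sequentially \<Longrightarrow> H S g"
begin

lemma uminus: "H S f \<Longrightarrow> H S (\<lambda>x. - f x)"
  using mult[OF const[of S "-1"], of f] by simp

lemma diff: "H S f \<Longrightarrow> H S g \<Longrightarrow> H S (\<lambda>x. f x - g x)"
  using add[OF _ uminus[of S g], of f] by simp

lemma divide:
  "H S f \<Longrightarrow> H S g \<Longrightarrow> (\<And>x. x \<in> S \<Longrightarrow> g x \<noteq> 0) \<Longrightarrow> H S (\<lambda>x. f x / g x)"
  unfolding divide_inverse by (intro mult inverse)

lemma sum: "(\<And>i. i \<in> I \<Longrightarrow> H S (f i)) \<Longrightarrow> H S (\<lambda>x. \<Sum>i\<in>I. f i x)"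
  by (induction I rule: infinite_finite_induct) (auto intro!: const add)

lemma prod: "(\<And>i. i \<in> I \<Longrightarrow> H S (f i)) \<Longrightarrow> H S (\<lambda>x. \<Prod>i\<in>I. f i x)"
  by (induction I rule: infinite_finite_induct) (auto intro!: const mult)

lemma prod_list: "(\<And>u. u \<in> set us \<Longrightarrow> H S (f u)) \<Longrightarrow> H S (\<lambda>x. \<Prod>u\<leftarrow>us. f u x)"
  by (induction us) (auto intro!: const mult)

lemma power: "H S f \<Longrightarrow> H S (\<lambda>x. f x ^ n)"
  by (induction n) (auto intro!: const mult)

lemmas intros = const add mult inverse uminus diff divide sum prod prod_list power

lemma isCont_at: "H S f \<Longrightarrow> open S \<Longrightarrow> x \<in> S \<Longrightarrow> (f \<longlongrightarrow> f x) (nhds x)"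
  using continuous[of S f]
  by (simp add: continuous_on_eq_continuous_at isCont_def flip: tendsto_at_iff_tendsto_nhds)

text \<open>A locally uniform ratio test: convergence along the product filter gives one bound r < 1
  for all large k and all x near \<open>x0\<close>, and continuity bounds the first term of the tail
  there, so a geometric series dominates.\<close>

lemma series_bound:
  assumes S: "open S" and f: "\<And>k. H S (f k)"
    and rec: "\<And>k x. x \<in> S \<Longrightarrow> f (Suc k) x = f k x * \<rho> k x"
    and lim: "((\<lambda>p. \<rho> (fst p) (snd p)) \<longlongrightarrow> l) (sequentially \<times>\<^sub>F nhds x0)"
    and l: "norm l < 1" and x0: "x0 \<in> S"
  obtains T M where "open T" "x0 \<in> T" "T \<subseteq> S" "summable M"
    "\<forall>\<^sub>F k in sequentially. \<forall>x\<in>T. norm (f k x) \<le> M k"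
proof -
  obtain r where r: "norm l < r" "r < 1"
    using l dense by blast
  have r0: "0 \<le> r"
    using r(1) norm_ge_zero[of l] by linarith
  have "\<forall>\<^sub>F p in sequentially \<times>\<^sub>F nhds x0. norm (\<rho> (fst p) (snd p)) < r"
    using tendsto_norm[OF lim] r(1) by (auto dest: order_tendstoD)
  then obtain P Q where P: "\<forall>\<^sub>F k in sequentially. P k" and Q: "\<forall>\<^sub>F x in nhds x0. Q x"
    and PQ: "\<And>k x. P k \<Longrightarrow> Q x \<Longrightarrow> norm (\<rho> k x) < r"
    unfolding eventually_prod_filter by auto
  obtain N where N: "\<And>k. k \<ge> N \<Longrightarrow> P k"
    using P by (auto simp: eventually_sequentially)
  define B where "B = norm (f N x0) + 1"
  have "\<forall>\<^sub>F x in nhds x0. norm (f N x) < B"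
    by (rule order_tendstoD(2)[OF tendsto_norm[OF isCont_at[OF f[of N] S x0]]]) (simp add: B_def)
  with Q have "\<forall>\<^sub>F x in nhds x0. Q x \<and> norm (f N x) < B"
    by eventually_elim simp
  then obtain T where T: "open T" "x0 \<in> T" "\<And>x. x \<in> T \<Longrightarrow> Q x \<and> norm (f N x) < B"
    by (auto simp: eventually_nhds)
  have bound: "norm (f (N + k) x) \<le> B * r ^ k" if "x \<in> T \<inter> S" for k x
  proof (induction k)
    case 0
    then show ?case using T(3)[of x] that by simp
  next
    case (Suc k)
    have "norm (\<rho> (N + k) x) \<le> r"
      using PQ[OF N[of "N + k"], of x] T(3)[of x] that by simp
    then have "norm (f (N + k) x) * norm (\<rho> (N + k) x) \<le> (B * r ^ k) * r"
      by (intro mult_mono Suc) (use r0 in \<open>auto simp: B_def\<close>)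
    then show ?case
      using that by (simp add: rec norm_mult mult_ac)
  qed
  show thesis
  proof (rule that[of "T \<inter> S" "\<lambda>k. B * r ^ (k - N)"])
    have "summable (\<lambda>k. B * r ^ k)"
      using r(2) r0 by (intro summable_mult summable_geometric) auto
    then have "summable (\<lambda>k. B * r ^ (k + N - N))"
      by simp
    then show "summable (\<lambda>k. B * r ^ (k - N))"
      by (rule summable_iff_shift[of "\<lambda>k. B * r ^ (k - N)" N, THEN iffD1])
    show "\<forall>\<^sub>F k in sequentially. \<forall>x\<in>T \<inter> S. norm (f k x) \<le> B * r ^ (k - N)"
      unfolding eventually_sequentially
    proof (intro exI allI impI ballI)
      fix k x assume "N \<le> k" "x \<in> T \<inter> S"
      then show "norm (f k x) \<le> B * r ^ (k - N)"
        using bound[of x "k - N"] by simp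
    qed
  qed (use T S x0 in auto)
qed

text \<open>Domination near each point feeds the Weierstrass M-test, and \<open>local\<close> glues
  the neighbourhoods. Assumptions on term ratios suit hypergeometric terms, whose ratios are
  explicit.\<close>

lemma series:
  assumes S: "open S" and f: "\<And>k. H S (f k)"
    and rec: "\<And>k x. x \<in> S \<Longrightarrow> f (Suc k) x = f k x * \<rho> k x"
    and lim: "\<And>x. x \<in> S \<Longrightarrow> ((\<lambda>p. \<rho> (fst p) (snd p)) \<longlongrightarrow> l x) (sequentially \<times>\<^sub>F nhds x)"
    and l: "\<And>x. x \<in> S \<Longrightarrow> norm (l x) < 1"
  shows "H S (\<lambda>x. \<Sum>k. f k x)"
proof (rule local)
  fix x0 assume x0: "x0 \<in> S"
  obtain T M where T: "open T" "x0 \<in> T" "T \<subseteq> S" "summable M"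
      "\<forall>\<^sub>F k in sequentially. \<forall>x\<in>T. norm (f k x) \<le> M k"
    by (rule series_bound[where S = S and f = f and \<rho> = \<rho> and l = "l x0" and ?x0.0 = x0])
      (use assms x0 in auto)
  have "uniform_limit T (\<lambda>n x. \<Sum>k<n. f k x) (\<lambda>x. \<Sum>k. f k x) sequentially"
    by (rule Weierstrass_m_test_ev[OF T(5,4)])
  then have "H T (\<lambda>x. \<Sum>k. f k x)"
    by (rule ulim[OF T(1) sum, rotated]) (use f T subset in blast)
  with T show "\<exists>T. open T \<and> x0 \<in> T \<and> T \<subseteq> S \<and> H T (\<lambda>x. \<Sum>k. f k x)"
    by blast
qed

end

interpretation cont: regular_functions "\<lambda>(S :: 'x::t2_space set) f. continuous_on S f"
proof
  show "continuous_on S f"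
    if *: "\<And>x. x \<in> S \<Longrightarrow> \<exists>T. open T \<and> x \<in> T \<and> T \<subseteq> S \<and> continuous_on T f"
    for S :: "'x set" and f :: "'x \<Rightarrow> complex"
    unfolding continuous_on_eq_continuous_within
  proof
    fix x assume "x \<in> S"
    then obtain T where "open T" "x \<in> T" "T \<subseteq> S" "continuous_on T f"
      using * by blast
    then have "isCont f x"
      by (simp add: continuous_on_eq_continuous_at)
    then show "continuous (at x within S) f"
      by (rule continuous_at_imp_continuous_at_within)
  qed
  show "continuous_on S g" if "open S" "\<And>n. continuous_on S (F n)"
    "uniform_limit S F g sequentially" for S :: "'x set" and F and g :: "'x \<Rightarrow> complex"
    by (rule uniform_limit_theorem[OF _ that(3)]) (use that in auto)
  show "continuous_on S g" if "continuous_on S f" "\<And>x. x \<in> S \<Longrightarrow> f x = g x"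
    for S :: "'x set" and f g :: "'x \<Rightarrow> complex"
    using that continuous_on_cong by blast
qed (auto simp: continuous_on_inverse continuous_on_add continuous_on_mult intro: continuous_on_subset)

interpretation holo: regular_functions "\<lambda>S f. f holomorphic_on S"
proof
  show "f holomorphic_on S"
    if *: "\<And>x. x \<in> S \<Longrightarrow> \<exists>T. open T \<and> x \<in> T \<and> T \<subseteq> S \<and> f holomorphic_on T"
    for S and f :: "complex \<Rightarrow> complex"
    unfolding holomorphic_on_def
  proof
    fix x assume "x \<in> S"
    then obtain T where "open T" "x \<in> T" "T \<subseteq> S" "f holomorphic_on T"
      using * by blast
    then show "f field_differentiable at x within S"
      using holomorphic_on_imp_differentiable_at field_differentiable_at_within by blast
  qed
  show "g holomorphic_on S" if S: "open S" and F: "\<And>n. F n holomorphic_on S"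
    and lim: "uniform_limit S F g sequentially" for S F and g :: "complex \<Rightarrow> complex"
  proof (rule holomorphic_uniform_sequence[OF S F])
    fix x assume "x \<in> S"
    then obtain d where "d > 0" "cball x d \<subseteq> S"
      using S open_contains_cball by blast
    then show "\<exists>d>0. cball x d \<subseteq> S \<and> uniform_limit (cball x d) F g sequentially"
      using lim uniform_limit_on_subset by blast
  qed
  show "g holomorphic_on S" if "f holomorphic_on S" "\<And>x. x \<in> S \<Longrightarrow> f x = g x"
    for S and f g :: "complex \<Rightarrow> complex"
    using that by (rule holomorphic_transform)
qed (auto simp: holomorphic_on_add holomorphic_on_mult holomorphic_on_inverse
  holomorphic_on_imp_continuous_on intro: holomorphic_on_subset)

subsection \<open>Infinite shifted factorials\<close>

text \<open>For \<open>norm q < 1\<close> this is the nonvanishing of (x; q)_infinity, see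
  \<open>qpoch_inf_eq_0_iff\<close>, in a form that is visibly stable under x -> x q.\<close>

definition nonres :: "complex \<Rightarrow> complex \<Rightarrow> bool" where
  "nonres q x \<longleftrightarrow> (\<forall>n. x * q ^ n \<noteq> 1)"

lemma nonres_mult_power: "nonres q x \<Longrightarrow> nonres q (x * q ^ k)"
  by (simp add: nonres_def mult.assoc flip: power_add)

lemma nonres_mult: "nonres q x \<Longrightarrow> nonres q (x * q)"
  using nonres_mult_power[of q x 1] by simp

lemma nonres_imp: "nonres q x \<Longrightarrow> x * q ^ n \<noteq> 1"
  by (simp add: nonres_def)

lemma nonres_neq_1: "nonres q x \<Longrightarrow> x \<noteq> 1"
  using nonres_imp[of q x 0] by simp

lemma nonres_norm_less_1:
  assumes "norm q < 1" "norm x < 1"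
  shows "nonres q x"
  unfolding nonres_def
proof
  fix n
  have "norm x * norm q ^ n \<le> norm x * 1"
    using assms by (intro mult_left_mono power_le_one) auto
  then show "x * q ^ n \<noteq> 1"
    using assms by (metis less_le_not_le mult.right_neutral norm_mult norm_one norm_power order_le_less_trans)
qed

lemma qpoch_0 [simp]: "qpoch q x 0 = 1"
  by (simp add: qpoch_def)

lemma qpoch_Suc: "qpoch q x (Suc k) = qpoch q x k * (1 - x * q ^ k)"
  by (simp add: qpoch_def)

lemma qpoch_Suc_shift: "qpoch q x (Suc k) = (1 - x) * qpoch q (x * q) k"
  unfolding qpoch_def by (subst prod.lessThan_Suc_shift) (simp add: mult_ac)

lemma qpoch_nonzero: "nonres q x \<Longrightarrow> qpoch q x k \<noteq> 0"
  by (auto simp: qpoch_def nonres_def)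

lemma qpoch_1: "k > 0 \<Longrightarrow> qpoch q 1 k = 0"
  by (cases k) (auto simp: qpoch_Suc_shift)

lemma qpochs_0 [simp]: "qpochs q xs 0 = 1"
  by (induction xs) (auto simp: qpochs_def)

lemma qpochs_Nil [simp]: "qpochs q [] k = 1"
  by (simp add: qpochs_def)

lemma qpochs_Cons [simp]: "qpochs q (x # xs) k = qpoch q x k * qpochs q xs k"
  by (simp add: qpochs_def)

lemma qpochs_inf_Nil [simp]: "qpochs_inf q [] = 1"
  by (simp add: qpochs_inf_def)

lemma qpochs_inf_Cons [simp]: "qpochs_inf q (x # xs) = qpoch_inf q x * qpochs_inf q xs"
  by (simp add: qpochs_inf_def)

lemma qpochs_Suc: "qpochs q xs (Suc k) = qpochs q xs k * (\<Prod>x\<leftarrow>xs. 1 - x * q ^ k)"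
  by (induction xs) (auto simp: qpoch_Suc)

lemma qpochs_nonzero: "\<forall>x\<in>set xs. nonres q x \<Longrightarrow> qpochs q xs k \<noteq> 0"
  by (induction xs) (auto simp: qpoch_nonzero)

lemma convergent_prod_qpoch:
  fixes q x :: complex
  assumes "norm q < 1"
  shows "convergent_prod (\<lambda>j. 1 - x * q ^ j)"
proof -
  have "summable (\<lambda>j. norm x * norm q ^ j)"
    using assms by (intro summable_mult summable_geometric) auto
  then have "summable (\<lambda>j. norm (1 - x * q ^ j - 1))"
    by (simp add: norm_mult norm_power)
  then show ?thesis
    using abs_convergent_prod_conv_summable abs_convergent_prod_imp_convergent_prod by blast
qed

lemma qpoch_tendsto:
  assumes "norm q < 1"
  shows "qpoch q x \<longlonglongrightarrow> qpoch_inf q x"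
  using convergent_prod_LIMSEQ[OF convergent_prod_qpoch[OF assms]]
  unfolding qpoch_def[abs_def] qpoch_inf_def LIMSEQ_lessThan_iff_atMost by blast

lemma qpoch_inf_rec:
  assumes "norm q < 1"
  shows "qpoch_inf q x = (1 - x) * qpoch_inf q (x * q)"
proof (rule LIMSEQ_unique)
  show "(\<lambda>n. qpoch q x (Suc n)) \<longlonglongrightarrow> qpoch_inf q x"
    using qpoch_tendsto[OF assms] by (rule LIMSEQ_Suc)
  show "(\<lambda>n. qpoch q x (Suc n)) \<longlonglongrightarrow> (1 - x) * qpoch_inf q (x * q)"
    unfolding qpoch_Suc_shift by (intro tendsto_mult tendsto_const qpoch_tendsto assms)
qed

lemma qpoch_inf_eq_0_iff:
  assumes "norm q < 1"
  shows "qpoch_inf q x = 0 \<longleftrightarrow> \<not> nonres q x"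
proof
  show "\<not> nonres q x" if "qpoch_inf q x = 0"
    using that prodinf_nonzero[OF convergent_prod_qpoch[OF assms], of x]
    by (auto simp: qpoch_inf_def nonres_def)
  show "qpoch_inf q x = 0" if nonres: "\<not> nonres q x"
  proof -
    obtain n where n: "x * q ^ n = 1"
      using nonres unfolding nonres_def by blast
    have "\<forall>\<^sub>F k in sequentially. qpoch q x k = 0"
      using eventually_gt_at_top[of n] by eventually_elim (use n in \<open>auto simp: qpoch_def intro!: bexI[of _ n]\<close>)
    then have "qpoch q x \<longlonglongrightarrow> 0"
      by (rule tendsto_eventually)
    then show ?thesis
      using LIMSEQ_unique qpoch_tendsto[OF assms] by blast
  qed
qed

lemma tendsto_one_minus_power:
  fixes u :: "'x::topological_space \<Rightarrow> complex"
  assumes "norm q < 1" "(u \<longlongrightarrow> c) (nhds x0)"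
  shows "((\<lambda>p. 1 - u (snd p) * q ^ fst p) \<longlongrightarrow> 1) (sequentially \<times>\<^sub>F nhds x0)"
proof -
  have "((\<lambda>p. 1 - u (snd p) * q ^ fst p) \<longlongrightarrow> 1 - c * 0) (sequentially \<times>\<^sub>F nhds x0)"
    by (intro tendsto_intros filterlim_compose[OF assms(2) filterlim_snd]
        filterlim_compose[OF LIMSEQ_power_zero filterlim_fst] assms)
  then show ?thesis by simp
qed

context regular_functions
begin

lemma qpoch: "H S u \<Longrightarrow> H S (\<lambda>x. qpoch q (u x) k)"
  unfolding qpoch_def by (intro intros)

text \<open>The product is rewritten as the telescoping series of the differences (u)_{k+1} - (u)_k
  = - u q^k (u)_k. Their ratio tends to q, so \<open>series\<close> applies.\<close>

lemma qpoch_inf: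
  assumes q: "norm q < 1" and S: "open S" and u: "H S u"
  shows "H S (\<lambda>x. qpoch_inf q (u x))"
proof -
  define f where "f = (\<lambda>k x. - (u x * q ^ k) * qpoch q (u x) k)"
  have "H S (\<lambda>x. \<Sum>k. f k x)"
  proof (rule series[OF S])
    show "H S (f k)" for k
      unfolding f_def by (intro intros qpoch u)
    show "f (Suc k) x = f k x * (q * (1 - u x * q ^ k))" for k x
      by (simp add: f_def qpoch_Suc)
    show "((\<lambda>p. q * (1 - u (snd p) * q ^ fst p)) \<longlongrightarrow> q) (sequentially \<times>\<^sub>F nhds x)"
      if "x \<in> S" for x
      using tendsto_mult_left[OF tendsto_one_minus_power[OF q isCont_at[OF u S that]], of q] by simp
  qed (use q in auto)
  moreover have "(\<Sum>k. f k x) = qpoch_inf q (u x) - 1" for x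
  proof -
    have "f k x = qpoch q (u x) (Suc k) - qpoch q (u x) k" for k
      by (simp add: f_def qpoch_Suc algebra_simps)
    then have "(\<lambda>k. f k x) sums (qpoch_inf q (u x) - qpoch q (u x) 0)"
      using telescope_sums[OF qpoch_tendsto[OF q]] by presburger
    then show ?thesis
      by (simp add: sums_unique[symmetric])
  qed
  ultimately have "H S (\<lambda>x. (qpoch_inf q (u x) - 1) + 1)"
    by (intro add const) simp
  then show ?thesis by simp
qed

end

text \<open>The excluded points are exactly the zeros of the continuous function (x;
  q)_infinity.\<close>

lemma open_nonres:
  assumes "norm q < 1"
  shows "open {x. nonres q x}"
proof -
  have "continuous_on UNIV (\<lambda>x. qpoch_inf q x)"
    by (rule cont.qpoch_inf[OF assms]) auto
  then have "open {x. qpoch_inf q x \<noteq> 0}"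
    by (intro open_Collect_neq continuous_intros)
  then show ?thesis
    by (simp add: qpoch_inf_eq_0_iff[OF assms])
qed

subsection \<open>Analytic continuation of basic hypergeometric series in the argument\<close>

text \<open>The factor (q)_k of a basic hypergeometric series is not built in; it is one of the
  entries of \<open>ws\<close>, whence the later assumption that \<open>q\<close> occurs in
  \<open>ws\<close>.\<close>

definition hyp :: "complex \<Rightarrow> complex list \<Rightarrow> complex list \<Rightarrow> complex \<Rightarrow> complex" where
  "hyp q us ws z = (\<Sum>k. qpochs q us k / qpochs q ws k * z ^ k)"

lemma hyp_ratio_tendsto:
  fixes us ws :: "('x::topological_space \<Rightarrow> complex) list"
  assumes q: "norm q < 1"
    and us: "\<And>u. u \<in> set us \<Longrightarrow> (u \<longlongrightarrow> u x0) (nhds x0)"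
    and ws: "\<And>w. w \<in> set ws \<Longrightarrow> (w \<longlongrightarrow> w x0) (nhds x0)"
    and z: "(z \<longlongrightarrow> z x0) (nhds x0)"
  shows "((\<lambda>p. (\<Prod>u\<leftarrow>us. 1 - u (snd p) * q ^ fst p) / (\<Prod>w\<leftarrow>ws. 1 - w (snd p) * q ^ fst p) * z (snd p))
    \<longlongrightarrow> z x0) (sequentially \<times>\<^sub>F nhds x0)"
proof -
  have *: "((\<lambda>p. \<Prod>u\<leftarrow>vs. 1 - u (snd p) * q ^ fst p) \<longlongrightarrow> 1) (sequentially \<times>\<^sub>F nhds x0)"
    if "\<And>u. u \<in> set vs \<Longrightarrow> (u \<longlongrightarrow> u x0) (nhds x0)" for vs :: "('x \<Rightarrow> complex) list"
    using that
  proof (induction vs)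
    case (Cons u vs)
    have "((\<lambda>p. (1 - u (snd p) * q ^ fst p) * (\<Prod>u\<leftarrow>vs. 1 - u (snd p) * q ^ fst p)) \<longlongrightarrow> 1 * 1)
        (sequentially \<times>\<^sub>F nhds x0)"
      by (intro tendsto_mult tendsto_one_minus_power[OF q] Cons) (use Cons in auto)
    then show ?case by simp
  qed auto
  have "((\<lambda>p. (\<Prod>u\<leftarrow>us. 1 - u (snd p) * q ^ fst p) / (\<Prod>w\<leftarrow>ws. 1 - w (snd p) * q ^ fst p) * z (snd p))
    \<longlongrightarrow> 1 / 1 * z x0) (sequentially \<times>\<^sub>F nhds x0)"
    by (intro tendsto_mult tendsto_divide * filterlim_compose[OF z filterlim_snd] us ws) auto
  then show ?thesis by simp
qed

context regular_functions
begin

lemma qpochs: "(\<And>u. u \<in> set us \<Longrightarrow> H S u) \<Longrightarrow> H S (\<lambda>x. qpochs q (map (\<lambda>u. u x) us) k)"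
  unfolding qpochs_def map_map o_def by (intro intros qpoch)

lemma hyp:
  assumes q: "norm q < 1" and S: "open S"
    and us: "\<And>u. u \<in> set us \<Longrightarrow> H S u"
    and ws: "\<And>w. w \<in> set ws \<Longrightarrow> H S w"
    and ws_nonres: "\<And>w x. w \<in> set ws \<Longrightarrow> x \<in> S \<Longrightarrow> nonres q (w x)"
    and z: "H S z" and z_less: "\<And>x. x \<in> S \<Longrightarrow> norm (z x) < 1"
  shows "H S (\<lambda>x. hyp q (map (\<lambda>u. u x) us) (map (\<lambda>w. w x) ws) (z x))"
  unfolding hyp_def
proof (rule series[OF S])
  show "H S (\<lambda>x. qpochs q (map (\<lambda>u. u x) us) k / qpochs q (map (\<lambda>w. w x) ws) k * z x ^ k)" for k
    by (intro mult divide power z qpochs qpochs_nonzero) (use us ws ws_nonres in auto)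
  show "qpochs q (map (\<lambda>u. u x) us) (Suc k) / qpochs q (map (\<lambda>w. w x) ws) (Suc k) * z x ^ Suc k
    = qpochs q (map (\<lambda>u. u x) us) k / qpochs q (map (\<lambda>w. w x) ws) k * z x ^ k *
      ((\<Prod>u\<leftarrow>us. 1 - u x * q ^ k) / (\<Prod>w\<leftarrow>ws. 1 - w x * q ^ k) * z x)" for k x
    by (simp add: qpochs_Suc o_def)
  show "((\<lambda>p. (\<Prod>u\<leftarrow>us. 1 - u (snd p) * q ^ fst p) / (\<Prod>w\<leftarrow>ws. 1 - w (snd p) * q ^ fst p) * z (snd p))
    \<longlongrightarrow> z x) (sequentially \<times>\<^sub>F nhds x)" if "x \<in> S" for x
    by (intro hyp_ratio_tendsto q isCont_at[OF _ S that] z) (use us ws in auto)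
qed (use z_less in auto)

end

lemma hyp_abs_summable:
  assumes q: "norm q < 1" and ws: "\<forall>w\<in>set ws. nonres q w" and z: "norm z < 1"
  shows "summable (\<lambda>k. norm (qpochs q us k / qpochs q ws k * z ^ k))"
proof -
  \<comment> \<open>The parameters are read as constant functions of a dummy variable, so that the
    locally uniform bound at 0 becomes an ordinary comparison test.\<close>
  have lim: "((\<lambda>p. (\<Prod>u\<leftarrow>map (\<lambda>u _. u) us. 1 - u (snd p) * q ^ fst p) /
      (\<Prod>w\<leftarrow>map (\<lambda>w _. w) ws. 1 - w (snd p) * q ^ fst p) * (\<lambda>_. z) (snd p)) \<longlongrightarrow> z)
      (sequentially \<times>\<^sub>F nhds (0 :: complex))"
    by (rule hyp_ratio_tendsto[OF q, where z = "\<lambda>_. z"]) auto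
  define f where "f = (\<lambda>k (_ :: complex). qpochs q us k / qpochs q ws k * z ^ k)"
  have rec: "f (Suc k) x = f k x * ((\<Prod>u\<leftarrow>map (\<lambda>u _. u) us. 1 - u x * q ^ k) /
      (\<Prod>w\<leftarrow>map (\<lambda>w _. w) ws. 1 - w x * q ^ k) * (\<lambda>_. z) x)" for k and x :: complex
    by (simp add: f_def qpochs_Suc o_def)
  have "continuous_on UNIV (f k)" for k
    unfolding f_def by (rule continuous_on_const)
  then obtain T M where TM: "0 \<in> T" "summable M" "\<forall>\<^sub>F k in sequentially. \<forall>x\<in>T. norm (f k x) \<le> M k"
    by (rule cont.series_bound[where f = f, OF open_UNIV _ rec lim z UNIV_I])
  have "\<forall>\<^sub>F k in sequentially. norm (norm (f k 0)) \<le> M k"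
    using TM(3) by eventually_elim (use TM(1) in auto)
  then have "summable (\<lambda>k. norm (f k 0))"
    using TM(2) by (rule summable_comparison_test_ev)
  then show ?thesis
    unfolding f_def .
qed

lemmas hyp_summable = summable_norm_cancel[OF hyp_abs_summable]

text \<open>At q^k this polynomial gives the numerator or denominator of the k-th term ratio;
  expanding it in powers of q^k turns each power into a shift z -> z q^i of the argument.\<close>

definition lin :: "complex list \<Rightarrow> complex poly" where
  "lin us = (\<Prod>u\<leftarrow>us. [:1, - u:])"

lemma lin_Nil [simp]: "lin [] = 1"
  by (simp add: lin_def)

lemma lin_Cons [simp]: "lin (u # us) = [:1, - u:] * lin us"
  by (simp add: lin_def)

lemma poly_lin: "poly (lin us) y = (\<Prod>u\<leftarrow>us. 1 - u * y)"
  by (induction us) (simp_all add: algebra_simps)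

lemma coeff_lin_0: "coeff (lin us) 0 = 1"
  by (induction us) (simp_all add: coeff_mult)

lemma degree_lin: "degree (lin us) \<le> length us"
proof (induction us)
  case (Cons u us)
  then show ?case
    using degree_mult_le[of "[:1, - u:]" "lin us"]
    by (simp only: lin_Cons length_Cons) (simp split: if_splits)
qed auto

lemma poly_eq_sum_coeff:
  fixes p :: "complex poly"
  assumes "degree p \<le> m"
  shows "poly p y = (\<Sum>i\<le>m. coeff p i * y ^ i)"
proof -
  have "poly p y = poly (\<Sum>i\<le>m. monom (coeff p i) i) y"
    by (simp only: poly_as_sum_of_monoms'[OF assms])
  also have "\<dots> = (\<Sum>i\<le>m. coeff p i * y ^ i)"
    by (simp only: poly_sum poly_monom)
  finally show ?thesis .
qed

lemma (in regular_functions) coeff_lin: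
  "(\<And>u. u \<in> set us \<Longrightarrow> H S u) \<Longrightarrow> H S (\<lambda>x. coeff (lin (map (\<lambda>u. u x) us)) i)"
proof (induction us arbitrary: i)
  case (Cons u us)
  have "H S (\<lambda>x. coeff (lin (map (\<lambda>u. u x) us)) i - u x *
      (case i of 0 \<Rightarrow> 0 | Suc j \<Rightarrow> coeff (lin (map (\<lambda>u. u x) us)) j))"
    using Cons by (cases i) (auto intro!: intros)
  then show ?case
    by (cases i) (simp_all add: coeff_pCons)
qed (auto intro: const)

text \<open>Multiply the recurrence of the coefficients, c (k+1) times the product of 1 - w q^k
  equals c k times the product of 1 - u q^k, by z^(k+1) and sum over k. Both polynomials have
  constant coefficient 1, so the terms with i = 0 combine to the factor 1 - z.\<close>

lemma hyp_functional_equation: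
  assumes q: "norm q < 1" "q \<noteq> 0" and ws: "q \<in> set ws" "\<forall>w\<in>set ws. nonres q w" and z: "norm z < 1"
    and m: "m = length us + length ws"
  shows "(1 - z) * hyp q us ws z = (\<Sum>i=1..m.
    (z * coeff (lin us) i - coeff (lin (map (\<lambda>w. w / q) ws)) i) * hyp q us ws (z * q ^ i))"
proof -
  define c where "c = (\<lambda>k. qpochs q us k / qpochs q ws k)"
  define ls where "ls = map (\<lambda>w. w / q) ws"
  have hyp: "(\<lambda>k. c k * z ^ k * (q ^ k) ^ i) sums hyp q us ws (z * q ^ i)" for i
  proof -
    have "norm (z * q ^ i) \<le> norm z * 1"
      unfolding norm_mult norm_power using q by (intro mult_left_mono power_le_one) auto
    with z have "norm (z * q ^ i) < 1" by simp
    from summable_sums[OF hyp_summable[OF q(1) ws(2) this]] show ?thesis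
      by (simp add: hyp_def c_def power_mult_distrib mult_ac flip: power_mult)
  qed
  have poly: "(\<lambda>k. c k * z ^ k * poly p (q ^ k)) sums (\<Sum>i\<le>m. coeff p i * hyp q us ws (z * q ^ i))"
    if "degree p \<le> m" for p
  proof -
    have "(\<lambda>k. \<Sum>i\<le>m. coeff p i * (c k * z ^ k * (q ^ k) ^ i)) sums
        (\<Sum>i\<le>m. coeff p i * hyp q us ws (z * q ^ i))"
      by (intro sums_sum sums_mult hyp)
    then show ?thesis
      by (simp add: poly_eq_sum_coeff[OF that] sum_distrib_left mult_ac)
  qed
  have deg: "degree (lin us) \<le> m" "degree (lin ls) \<le> m"
    using degree_lin[of us] degree_lin[of ls] by (auto simp: m ls_def)
  have "(\<lambda>k. z * (c k * z ^ k * poly (lin us) (q ^ k))) sums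
      (z * (\<Sum>i\<le>m. coeff (lin us) i * hyp q us ws (z * q ^ i)))"
    by (intro sums_mult poly deg)
  \<comment> \<open>Dividing the entries of \<open>ws\<close> by q moves the second polynomial to
    the point q^(k+1), so that the right-hand side depends on k + 1 only.\<close>
  moreover have "z * (c k * z ^ k * poly (lin us) (q ^ k)) = c (Suc k) * z ^ Suc k * poly (lin ls) (q ^ Suc k)" for k
  proof -
    have "poly (lin ls) (q ^ Suc k) = (\<Prod>w\<leftarrow>ws. 1 - w * q ^ k)"
      using q(2) by (simp add: poly_lin ls_def o_def)
    moreover from this have "(\<Prod>w\<leftarrow>ws. 1 - w * q ^ k) \<noteq> 0"
      using ws(2) by (auto simp: prod_list_zero_iff nonres_def)
    moreover have "qpochs q ws k \<noteq> 0"
      by (rule qpochs_nonzero[OF ws(2)])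
    ultimately show ?thesis
      by (simp add: c_def qpochs_Suc poly_lin)
  qed
  ultimately have "(\<lambda>k. c (Suc k) * z ^ Suc k * poly (lin ls) (q ^ Suc k)) sums
      (z * (\<Sum>i\<le>m. coeff (lin us) i * hyp q us ws (z * q ^ i)))"
    by simp
  then have "(\<lambda>k. c k * z ^ k * poly (lin ls) (q ^ k)) sums
      (z * (\<Sum>i\<le>m. coeff (lin us) i * hyp q us ws (z * q ^ i)) + c 0 * z ^ 0 * poly (lin ls) (q ^ 0))"
    by (rule sums_Suc_iff[THEN iffD1])
  \<comment> \<open>The term k = 0, restored by the index shift, vanishes: the entry
    \<open>q\<close> of \<open>ws\<close> contributes the factor 1 - q/q.\<close>
  moreover have "poly (lin ls) 1 = 0"
    using ws(1) q(2) by (auto simp: poly_lin prod_list_zero_iff ls_def image_iff)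
  ultimately have "z * (\<Sum>i\<le>m. coeff (lin us) i * hyp q us ws (z * q ^ i)) =
      (\<Sum>i\<le>m. coeff (lin ls) i * hyp q us ws (z * q ^ i))"
    using poly[OF deg(2)] by (auto dest: sums_unique2)
  then have "(\<Sum>i\<le>m. (z * coeff (lin us) i - coeff (lin ls) i) * hyp q us ws (z * q ^ i)) = 0"
    by (simp add: sum_distrib_left left_diff_distrib sum_subtractf mult.assoc)
  moreover have "{..m} = insert 0 {1..m}"
    by auto
  ultimately show ?thesis
    by (simp add: coeff_lin_0 ls_def algebra_simps)
qed

text \<open>The functional equation extends the disc of definition by a factor \<open>1 / norm q\<close>.\<close>

primrec hyp_ext :: "nat \<Rightarrow> complex \<Rightarrow> complex list \<Rightarrow> complex list \<Rightarrow> complex \<Rightarrow> complex" where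
  "hyp_ext 0 q us ws z = hyp q us ws z"
| "hyp_ext (Suc n) q us ws z = (\<Sum>i=1..length us + length ws.
    (z * coeff (lin us) i - coeff (lin (map (\<lambda>w. w / q) ws)) i) * hyp_ext n q us ws (z * q ^ i)) / (1 - z)"

lemma norm_mult_power_less:
  fixes q z :: complex
  assumes "norm z * norm q ^ Suc n < 1" "norm q < 1" "1 \<le> i"
  shows "norm (z * q ^ i) * norm q ^ n < 1"
proof -
  have "norm z * norm q ^ (i + n) \<le> norm z * norm q ^ Suc n"
    using assms by (intro mult_left_mono power_decreasing) auto
  then show ?thesis
    using assms by (simp add: norm_mult norm_power power_add mult_ac)
qed

text \<open>For n = 0 this is the functional equation itself. Later, both sides are the same
  combination of values at z q^i with i at least 1, where one step fewer is enough.\<close>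

lemma hyp_ext_Suc_eq:
  assumes q: "norm q < 1" "q \<noteq> 0" and ws: "q \<in> set ws" "\<forall>w\<in>set ws. nonres q w"
  shows "norm z * norm q ^ n < 1 \<Longrightarrow> nonres q z \<Longrightarrow> hyp_ext (Suc n) q us ws z = hyp_ext n q us ws z"
proof (induction n arbitrary: z)
  case 0
  then have "(1 - z) \<noteq> 0"
    using nonres_neq_1 by auto
  then show ?case
    using hyp_functional_equation[OF q ws _ refl, of z us] 0 by (simp add: divide_eq_eq mult.commute)
next
  case (Suc n)
  have "hyp_ext (Suc n) q us ws (z * q ^ i) = hyp_ext n q us ws (z * q ^ i)" if "1 \<le> i" for i
    by (rule Suc.IH[OF norm_mult_power_less[OF Suc.prems(1) q(1) that]
          nonres_mult_power[OF Suc.prems(2)]])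
  then show ?case
    unfolding hyp_ext.simps(2)[of "Suc n"] hyp_ext.simps(2)[of n q us ws z]
    by (intro arg_cong2[where f = "(/)"] sum.cong) (auto simp del: hyp_ext.simps)
qed

lemma hyp_ext_eq:
  assumes q: "norm q < 1" "q \<noteq> 0" and ws: "q \<in> set ws" "\<forall>w\<in>set ws. nonres q w"
    and z: "norm z * norm q ^ n < 1" "nonres q z" and le: "n \<le> m"
  shows "hyp_ext m q us ws z = hyp_ext n q us ws z"
  using le
proof (induction m rule: dec_induct)
  case (step m)
  have "norm z * norm q ^ m \<le> norm z * norm q ^ n"
    using q step by (intro mult_left_mono power_decreasing) auto
  then have "hyp_ext (Suc m) q us ws z = hyp_ext m q us ws z"
    using z by (intro hyp_ext_Suc_eq q ws) auto
  with step show ?case by simp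
qed simp

text \<open>Away from the poles every sufficiently large number of steps gives the same value, see
  \<open>hypc_eq_hyp_ext\<close>; the least one is just a canonical choice.\<close>

definition hypc :: "complex \<Rightarrow> complex list \<Rightarrow> complex list \<Rightarrow> complex \<Rightarrow> complex" where
  "hypc q us ws z = hyp_ext (LEAST n. norm z * norm q ^ n < 1) q us ws z"

lemma hypc_eq_hyp_ext:
  assumes q: "norm q < 1" "q \<noteq> 0" and ws: "q \<in> set ws" "\<forall>w\<in>set ws. nonres q w"
    and z: "norm z * norm q ^ n < 1" "nonres q z"
  shows "hypc q us ws z = hyp_ext n q us ws z"
  unfolding hypc_def
  by (rule hyp_ext_eq[OF q ws _ z(2), symmetric])
    (rule LeastI[of "\<lambda>n. norm z * norm q ^ n < 1", OF z(1)], rule Least_le, rule z(1))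

lemma hypc_eq_hyp:
  assumes "norm q < 1" "q \<noteq> 0" "q \<in> set ws" "\<forall>w\<in>set ws. nonres q w" "norm z < 1"
  shows "hypc q us ws z = hyp q us ws z"
  using hypc_eq_hyp_ext[OF assms(1-4), of z 0] assms nonres_norm_less_1 by simp

context regular_functions
begin

lemma hyp_ext:
  assumes q: "norm q < 1" "q \<noteq> 0" and S: "open S"
    and us: "\<And>u. u \<in> set us \<Longrightarrow> H S u"
    and ws: "\<And>w. w \<in> set ws \<Longrightarrow> H S w"
    and ws_nonres: "\<And>w x. w \<in> set ws \<Longrightarrow> x \<in> S \<Longrightarrow> nonres q (w x)"
  shows "H S z \<Longrightarrow> (\<And>x. x \<in> S \<Longrightarrow> norm (z x) * norm q ^ n < 1) \<Longrightarrow> (\<And>x. x \<in> S \<Longrightarrow> nonres q (z x)) \<Longrightarrow>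
    H S (\<lambda>x. hyp_ext n q (map (\<lambda>u. u x) us) (map (\<lambda>w. w x) ws) (z x))"
proof (induction n arbitrary: z)
  case 0
  then show ?case
    unfolding hyp_ext.simps by (intro hyp) (use q S us ws ws_nonres in auto)
next
  case (Suc n)
  have IH: "H S (\<lambda>x. hyp_ext n q (map (\<lambda>u. u x) us) (map (\<lambda>w. w x) ws) (z x * q ^ i))" if "1 \<le> i" for i
    by (rule Suc.IH[OF mult[OF Suc.prems(1) const] norm_mult_power_less[OF Suc.prems(2) q(1) that]
          nonres_mult_power[OF Suc.prems(3)]])
  have ls: "map (\<lambda>w. w / q) (map (\<lambda>w. w x) ws) = map (\<lambda>w. w x) (map (\<lambda>w x. w x / q) ws)" for x
    by simp
  have "H S (\<lambda>x. coeff (lin (map (\<lambda>w. w / q) (map (\<lambda>w. w x) ws))) i)" for i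
    unfolding ls by (rule coeff_lin) (use q(2) ws in \<open>auto intro!: divide const\<close>)
  moreover have "1 - z x \<noteq> 0" if "x \<in> S" for x
    using Suc.prems(3)[OF that] nonres_neq_1 by auto
  ultimately show ?case
    unfolding hyp_ext.simps length_map
    by (intro divide sum mult diff const Suc.prems(1) coeff_lin IH) (use us in auto)
qed

text \<open>The least number of steps may jump with the argument, but a fixed n that works at a
  point works near it, and there \<open>hypc\<close> coincides with
  \<open>hyp_ext n\<close>.\<close>

lemma hypc:
  assumes q: "norm q < 1" "q \<noteq> 0" and S: "open S"
    and us: "\<And>u. u \<in> set us \<Longrightarrow> H S u"
    and ws: "\<And>w. w \<in> set ws \<Longrightarrow> H S w"
    and ws_nonres: "\<And>w x. w \<in> set ws \<Longrightarrow> x \<in> S \<Longrightarrow> nonres q (w x)"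
    and ws_q: "(\<lambda>_. q) \<in> set ws"
    and z: "H S z" and z_nonres: "\<And>x. x \<in> S \<Longrightarrow> nonres q (z x)"
  shows "H S (\<lambda>x. hypc q (map (\<lambda>u. u x) us) (map (\<lambda>w. w x) ws) (z x))"
proof (rule local)
  fix x0 assume x0: "x0 \<in> S"
  have "(\<lambda>n. norm (z x0) * norm q ^ n) \<longlonglongrightarrow> norm (z x0) * 0"
    using q by (intro tendsto_intros LIMSEQ_power_zero) auto
  then have "\<forall>\<^sub>F n in sequentially. norm (z x0) * norm q ^ n < 1"
    by (rule order_tendstoD) simp
  then obtain n where n: "norm (z x0) * norm q ^ n < 1"
    using eventually_happens'[OF sequentially_bot] by blast
  have "((\<lambda>x. norm (z x) * norm q ^ n) \<longlongrightarrow> norm (z x0) * norm q ^ n) (nhds x0)"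
    by (intro tendsto_intros isCont_at[OF z S x0])
  then have "\<forall>\<^sub>F x in nhds x0. norm (z x) * norm q ^ n < 1"
    by (rule order_tendstoD) (rule n)
  then obtain T where T: "open T" "x0 \<in> T" "\<And>x. x \<in> T \<Longrightarrow> norm (z x) * norm q ^ n < 1"
    by (auto simp: eventually_nhds)
  have "H (T \<inter> S) (\<lambda>x. hyp_ext n q (map (\<lambda>u. u x) us) (map (\<lambda>w. w x) ws) (z x))"
    by (rule hyp_ext) (use q S T ws_nonres z_nonres in \<open>auto intro: subset[OF us] subset[OF ws] subset[OF z]\<close>)
  then have "H (T \<inter> S) (\<lambda>x. hypc q (map (\<lambda>u. u x) us) (map (\<lambda>w. w x) ws) (z x))"
  proof (rule cong)
    fix x assume x: "x \<in> T \<inter> S"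
    have "q \<in> set (map (\<lambda>w. w x) ws)"
      using ws_q by force
    then show "hyp_ext n q (map (\<lambda>u. u x) us) (map (\<lambda>w. w x) ws) (z x) =
        hypc q (map (\<lambda>u. u x) us) (map (\<lambda>w. w x) ws) (z x)"
      using x T(3) z_nonres ws_nonres by (intro hypc_eq_hyp_ext[symmetric] q) auto
  qed
  with S T x0 show "\<exists>T. open T \<and> x0 \<in> T \<and> T \<subseteq> S \<and>
      H T (\<lambda>x. hypc q (map (\<lambda>u. u x) us) (map (\<lambda>w. w x) ws) (z x))"
    by (intro exI[of _ "T \<inter> S"]) auto
qed

end

subsection \<open>Existence of the continued very-well-poised series\<close>

lemma W87_dom_iff:
  "(a, b, c, d, e, f) \<in> W87_dom q \<longleftrightarrow> a \<noteq> 0 \<and> a \<noteq> 1 \<and>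
    (\<forall>p\<in>{b, c, d, e, f}. p \<noteq> 0 \<and> nonres q (a * q / p)) \<and> nonres q (vwp_arg q a [b, c, d, e, f])"
  by (auto simp: W87_dom_def nonres_def)

lemma open_W87_dom:
  assumes q: "norm q < 1"
  shows "open (W87_dom q)"
proof -
  \<comment> \<open>The conditions that keep denominators nonzero are separated: on
    \<open>D0\<close> the quotients are continuous, and the remaining conditions are open preimages
    under them.\<close>
  define D0 :: "params set" where "D0 = {x. fst x \<noteq> 0 \<and> fst x \<noteq> 1 \<and> fst (snd x) \<noteq> 0 \<and>
    fst (snd (snd x)) \<noteq> 0 \<and> fst (snd (snd (snd x))) \<noteq> 0 \<and> fst (snd (snd (snd (snd x)))) \<noteq> 0 \<and>
    snd (snd (snd (snd (snd x)))) \<noteq> 0}"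
  have D0: "open D0"
    unfolding D0_def by (intro open_Collect_conj open_Collect_neq continuous_intros)
  define N where "N = (\<lambda>h. D0 \<inter> h -` {x. nonres q x})"
  have N: "open (N h)" if "continuous_on D0 h" for h
    unfolding N_def by (rule continuous_open_preimage[OF that D0 open_nonres[OF q]])
  have "W87_dom q =
      N (\<lambda>x. fst x * q / fst (snd x)) \<inter>
      N (\<lambda>x. fst x * q / fst (snd (snd x))) \<inter>
      N (\<lambda>x. fst x * q / fst (snd (snd (snd x)))) \<inter>
      N (\<lambda>x. fst x * q / fst (snd (snd (snd (snd x))))) \<inter>
      N (\<lambda>x. fst x * q / snd (snd (snd (snd (snd x))))) \<inter>
      N (\<lambda>x. (fst x)\<^sup>2 * q\<^sup>2 / (fst (snd x) * (fst (snd (snd x)) * (fst (snd (snd (snd x))) *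
        (fst (snd (snd (snd (snd x)))) * snd (snd (snd (snd (snd x)))))))))" (is "_ = ?R")
  proof (rule set_eqI)
    fix x :: params
    obtain a b c d e f where x: "x = (a, b, c, d, e, f)"
      by (metis prod.exhaust)
    show "x \<in> W87_dom q \<longleftrightarrow> x \<in> ?R"
      unfolding x W87_dom_iff by (auto simp: N_def D0_def vwp_arg_def)
  qed
  moreover have "\<forall>x\<in>D0. fst (snd x) \<noteq> 0" "\<forall>x\<in>D0. fst (snd (snd x)) \<noteq> 0"
    "\<forall>x\<in>D0. fst (snd (snd (snd x))) \<noteq> 0" "\<forall>x\<in>D0. fst (snd (snd (snd (snd x)))) \<noteq> 0"
    "\<forall>x\<in>D0. snd (snd (snd (snd (snd x)))) \<noteq> 0"
    by (simp_all add: D0_def)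
  moreover from this have "open ?R"
    by (intro open_Int N continuous_on_divide continuous_on_mult continuous_on_power
        continuous_on_fst continuous_on_snd continuous_on_id continuous_on_const) auto
  ultimately show ?thesis by simp
qed

text \<open>The factor 1 - a q^(2k) splits the very-well-poised series into two plain ones with
  arguments z and z q^2, and each is continued separately.\<close>

definition vwp_cont :: "complex \<Rightarrow> params \<Rightarrow> complex" where
  "vwp_cont q = (\<lambda>(a, b, c, d, e, f).
     let ps = [b, c, d, e, f]; us = a # ps; ws = q # map (\<lambda>p. a * q / p) ps; z = vwp_arg q a ps
     in (hypc q us ws z - a * hypc q us ws (z * q\<^sup>2)) / (1 - a))"

text \<open>The parameters are functions of one variable x, so the same statement yields joint
  continuity (x the tuple, with projections) and holomorphy of slices (one entry moving).\<close>

lemma (in regular_functions) vwp_cont: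
  assumes q: "norm q < 1" "q \<noteq> 0" and S: "open S"
    and H: "H S a" "H S b" "H S c" "H S d" "H S e" "H S f"
    and dom: "\<And>x. x \<in> S \<Longrightarrow> (a x, b x, c x, d x, e x, f x) \<in> W87_dom q"
  shows "H S (\<lambda>x. vwp_cont q (a x, b x, c x, d x, e x, f x))"
proof -
  define ws where "ws = (\<lambda>_. q) # map (\<lambda>p x. a x * q / p x) [b, c, d, e, f]"
  define z where "z = (\<lambda>x. vwp_arg q (a x) [b x, c x, d x, e x, f x])"
  have nz: "b x \<noteq> 0" "c x \<noteq> 0" "d x \<noteq> 0" "e x \<noteq> 0" "f x \<noteq> 0" if "x \<in> S" for x
    using dom[OF that] by (auto simp: W87_dom_iff)
  have z: "H S z"
    unfolding z_def vwp_arg_def prod_list.Cons prod_list.Nil by (intro intros H) (simp add: nz)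
  have hypc: "H S (\<lambda>x. hypc q (map (\<lambda>u. u x) [a, b, c, d, e, f]) (map (\<lambda>w. w x) ws) (y x))"
    if "H S y" "\<And>x. x \<in> S \<Longrightarrow> nonres q (y x)" for y
  proof (rule hypc[OF q S])
    show "H S w" if "w \<in> set ws" for w
      using that nz by (auto simp: ws_def intro!: intros H)
    show "nonres q (w x)" if "w \<in> set ws" "x \<in> S" for w x
      using that dom[OF that(2)] nonres_norm_less_1[OF q(1) q(1)] by (auto simp: ws_def W87_dom_iff)
  qed (use that H in \<open>auto simp: ws_def\<close>)
  have z_nonres: "nonres q (z x)" if "x \<in> S" for x
    using dom[OF that] by (auto simp: z_def W87_dom_iff)
  have "1 - a x \<noteq> 0" if "x \<in> S" for x
    using dom[OF that] by (auto simp: W87_dom_iff)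
  then have "H S (\<lambda>x. (hypc q (map (\<lambda>u. u x) [a, b, c, d, e, f]) (map (\<lambda>w. w x) ws) (z x) -
     a x * hypc q (map (\<lambda>u. u x) [a, b, c, d, e, f]) (map (\<lambda>w. w x) ws) (z x * q\<^sup>2)) / (1 - a x))"
    by (intro divide diff mult const hypc z H z_nonres nonres_mult_power)
  then show ?thesis
    by (simp add: vwp_cont_def ws_def z_def Let_def)
qed

lemma vwp_series_eq_hyp:
  assumes q: "norm q < 1"
    and ws: "\<forall>p\<in>set ps. nonres q (a * q / p)" and z: "norm (vwp_arg q a ps) < 1"
  defines "ws \<equiv> q # map (\<lambda>p. a * q / p) ps"
  shows "vwp_series q a ps =
    (hyp q (a # ps) ws (vwp_arg q a ps) - a * hyp q (a # ps) ws (vwp_arg q a ps * q\<^sup>2)) / (1 - a)"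
proof -
  define z where "z = vwp_arg q a ps"
  define c where "c = (\<lambda>k. qpochs q (a # ps) k / qpochs q ws k)"
  have ws': "\<forall>w\<in>set ws. nonres q w"
    using ws nonres_norm_less_1[OF q q] by (auto simp: ws_def)
  have "norm z * norm q ^ 2 \<le> norm z * 1"
    using q by (intro mult_left_mono power_le_one) auto
  then have z2: "norm (z * q\<^sup>2) < 1"
    using z by (simp add: z_def norm_mult norm_power)
  have "(\<lambda>k. c k * z ^ k - a * (c k * (z * q\<^sup>2) ^ k)) sums
      (hyp q (a # ps) ws z - a * hyp q (a # ps) ws (z * q\<^sup>2))"
    unfolding c_def hyp_def
    by (intro sums_diff sums_mult summable_sums hyp_summable q ws') (use z z2 in \<open>auto simp: z_def\<close>)
  moreover have "(c k * z ^ k - a * (c k * (z * q\<^sup>2) ^ k)) / (1 - a) =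
      (1 - a * q ^ (2 * k)) / (1 - a) * c k * z ^ k" for k
    by (simp add: power_mult_distrib power_even_eq algebra_simps flip: diff_divide_distrib power_mult)
  ultimately have "(\<lambda>k. (1 - a * q ^ (2 * k)) / (1 - a) * c k * z ^ k) sums
      ((hyp q (a # ps) ws z - a * hyp q (a # ps) ws (z * q\<^sup>2)) / (1 - a))"
    using sums_divide[of _ _ "1 - a"] by fastforce
  then show ?thesis
    unfolding vwp_series_def c_def z_def ws_def by (rule sums_unique[symmetric])
qed

lemma is_W87_continuation_vwp_cont:
  assumes q: "norm q < 1" "q \<noteq> 0"
  shows "is_W87_continuation q (vwp_cont q)"
  unfolding is_W87_continuation_def holomorphic6_on_def
proof (intro conjI ballI, goal_cases)
  case 1
  have "continuous_on (W87_dom q) (\<lambda>x. vwp_cont q (fst x, fst (snd x), fst (snd (snd x)),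
      fst (snd (snd (snd x))), fst (snd (snd (snd (snd x)))), snd (snd (snd (snd (snd x))))))"
    by (rule cont.vwp_cont[OF q open_W87_dom[OF q(1)]]) (intro continuous_intros | simp)+
  then show ?case by simp
next
  case (2 x)
  obtain a b c d e f where x: "x = (a, b, c, d, e, f)"
    by (metis prod.exhaust)
  have diff: "(\<lambda>w. vwp_cont q (A w, B w, C w, D w, E w, F w)) field_differentiable (at w0)"
    if hol: "A holomorphic_on UNIV" "B holomorphic_on UNIV" "C holomorphic_on UNIV"
       "D holomorphic_on UNIV" "E holomorphic_on UNIV" "F holomorphic_on UNIV"
     and w0: "(A w0, B w0, C w0, D w0, E w0, F w0) \<in> W87_dom q" for A B C D E F w0
  proof -
    let ?h = "\<lambda>w. (A w, B w, C w, D w, E w, F w)"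
    have "continuous_on UNIV ?h"
      by (intro continuous_intros holomorphic_on_imp_continuous_on hol)
    then have S: "open (?h -` W87_dom q)"
      by (rule open_vimage[OF open_W87_dom[OF q(1)]])
    have "(\<lambda>w. vwp_cont q (A w, B w, C w, D w, E w, F w)) holomorphic_on (?h -` W87_dom q)"
      by (rule holo.vwp_cont[OF q S]) (auto intro: holomorphic_on_subset[OF hol(1)]
        holomorphic_on_subset[OF hol(2)] holomorphic_on_subset[OF hol(3)]
        holomorphic_on_subset[OF hol(4)] holomorphic_on_subset[OF hol(5)] holomorphic_on_subset[OF hol(6)])
    then show ?thesis
      by (rule holomorphic_on_imp_differentiable_at[OF _ S]) (use w0 in auto)
  qed
  have id: "(\<lambda>w. w) holomorphic_on UNIV" and const: "(\<lambda>w. p) holomorphic_on UNIV" for p :: complex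
    by auto
  show ?case
    using 2 diff[OF id const const const const const, of a b c d e f]
      diff[OF const id const const const const, of a b c d e f]
      diff[OF const const id const const const, of a b c d e f]
      diff[OF const const const id const const, of a b c d e f]
      diff[OF const const const const id const, of a b c d e f]
      diff[OF const const const const const id, of a b c d e f]
    by (simp add: x)
next
  case (3 x)
  obtain a b c d e f where x: "x = (a, b, c, d, e, f)"
    by (metis prod.exhaust)
  define ps where "ps = [b, c, d, e, f]"
  define ws where "ws = q # map (\<lambda>p. a * q / p) ps"
  have "vwp_cont q (a, b, c, d, e, f) = vwp_series q a ps" if z: "norm (vwp_arg q a ps) < 1"
  proof -
    have ps: "\<forall>p\<in>set ps. nonres q (a * q / p)"
      using 3 unfolding x W87_dom_iff by (auto simp: ps_def)
    then have ws: "\<forall>w\<in>set ws. nonres q w" "q \<in> set ws"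
      using nonres_norm_less_1[OF q(1) q(1)] by (auto simp: ws_def)
    have "norm (vwp_arg q a ps) * norm q ^ 2 \<le> norm (vwp_arg q a ps) * 1"
      using q by (intro mult_left_mono power_le_one) auto
    then have z2: "norm (vwp_arg q a ps * q\<^sup>2) < 1"
      using z by (simp add: norm_mult norm_power)
    show ?thesis
      unfolding vwp_series_eq_hyp[OF q(1) ps z]
      using hypc_eq_hyp[OF q ws(2,1) z] hypc_eq_hyp[OF q ws(2,1) z2]
      by (simp add: vwp_cont_def Let_def ws_def ps_def)
  qed
  then show ?case
    by (simp add: x ps_def)
qed

text \<open>Existence makes the chosen function a continuation. From here on \<open>W87\<close> is
  known only through this specification: its values on the disc of convergence, continuity and
  differentiability in each variable.\<close>

lemma is_W87_continuation_W87:
  "norm q < 1 \<Longrightarrow> q \<noteq> 0 \<Longrightarrow> is_W87_continuation q (W87 q)"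
  unfolding W87_def by (rule someI[of "is_W87_continuation q", OF is_W87_continuation_vwp_cont])

subsection \<open>Moments of the very-well-poised series\<close>

definition vterm :: "complex \<Rightarrow> complex \<Rightarrow> complex list \<Rightarrow> nat \<Rightarrow> complex" where
  "vterm q a ps k = (1 - a * q ^ (2 * k)) / (1 - a)
     * (qpochs q (a # ps) k / qpochs q (q # map (\<lambda>p. a * q / p) ps) k) * vwp_arg q a ps ^ k"

text \<open>With y = q^k this is 1/y + a y, the invariant of y -> 1/(a y). The well-poised pair (1 -
  x y)(1 - a y/x) / y is linear in it, namely \<open>lam\<close> minus x + a/x.\<close>

definition lam :: "complex \<Rightarrow> complex \<Rightarrow> nat \<Rightarrow> complex" where
  "lam q a k = 1 / q ^ k + a * q ^ k"

definition vmom :: "complex \<Rightarrow> complex \<Rightarrow> complex list \<Rightarrow> nat \<Rightarrow> complex" where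
  "vmom q a ps i = (\<Sum>k. vterm q a ps k * lam q a k ^ i)"

lemma vmom_0: "vmom q a ps 0 = vwp_series q a ps"
  by (simp add: vmom_def vterm_def vwp_series_def)

lemma lower_nonres:
  assumes "norm q < 1" "\<forall>p\<in>set ps. nonres q (a * q / p)"
  shows "\<forall>w\<in>set (q # map (\<lambda>p. a * q / p) ps). nonres q w"
  using assms nonres_norm_less_1 by auto

text \<open>Each factor \<open>lam\<close> costs q^(-k), so the i-th moment converges like the
  series with argument z / q^i; the remaining factors are bounded by \<open>C\<close>.\<close>

lemma vmom_summable:
  assumes q: "norm q < 1" "q \<noteq> 0" and ps: "\<forall>p\<in>set ps. nonres q (a * q / p)"
    and z: "norm (vwp_arg q a ps) < norm q ^ i"
  shows "summable (\<lambda>k. vterm q a ps k * lam q a k ^ i)"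
proof -
  define ws where "ws = q # map (\<lambda>p. a * q / p) ps"
  define t where "t = (\<lambda>k. qpochs q (a # ps) k / qpochs q ws k * (vwp_arg q a ps / q ^ i) ^ k)"
  define C where "C = (1 + norm a) / norm (1 - a) * (1 + norm a) ^ i"
  have qk: "norm (a * q ^ (2 * k)) \<le> norm a" for k
    using q by (auto simp: norm_mult norm_power intro!: mult_left_le power_le_one)
  have "norm (vwp_arg q a ps / q ^ i) < 1"
    using z q by (simp add: norm_divide norm_power)
  from hyp_abs_summable[OF q(1) _ this, of ws "a # ps"] have "summable (\<lambda>k. C * norm (t k))"
    using lower_nonres[OF q(1) ps] by (intro summable_mult) (simp add: t_def ws_def)
  then show ?thesis
  proof (rule summable_comparison_test[rotated], intro exI allI impI)
    fix k
    have "q ^ (2 * k) = q ^ k * q ^ k"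
      by (simp add: mult_2 power_add)
    then have "lam q a k = (1 + a * q ^ (2 * k)) / q ^ k"
      using q by (simp add: lam_def add_divide_distrib)
    then have "vterm q a ps k * lam q a k ^ i =
        (1 - a * q ^ (2 * k)) / (1 - a) * (1 + a * q ^ (2 * k)) ^ i * t k"
      by (simp add: vterm_def t_def ws_def power_divide mult_ac flip: power_mult)
    also have "norm \<dots> \<le> C * norm (t k)"
      unfolding norm_mult C_def norm_divide norm_power
      by (intro mult_right_mono mult_mono divide_right_mono power_mono zero_le_power)
        (use qk[of k] norm_triangle_ineq4[of 1 "a * q ^ (2 * k)"]
          norm_triangle_ineq[of 1 "a * q ^ (2 * k)"] in auto)
    finally show "norm (vterm q a ps k * lam q a k ^ i) \<le> C * norm (t k)" .
  qed
qed

lemma vmom_sums: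
  assumes "norm q < 1" "q \<noteq> 0" "\<forall>p\<in>set ps. nonres q (a * q / p)" "norm (vwp_arg q a ps) < norm q ^ i"
  shows "(\<lambda>k. vterm q a ps k * lam q a k ^ i) sums vmom q a ps i"
  unfolding vmom_def using vmom_summable[OF assms] by (rule summable_sums)

lemma norm_less_power:
  fixes q :: complex
  assumes "norm q < 1" "x < norm q ^ Suc i"
  shows "x < norm q ^ i"
proof -
  have "norm q ^ Suc i \<le> norm q ^ i"
    using assms by (intro power_decreasing) auto
  with assms show ?thesis by linarith
qed

text \<open>With y = q^k, (1 - a y^2)(1/y + a y) = 1/y - a^2 y^3, which produces the arguments z/q
  and z q^3. Limits of moments thereby reduce to limits of \<open>hyp\<close>.\<close>

lemma vmom_hyp:
  assumes q: "norm q < 1" "q \<noteq> 0" and ps: "\<forall>p\<in>set ps. nonres q (a * q / p)"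
    and z: "norm (vwp_arg q a ps) < norm q"
  defines "h \<equiv> hyp q (a # ps) (q # map (\<lambda>p. a * q / p) ps)"
  shows "vmom q a ps 0 = (h (vwp_arg q a ps) - a * h (vwp_arg q a ps * q\<^sup>2)) / (1 - a)"
    and "vmom q a ps 1 = (h (vwp_arg q a ps / q) - a\<^sup>2 * h (vwp_arg q a ps * q ^ 3)) / (1 - a)"
proof -
  define z where "z = vwp_arg q a ps"
  define c where "c = (\<lambda>k. qpochs q (a # ps) k / qpochs q (q # map (\<lambda>p. a * q / p) ps) k)"
  have z1: "norm z < 1"
    using z q unfolding z_def by linarith
  show "vmom q a ps 0 = (h (vwp_arg q a ps) - a * h (vwp_arg q a ps * q\<^sup>2)) / (1 - a)"
    unfolding vmom_0 h_def using vwp_series_eq_hyp[OF q(1) ps] z1 by (simp add: z_def)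
  have sums: "(\<lambda>k. c k * x ^ k) sums h x" if "norm x < 1" for x
    unfolding c_def h_def hyp_def by (intro summable_sums hyp_summable lower_nonres q ps that)
  have "norm z * norm q ^ 3 \<le> norm z * 1"
    using q by (intro mult_left_mono power_le_one) auto
  then have z3: "norm (z * q ^ 3) < 1"
    using z1 by (simp add: norm_mult norm_power)
  have zq: "norm (z / q) < 1"
    using z q by (simp add: norm_divide z_def)
  have "(\<lambda>k. (c k * (z / q) ^ k - a\<^sup>2 * (c k * (z * q ^ 3) ^ k)) / (1 - a)) sums
      ((h (z / q) - a\<^sup>2 * h (z * q ^ 3)) / (1 - a))"
    by (intro sums_divide sums_diff sums_mult sums zq z3)
  moreover have "(c k * (z / q) ^ k - a\<^sup>2 * (c k * (z * q ^ 3) ^ k)) / (1 - a) =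
      vterm q a ps k * lam q a k ^ 1" for k
  proof -
    have "(z * q ^ 3) ^ k = z ^ k * (q ^ k) ^ 3"
      by (simp add: power_mult_distrib mult.commute flip: power_mult)
    moreover have vterm: "vterm q a ps k = (1 - a * (q ^ k)\<^sup>2) / (1 - a) * c k * z ^ k"
      by (simp add: vterm_def c_def z_def power_even_eq)
    ultimately show ?thesis
      using q unfolding lam_def vterm
      by (cases "a = 1") (simp_all add: field_simps power_divide power2_eq_square power3_eq_cube)
  qed
  ultimately show "vmom q a ps 1 = (h (vwp_arg q a ps / q) - a\<^sup>2 * h (vwp_arg q a ps * q ^ 3)) / (1 - a)"
    unfolding vmom_def z_def by (simp add: sums_iff)
qed

lemma qpochs_Suc_shift:
  "qpochs q xs (Suc k) = (\<Prod>x\<leftarrow>xs. 1 - x) * qpochs q (map (\<lambda>x. x * q) xs) k"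
  by (induction xs) (auto simp: qpoch_Suc_shift)

text \<open>The difference of \<open>lam q a k\<close> and 1 + a is (1 - q^k)(1 - a q^k) / q^k. It
  removes the term k = 0 and supplies exactly the factors that turn the term k + 1 into the k-th
  term of the series with shifted parameters.\<close>

lemma vwp_series_shift:
  assumes q: "norm q < 1" "q \<noteq> 0" and a: "a \<noteq> 1" "a * q\<^sup>2 \<noteq> 1"
    and ps: "\<forall>p\<in>set ps. p \<noteq> 0 \<and> nonres q (a * q / p)" "length ps = 5"
    and z: "norm (vwp_arg q a ps) < norm q"
  shows "vwp_arg q a ps / q * (1 - a * q) * (1 - a * q\<^sup>2) * (\<Prod>p\<leftarrow>ps. 1 - p) / (\<Prod>p\<leftarrow>ps. 1 - a * q / p)
      * vwp_series q (a * q\<^sup>2) (map (\<lambda>p. p * q) ps) = vmom q a ps 1 - (1 + a) * vmom q a ps 0"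
    (is "?K * _ = _")
proof -
  define z where "z = vwp_arg q a ps"
  have z1: "norm z < 1"
    using z q unfolding z_def by linarith
  have ps': "\<forall>p\<in>set ps. nonres q (a * q / p)"
    using ps by blast
  have nz: "(\<Prod>p\<leftarrow>ps. 1 - a * q / p) \<noteq> 0"
    using ps nonres_neq_1 by (force simp: prod_list_zero_iff)
  have "prod_list (map (\<lambda>p. p * q) ps) = prod_list ps * q ^ length ps"
    by (induction ps) auto
  \<comment> \<open>The numerator of the argument gains q^4 and the five parameters gain q^5, hence
    the quotient by q.\<close>
  then have arg: "vwp_arg q (a * q\<^sup>2) (map (\<lambda>p. p * q) ps) = z / q"
    using q by (simp add: vwp_arg_def z_def ps(2) field_simps eval_nat_numeral)
  have lower: "map (\<lambda>p. a * q\<^sup>2 * q / p) (map (\<lambda>p. p * q) ps) = map (\<lambda>x. x * q) (map (\<lambda>p. a * q / p) ps)"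
    using q by (simp add: power2_eq_square)
  have zq: "norm (vwp_arg q (a * q\<^sup>2) (map (\<lambda>p. p * q) ps)) < 1"
    unfolding arg using z q by (simp add: norm_divide z_def)
  have "nonres q (a * q\<^sup>2 * q / (p * q))" if "p \<in> set ps" for p
    using nonres_mult[of q "a * q / p"] ps' q that by (simp add: power2_eq_square mult.assoc)
  then have "\<forall>p\<in>set (map (\<lambda>p. p * q) ps). nonres q (a * q\<^sup>2 * q / p)"
    by auto
  then have "(\<lambda>k. vterm q (a * q\<^sup>2) (map (\<lambda>p. p * q) ps) k * lam q (a * q\<^sup>2) k ^ 0) sums
      vmom q (a * q\<^sup>2) (map (\<lambda>p. p * q) ps) 0"
    by (intro vmom_sums q) (use zq in auto)
  then have plus: "(\<lambda>k. ?K * vterm q (a * q\<^sup>2) (map (\<lambda>p. p * q) ps) k) sums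
      (?K * vwp_series q (a * q\<^sup>2) (map (\<lambda>p. p * q) ps))"
    unfolding vmom_0 by (intro sums_mult) simp
  define g where "g = (\<lambda>k. vterm q a ps k * lam q a k ^ 1 - (1 + a) * (vterm q a ps k * lam q a k ^ 0))"
  have g: "g sums (vmom q a ps 1 - (1 + a) * vmom q a ps 0)"
    unfolding g_def by (intro sums_diff sums_mult vmom_sums q ps') (use z z1 in \<open>auto simp: z_def\<close>)
  have "g 0 = 0"
    by (simp add: g_def lam_def algebra_simps)
  moreover have "g (Suc k) = ?K * vterm q (a * q\<^sup>2) (map (\<lambda>p. p * q) ps) k" for k
  proof -
    have qk: "1 - q ^ Suc k \<noteq> 0"
      using nonres_imp[OF nonres_norm_less_1[OF q(1) q(1)], of k] by simp
    have qq: "qpoch q q (Suc k) = qpoch q q k * (1 - q ^ Suc k)"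
      by (simp add: qpoch_Suc)
    \<comment> \<open>Both sides are (a)_{k+2}, split off at the end and at the beginning.\<close>
    have "qpoch q a (Suc k) * (1 - a * q ^ Suc k) = (1 - a) * (1 - a * q) * qpoch q (a * q\<^sup>2) k"
      by (metis qpoch_Suc qpoch_Suc_shift mult.assoc power2_eq_square)
    then have qa: "qpoch q a (Suc k) / (1 - a) * (1 - a * q ^ Suc k) = (1 - a * q) * qpoch q (a * q\<^sup>2) k"
      using a by (simp add: field_simps)
    have lam: "lam q a (Suc k) - (1 + a) = (1 - q ^ Suc k) * (1 - a * q ^ Suc k) / q ^ Suc k"
      using q by (simp add: lam_def field_simps del: power_Suc)
    have "g (Suc k) = vterm q a ps (Suc k) * (lam q a (Suc k) - (1 + a))"
      by (simp add: g_def algebra_simps)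
    also have "\<dots> = (1 - a * q ^ (2 * Suc k)) * (qpoch q a (Suc k) / (1 - a) * (1 - a * q ^ Suc k)) *
        (qpochs q ps (Suc k) / qpochs q (map (\<lambda>p. a * q / p) ps) (Suc k)) *
        ((1 - q ^ Suc k) / qpoch q q (Suc k)) * (z / q) ^ Suc k"
      unfolding lam vterm_def by (simp add: z_def power_divide mult_ac del: power_Suc)
    also have "\<dots> = ?K * ((1 - a * q\<^sup>2 * q ^ (2 * k)) / (1 - a * q\<^sup>2) *
        (qpoch q (a * q\<^sup>2) k * qpochs q (map (\<lambda>p. p * q) ps) k /
          (qpoch q q k * qpochs q (map (\<lambda>x. x * q) (map (\<lambda>p. a * q / p) ps)) k)) * (z / q) ^ k)"
      unfolding qa qq qpochs_Suc_shift
      using a qk by (simp add: z_def o_def power_add power2_eq_square mult_ac)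
    also have "\<dots> = ?K * vterm q (a * q\<^sup>2) (map (\<lambda>p. p * q) ps) k"
      unfolding vterm_def lower arg qpochs_Cons ..
    finally show ?thesis .
  qed
  ultimately have "(\<lambda>k. ?K * vterm q (a * q\<^sup>2) (map (\<lambda>p. p * q) ps) k) sums
      (vmom q a ps 1 - (1 + a) * vmom q a ps 0)"
    using g sums_Suc_iff[of g] by simp
  with plus show ?thesis
    by (rule sums_unique2)
qed

subsection \<open>The shift relation for the bilinear form\<close>

lemma vmom_swap: "vmom q a (x # y # ps) i = vmom q a (y # x # ps) i"
  by (simp add: vmom_def vterm_def vwp_arg_def mult_ac)

text \<open>The summand is g (k+1) - g k, because the term ratio turns the second product at k + 1
  into the first one at k. The boundary term at 0 vanishes through 1 - q^0, and the one at infinity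
  because the argument Z/q^2 still has norm below 1.\<close>

lemma vwp_telescope:
  assumes q: "norm q < 1" "q \<noteq> 0" and ps: "\<forall>p\<in>set ps. nonres q (a * q / p)"
    and Z: "norm (vwp_arg q a ps) < norm q ^ 2" "vwp_arg q a ps \<noteq> 0"
  defines "Z \<equiv> vwp_arg q a ps"
  shows "(\<lambda>k. qpochs q (a # ps) k / qpochs q (q # map (\<lambda>p. a * q / p) ps) k * (Z / q\<^sup>2) ^ k *
    ((1 - a * q ^ k) * (\<Prod>p\<leftarrow>ps. 1 - p * q ^ k) -
     q\<^sup>2 / Z * ((1 - q ^ k) * (\<Prod>p\<leftarrow>ps. 1 - a * q ^ k / p)))) sums 0"
proof -
  define ws where "ws = q # map (\<lambda>p. a * q / p) ps"
  define c where "c = (\<lambda>k. qpochs q (a # ps) k / qpochs q ws k * (Z / q\<^sup>2) ^ k)"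
  define up where "up = (\<lambda>k. \<Prod>u\<leftarrow>a # ps. 1 - u * q ^ k)"
  define low where "low = (\<lambda>k. (1 - q ^ k) * (\<Prod>p\<leftarrow>ps. 1 - a * q ^ k / p))"
  define g where "g = (\<lambda>k. c k * (q\<^sup>2 / Z * low k))"
  have ws: "\<forall>w\<in>set ws. nonres q w"
    unfolding ws_def by (rule lower_nonres[OF q(1) ps])
  have step: "g (Suc k) = c k * up k" for k
  proof -
    have "(\<Prod>w\<leftarrow>ws. 1 - w * q ^ k) = low (Suc k)"
      by (simp add: low_def ws_def o_def mult_ac)
    moreover have "(\<Prod>w\<leftarrow>ws. 1 - w * q ^ k) \<noteq> 0"
      using ws by (auto simp: prod_list_zero_iff nonres_def)
    ultimately show ?thesis
      using Z(2) q(2) qpochs_nonzero[OF ws, of k]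
      unfolding g_def c_def up_def qpochs_Suc by (simp add: Z_def field_simps)
  qed
  have "c \<longlonglongrightarrow> 0"
    unfolding c_def using Z q
    by (intro summable_LIMSEQ_zero hyp_summable ws) (auto simp: Z_def norm_divide norm_power)
  moreover have "up \<longlonglongrightarrow> 1"
  proof -
    have "(\<lambda>k. \<Prod>u\<leftarrow>us. 1 - u * q ^ k) \<longlonglongrightarrow> 1" for us
    proof (induction us)
      case (Cons u us)
      have "(\<lambda>k. (1 - u * q ^ k) * (\<Prod>u\<leftarrow>us. 1 - u * q ^ k)) \<longlonglongrightarrow> (1 - u * 0) * 1"
        by (intro tendsto_intros LIMSEQ_power_zero Cons q)
      then show ?case by simp
    qed auto
    then show ?thesis unfolding up_def .
  qed
  ultimately have "(\<lambda>k. g (Suc k)) \<longlonglongrightarrow> 0"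
    unfolding step using tendsto_mult[of c 0 sequentially up 1] by simp
  then have "g \<longlonglongrightarrow> 0"
    by (rule LIMSEQ_imp_Suc)
  then have "(\<lambda>k. g (Suc k) - g k) sums (0 - g 0)"
    by (rule telescope_sums)
  moreover have "g 0 = 0"
    by (simp add: g_def low_def)
  moreover have "g (Suc k) - g k = c k * (up k - q\<^sup>2 / Z * low k)" for k
    unfolding step unfolding g_def by (simp only: right_diff_distrib)
  ultimately have "(\<lambda>k. c k * (up k - q\<^sup>2 / Z * low k)) sums 0"
    by simp
  then show ?thesis
    by (simp add: c_def up_def low_def ws_def)
qed

text \<open>\<open>quad2\<close>, \<open>quad1\<close> and \<open>quad0\<close> are the coefficients
  of the quadratic in X = 1/y + a y that remains of the telescoped difference; they are symmetric in
  b, ..., f.\<close>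

definition quad2 :: "complex \<Rightarrow> complex \<Rightarrow> complex \<Rightarrow> complex \<Rightarrow> complex \<Rightarrow> complex \<Rightarrow> complex" where
  "quad2 a b c d e f = 1 - b * c * d * e * f / a\<^sup>2"

definition quad1 :: "complex \<Rightarrow> complex \<Rightarrow> complex \<Rightarrow> complex \<Rightarrow> complex \<Rightarrow> complex \<Rightarrow> complex" where
  "quad1 a b c d e f = b * c * d * e * f / a\<^sup>2 - a - (b + c + d + e + f)
     + (b*c*d*e + b*c*d*f + b*c*e*f + b*d*e*f + c*d*e*f) / a"

definition quad0 :: "complex \<Rightarrow> complex \<Rightarrow> complex \<Rightarrow> complex \<Rightarrow> complex \<Rightarrow> complex \<Rightarrow> complex" where
  "quad0 a b c d e f = a * (b + c + d + e + f)
     + (b*c + b*d + b*e + b*f + c*d + c*e + c*f + d*e + d*f + e*f)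
     - (b*c*d + b*c*e + b*c*f + b*d*e + b*d*f + b*e*f + c*d*e + c*d*f + c*e*f + d*e*f)
     - (b*c*d*e + b*c*d*f + b*c*e*f + b*d*e*f + c*d*e*f) / a - a * quad2 a b c d e f"

text \<open>Up to the factor a^3 y^6, y -> 1/(a y) exchanges the two products. Their difference is
  therefore divisible by 1 - a y^2, and the quotient, self-reciprocal of degree 4, is y^2 times a
  quadratic in 1/y + a y.\<close>

lemma quad_factorization:
  assumes "a \<noteq> 0" "b \<noteq> 0" "c \<noteq> 0" "d \<noteq> 0" "e \<noteq> 0" "f \<noteq> 0"
  shows "(1 - a*y) * ((1 - b*y) * ((1 - c*y) * ((1 - d*y) * ((1 - e*y) * (1 - f*y))))) -
      b*c*d*e*f / a\<^sup>2 * ((1 - y) * ((1 - a*y/b) * ((1 - a*y/c) * ((1 - a*y/d) * ((1 - a*y/e) * (1 - a*y/f)))))) =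
    (1 - a*y\<^sup>2) * (quad2 a b c d e f * (1 + a*y\<^sup>2)\<^sup>2 + quad1 a b c d e f * y * (1 + a*y\<^sup>2) + quad0 a b c d e f * y\<^sup>2)"
proof -
  have 1: "b*c*d*e*f / a\<^sup>2 * ((1 - y) * ((1 - a*y/b) * ((1 - a*y/c) * ((1 - a*y/d) * ((1 - a*y/e) * (1 - a*y/f)))))) =
     ((1 - y) * ((b - a*y) * ((c - a*y) * ((d - a*y) * ((e - a*y) * (f - a*y)))))) / a\<^sup>2"
    using assms by (simp add: field_simps)
  \<comment> \<open>Naming the expressions with denominators reduces the claim to polynomial
    identities.\<close>
  define K where "K = b*c*d*e*f / a\<^sup>2"
  define G where "G = (b*c*d*e + b*c*d*f + b*c*e*f + b*d*e*f + c*d*e*f) / a"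
  define Q where "Q = ((1 - y) * ((b - a*y) * ((c - a*y) * ((d - a*y) * ((e - a*y) * (f - a*y)))))) / a\<^sup>2"
  have K: "b*c*d*e*f = K * a\<^sup>2" and G: "b*c*d*e + b*c*d*f + b*c*e*f + b*d*e*f + c*d*e*f = G * a"
    using assms by (simp_all add: K_def G_def)
  have "Q * a\<^sup>2 = (1 - y) * (b*c*d*e*f - (b*c*d*e + b*c*d*f + b*c*e*f + b*d*e*f + c*d*e*f) * (a * y)
      + (b*c*d + b*c*e + b*c*f + b*d*e + b*d*f + b*e*f + c*d*e + c*d*f + c*e*f + d*e*f) * (a * y)^2
      - (b*c + b*d + b*e + b*f + c*d + c*e + c*f + d*e + d*f + e*f) * (a * y)^3
      + (b + c + d + e + f) * (a * y)^4 - (a * y)^5)"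
    using assms unfolding Q_def by (simp add: field_simps) algebra
  also have "\<dots> = ((1 - y) * (K - G * y
      + (b*c*d + b*c*e + b*c*f + b*d*e + b*d*f + b*e*f + c*d*e + c*d*f + c*e*f + d*e*f) * y^2
      - (b*c + b*d + b*e + b*f + c*d + c*e + c*f + d*e + d*f + e*f) * (a * y^3)
      + (b + c + d + e + f) * (a^2 * y^4) - a^3 * y^5)) * a\<^sup>2"
    unfolding K G by algebra
  finally have Q: "Q = (1 - y) * (K - G * y
      + (b*c*d + b*c*e + b*c*f + b*d*e + b*d*f + b*e*f + c*d*e + c*d*f + c*e*f + d*e*f) * y^2
      - (b*c + b*d + b*e + b*f + c*d + c*e + c*f + d*e + d*f + e*f) * (a * y^3)
      + (b + c + d + e + f) * (a^2 * y^4) - a^3 * y^5)"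
    using assms by simp
  have P: "(1 - b*y) * ((1 - c*y) * ((1 - d*y) * ((1 - e*y) * (1 - f*y)))) =
      1 - (b + c + d + e + f) * y + (b*c + b*d + b*e + b*f + c*d + c*e + c*f + d*e + d*f + e*f) * y^2
      - (b*c*d + b*c*e + b*c*f + b*d*e + b*d*f + b*e*f + c*d*e + c*d*f + c*e*f + d*e*f) * y^3
      + (b*c*d*e + b*c*d*f + b*c*e*f + b*d*e*f + c*d*e*f) * y^4 - b*c*d*e*f * y^5"
    by algebra
  show ?thesis
    unfolding 1
    unfolding Q_def[symmetric] quad2_def quad1_def quad0_def K_def[symmetric] G_def[symmetric]
    unfolding P Q
    unfolding K G by algebra
qed

text \<open>In \<open>quad_factorization\<close> at y = q^k, 1 - a y^2 is the very-well-poised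
  factor of the terms, and (Z/q^2)^k = Z^k / y^2 absorbs the y^2. The telescoping sum thus becomes a
  combination of the moments 0, 1 and 2.\<close>

lemma vmom_quad:
  assumes q: "norm q < 1" "q \<noteq> 0" and a: "a \<noteq> 0" "a \<noteq> 1"
    and ps: "\<forall>p\<in>{b, c, d, e, f}. p \<noteq> 0 \<and> nonres q (a * q / p)"
    and Z: "norm (vwp_arg q a [b, c, d, e, f]) < norm q ^ 2"
  shows "quad2 a b c d e f * vmom q a [b, c, d, e, f] 2 + quad1 a b c d e f * vmom q a [b, c, d, e, f] 1
    + quad0 a b c d e f * vmom q a [b, c, d, e, f] 0 = 0"
proof -
  define ps where "ps = [b, c, d, e, f]"
  define Z where "Z = vwp_arg q a ps"
  define w where "w = (\<lambda>k. qpochs q (a # ps) k / qpochs q (q # map (\<lambda>p. a * q / p) ps) k)"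
  have Z0: "Z \<noteq> 0"
    using ps a q by (simp add: Z_def ps_def vwp_arg_def)
  have kap: "q\<^sup>2 / Z = b * c * d * e * f / a\<^sup>2"
    using ps a q by (simp add: Z_def ps_def vwp_arg_def field_simps)
  have ps': "\<forall>p\<in>set ps. nonres q (a * q / p)"
    using ps by (simp add: ps_def)
  have Z1: "norm Z < norm q ^ 1" "norm Z < norm q ^ 0"
    using norm_less_power[OF q(1), of "norm Z" 1] norm_less_power[OF q(1), of "norm Z" 0] Z
    by (simp_all add: Z_def ps_def eval_nat_numeral)
  have "(\<lambda>k. quad2 a b c d e f * (vterm q a ps k * lam q a k ^ 2) + quad1 a b c d e f * (vterm q a ps k * lam q a k ^ 1)
      + quad0 a b c d e f * (vterm q a ps k * lam q a k ^ 0)) sums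
      (quad2 a b c d e f * vmom q a ps 2 + quad1 a b c d e f * vmom q a ps 1 + quad0 a b c d e f * vmom q a ps 0)"
    by (intro sums_add sums_mult vmom_sums q ps') (use Z Z1 in \<open>auto simp: Z_def ps_def\<close>)
  moreover have "quad2 a b c d e f * (vterm q a ps k * lam q a k ^ 2) + quad1 a b c d e f * (vterm q a ps k * lam q a k ^ 1)
      + quad0 a b c d e f * (vterm q a ps k * lam q a k ^ 0) =
    w k * (Z / q\<^sup>2) ^ k *
    ((1 - a * q ^ k) * (\<Prod>p\<leftarrow>ps. 1 - p * q ^ k) -
     q\<^sup>2 / Z * ((1 - q ^ k) * (\<Prod>p\<leftarrow>ps. 1 - a * q ^ k / p))) / (1 - a)" for k
  proof -
    define y where "y = q ^ k"
    have y: "y \<noteq> 0"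
      using q by (simp add: y_def)
    define L where "L = lam q a k"
    have L: "1 + a * y\<^sup>2 = L * y"
      using y by (simp add: L_def lam_def field_simps power2_eq_square flip: y_def)
    have v: "vterm q a ps k = (1 - a * y\<^sup>2) / (1 - a) * w k * Z ^ k"
      by (simp add: vterm_def w_def Z_def y_def power_even_eq)
    have Zk: "(Z / q\<^sup>2) ^ k = Z ^ k / y\<^sup>2"
      by (simp add: power_divide y_def mult.commute flip: power_mult)
    have fact: "(1 - a * y) * (\<Prod>p\<leftarrow>ps. 1 - p * y) - q\<^sup>2 / Z * ((1 - y) * (\<Prod>p\<leftarrow>ps. 1 - a * y / p)) =
      (1 - a*y\<^sup>2) * (quad2 a b c d e f * (1 + a*y\<^sup>2)\<^sup>2 + quad1 a b c d e f * y * (1 + a*y\<^sup>2) + quad0 a b c d e f * y\<^sup>2)"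
      using quad_factorization[of a b c d e f y] ps a unfolding kap ps_def by simp
    define u where "u = (1 - a * y\<^sup>2) / (1 - a) * w k * Z ^ k"
    have "quad2 a b c d e f * (vterm q a ps k * lam q a k ^ 2) + quad1 a b c d e f * (vterm q a ps k * lam q a k ^ 1)
      + quad0 a b c d e f * (vterm q a ps k * lam q a k ^ 0) =
      u * (quad2 a b c d e f * L\<^sup>2 + quad1 a b c d e f * L + quad0 a b c d e f)"
      unfolding v u_def[symmetric] L_def[symmetric] by (simp add: algebra_simps)
    also have "\<dots> = u / y\<^sup>2 * (quad2 a b c d e f * (L * y)\<^sup>2 + quad1 a b c d e f * y * (L * y) + quad0 a b c d e f * y\<^sup>2)"
      using y by (simp add: field_simps power2_eq_square)
    also have "u / y\<^sup>2 = w k * (Z / q\<^sup>2) ^ k * (1 - a * y\<^sup>2) / (1 - a)"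
      unfolding u_def Zk by (simp add: mult_ac)
    finally show ?thesis
      unfolding y_def[symmetric] fact L[symmetric] by simp
  qed
  moreover have "(\<lambda>k. w k * (Z / q\<^sup>2) ^ k *
    ((1 - a * q ^ k) * (\<Prod>p\<leftarrow>ps. 1 - p * q ^ k) -
     q\<^sup>2 / Z * ((1 - q ^ k) * (\<Prod>p\<leftarrow>ps. 1 - a * q ^ k / p))) / (1 - a)) sums (0 / (1 - a))"
    unfolding w_def Z_def by (intro sums_divide vwp_telescope q ps') (use Z Z0 in \<open>auto simp: ps_def Z_def\<close>)
  ultimately show ?thesis
    unfolding ps_def by (auto dest: sums_unique2)
qed

text \<open>With x = c/q and y = q^k, the shifted factorials change by 1 - x y and 1 - a y/x, and
  the power of the argument changes by 1/y. The product of these is \<open>lam\<close> minus x +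
  a/x.\<close>

lemma vterm_shift:
  assumes q: "q \<noteq> 0" and c: "c \<noteq> 0" and nonres: "nonres q (a * q / c)"
  shows "vterm q a (c # ps) k * ((1 - c / q) * (1 - a * q / c)) =
    vterm q a (c / q # ps) k * (lam q a k - (c / q + a * q / c))"
proof -
  define g where "g = a * q / c"
  define y where "y = q ^ k"
  have y: "y \<noteq> 0"
    using q by (simp add: y_def)
  have up: "qpoch q c k * (1 - c / q) = qpoch q (c / q) k * (1 - c / q * y)"
    using qpoch_Suc[of q "c / q" k] qpoch_Suc_shift[of q "c / q" k] q by (simp add: y_def mult.commute)
  have g0: "nonres q g"
    using nonres by (simp add: g_def)
  have "qpoch q g k * (1 - g * y) = (1 - g) * qpoch q (g * q) k"
    using qpoch_Suc[of q g k] qpoch_Suc_shift[of q g k] by (simp add: y_def)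
  then have low: "(1 - g) / qpoch q g k = (1 - g * y) / qpoch q (g * q) k"
    using qpoch_nonzero[OF g0, of k] qpoch_nonzero[OF nonres_mult[OF g0], of k] by (simp add: field_simps)
  have gq: "a * q / (c / q) = g * q"
    using q c by (simp add: g_def)
  have arg: "vwp_arg q a (c # ps) ^ k = vwp_arg q a (c / q # ps) ^ k / y"
    using q by (simp add: vwp_arg_def y_def flip: power_divide)
  have lam: "(1 - c / q * y) * (1 - g * y) / y = lam q a k - (c / q + g)"
    using y q c by (simp add: lam_def g_def field_simps flip: y_def)
  define r where "r = (1 - a * q ^ (2 * k)) / (1 - a) *
    (qpoch q a k * qpochs q ps k / (qpoch q q k * qpochs q (map (\<lambda>p. a * q / p) ps) k)) *
    vwp_arg q a (c / q # ps) ^ k"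
  have "vterm q a (c # ps) k * ((1 - c / q) * (1 - g)) =
      r / y * (qpoch q c k * (1 - c / q)) * ((1 - g) / qpoch q g k)"
    unfolding vterm_def arg r_def by (simp add: g_def mult_ac)
  also have "\<dots> = r * (qpoch q (c / q) k / qpoch q (g * q) k) * ((1 - c / q * y) * (1 - g * y) / y)"
    unfolding up low by (simp add: mult_ac)
  also have "r * (qpoch q (c / q) k / qpoch q (g * q) k) = vterm q a (c / q # ps) k"
    unfolding vterm_def r_def list.map gq by (simp add: mult_ac)
  finally show ?thesis
    unfolding lam by (simp add: g_def)
qed

lemma vmom_shift:
  assumes q: "norm q < 1" "q \<noteq> 0" and c: "c \<noteq> 0" and ps: "\<forall>p\<in>set (c # ps). nonres q (a * q / p)"
    and z: "norm (vwp_arg q a (c # ps)) < norm q ^ i"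
  shows "vmom q a (c # ps) i * ((1 - c / q) * (1 - a * q / c)) =
    vmom q a (c / q # ps) (Suc i) - (c / q + a * q / c) * vmom q a (c / q # ps) i"
proof -
  have "nonres q (a * q / (c / q))"
    using nonres_mult[of q "a * q / c"] ps by simp
  then have ps': "\<forall>p\<in>set (c / q # ps). nonres q (a * q / p)"
    using ps by simp
  have "vwp_arg q a (c / q # ps) = vwp_arg q a (c # ps) * q"
    using q by (simp add: vwp_arg_def)
  then have z': "norm (vwp_arg q a (c / q # ps)) < norm q ^ Suc i"
    using z q by (simp add: norm_mult mult.commute)
  have "(\<lambda>k. vterm q a (c # ps) k * lam q a k ^ i * ((1 - c / q) * (1 - a * q / c))) sums
      (vmom q a (c # ps) i * ((1 - c / q) * (1 - a * q / c)))"
    by (intro sums_mult2 vmom_sums q ps z)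
  moreover have "(\<lambda>k. vterm q a (c / q # ps) k * lam q a k ^ Suc i -
        (c / q + a * q / c) * (vterm q a (c / q # ps) k * lam q a k ^ i)) sums
      (vmom q a (c / q # ps) (Suc i) - (c / q + a * q / c) * vmom q a (c / q # ps) i)"
    by (intro sums_diff sums_mult vmom_sums q ps' z' norm_less_power[OF q(1) z'])
  moreover have "vterm q a (c # ps) k * lam q a k ^ i * ((1 - c / q) * (1 - a * q / c)) =
      vterm q a (c / q # ps) k * lam q a k ^ Suc i -
        (c / q + a * q / c) * (vterm q a (c / q # ps) k * lam q a k ^ i)" for k
  proof -
    have "vterm q a (c # ps) k * lam q a k ^ i * ((1 - c / q) * (1 - a * q / c)) =
        vterm q a (c # ps) k * ((1 - c / q) * (1 - a * q / c)) * lam q a k ^ i"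
      by (simp only: mult_ac)
    also have "vterm q a (c # ps) k * ((1 - c / q) * (1 - a * q / c)) =
        vterm q a (c / q # ps) k * (lam q a k - (c / q + a * q / c))"
      by (rule vterm_shift[OF q(2) c]) (use ps in simp)
    finally show ?thesis
      by (simp only: right_diff_distrib left_diff_distrib power_Suc mult_ac)
  qed
  ultimately show ?thesis
    by (auto dest: sums_unique2)
qed

text \<open>The upper parameters of the reflected series are b/a times the old ones, with a and b
  exchanging places, and the numbers 1, a/p scale in the same way. Both products are the old ones at
  (b/a) y, so X scales by b/a and the rescaled moments satisfy the old relation.\<close>

lemma quad_reflect:
  assumes "a \<noteq> 0" "b \<noteq> 0"
  shows "quad2 (b\<^sup>2/a) b (b*c/a) (b*d/a) (b*e/a) (b*f/a) = quad2 a b c d e f"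
    and "quad1 (b\<^sup>2/a) b (b*c/a) (b*d/a) (b*e/a) (b*f/a) = b/a * quad1 a b c d e f"
    and "quad0 (b\<^sup>2/a) b (b*c/a) (b*d/a) (b*e/a) (b*f/a) = (b/a)\<^sup>2 * quad0 a b c d e f"
proof -
  show 2: "quad2 (b\<^sup>2/a) b (b*c/a) (b*d/a) (b*e/a) (b*f/a) = quad2 a b c d e f"
    using assms unfolding quad2_def by (simp add: field_simps) algebra
  show "quad1 (b\<^sup>2/a) b (b*c/a) (b*d/a) (b*e/a) (b*f/a) = b/a * quad1 a b c d e f"
    using assms unfolding quad1_def by (simp add: field_simps) algebra
  show "quad0 (b\<^sup>2/a) b (b*c/a) (b*d/a) (b*e/a) (b*f/a) = (b/a)\<^sup>2 * quad0 a b c d e f"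
    using assms unfolding quad0_def 2 by (simp add: field_simps) algebra
qed

text \<open>X = x + a/x belongs to y = 1/x. There the first product in
  \<open>quad_factorization\<close> vanishes, x being one of its parameters, and in the second one 1
  - a/x^2 cancels against 1 - a y^2.\<close>

lemma quad_root:
  assumes "a \<noteq> 0" "b \<noteq> 0" "x \<noteq> 0" "d \<noteq> 0" "e \<noteq> 0" "f \<noteq> 0"
  shows "quad2 a b x d e f * (x + a/x)\<^sup>2 + quad1 a b x d e f * (x + a/x) + quad0 a b x d e f =
    - ((1 - x) * (1 - b*x/a) * (d*x - a) * (e*x - a) * (f*x - a) / (a * x\<^sup>2))"
proof -
  define P where "P = b*d*e*f / a\<^sup>2"
  define S where "S = (b*d*e + b*d*f + b*e*f + d*e*f) / a"
  define T where "T = P * x^4 - S * x^3 + (b*d + b*e + b*f + d*e + d*f + e*f) * x^2 - a * (b + d + e + f) * x + a^2"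
  have P: "b*d*e*f = P * a\<^sup>2" and S: "b*d*e + b*d*f + b*e*f + d*e*f = S * a"
    using assms by (simp_all add: P_def S_def)
  have 2: "quad2 a b x d e f = 1 - x * P"
    by (simp add: quad2_def P_def mult_ac)
  have "(b*x*d*e + b*x*d*f + b*x*e*f + b*d*e*f + x*d*e*f) / a = x * S + a * P"
    using assms by (simp add: S_def P_def field_simps power2_eq_square)
  then have 1: "quad1 a b x d e f = x * P - a - (b + x + d + e + f) + x * S + a * P"
    and 0: "quad0 a b x d e f = a * (b + x + d + e + f)
     + (b*x + b*d + b*e + b*f + x*d + x*e + x*f + d*e + d*f + e*f)
     - (S * a + x * (b*d + b*e + b*f + d*e + d*f + e*f)) - (x * S + a * P) - a * (1 - x * P)"
    unfolding quad1_def quad0_def 2 S[symmetric] by (simp_all add: P_def algebra_simps)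
  have "(1 - x) * (1 - b*x/a) * (d*x - a) * (e*x - a) * (f*x - a) / (a * x\<^sup>2) =
      ((1 - x) * (a - b*x) * (d*x - a) * (e*x - a) * (f*x - a) / a\<^sup>2) / x\<^sup>2"
    using assms by (simp add: field_simps power2_eq_square)
  also have "(1 - x) * (a - b*x) * (d*x - a) * (e*x - a) * (f*x - a) =
      - (1 - x) * (b*d*e*f * x^4 - a * x^3 * (b*d*e + b*d*f + b*e*f + d*e*f)
        + a^2 * x^2 * (b*d + b*e + b*f + d*e + d*f + e*f) - a^3 * x * (b + d + e + f) + a^4)"
    by algebra
  also have "\<dots> = - ((1 - x) * T) * a\<^sup>2"
    unfolding P S T_def by algebra
  finally have rhs: "(1 - x) * (1 - b*x/a) * (d*x - a) * (e*x - a) * (f*x - a) / (a * x\<^sup>2) =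
      - ((1 - x) * T / x\<^sup>2)"
    using assms(1) by simp
  have \<phi>: "x + a/x = (x\<^sup>2 + a) / x"
    using assms by (simp add: field_simps power2_eq_square)
  have "quad2 a b x d e f * (x + a/x)\<^sup>2 + quad1 a b x d e f * (x + a/x) + quad0 a b x d e f =
      (quad2 a b x d e f * (x\<^sup>2 + a)\<^sup>2 + quad1 a b x d e f * (x\<^sup>2 + a) * x + quad0 a b x d e f * x\<^sup>2) / x\<^sup>2"
    unfolding \<phi> using assms by (simp add: field_simps power2_eq_square)
  also have "quad2 a b x d e f * (x\<^sup>2 + a)\<^sup>2 + quad1 a b x d e f * (x\<^sup>2 + a) * x + quad0 a b x d e f * x\<^sup>2 =
      (1 - x) * T"
    unfolding 0 1 2 T_def by algebra
  finally show ?thesis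
    unfolding rhs minus_minus .
qed

text \<open>m and n are functionals on polynomials modulo p(X) = \<alpha> X^2 + \<beta> X +
  \<gamma>. Multiplication by X - \<phi> on this two-dimensional quotient has determinant
  p(\<phi>)/\<alpha>; multiplying through by \<alpha> avoids the division.\<close>

lemma det_mod_quad:
  fixes \<alpha> \<beta> \<gamma> \<phi> :: "'a::comm_ring_1"
  assumes "\<alpha> * m2 + \<beta> * m1 + \<gamma> * m0 = 0" "\<alpha> * n2 + \<beta> * n1 + \<gamma> * n0 = 0"
  shows "\<alpha> * ((m2 - \<phi> * m1) * (n1 - \<phi> * n0) - (m1 - \<phi> * m0) * (n2 - \<phi> * n1)) =
    (\<alpha> * \<phi>\<^sup>2 + \<beta> * \<phi> + \<gamma>) * (m1 * n0 - m0 * n1)"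
proof -
  have *: "\<alpha> * m2 = - \<beta> * m1 - \<gamma> * m0" "\<alpha> * n2 = - \<beta> * n1 - \<gamma> * n0"
    using assms by (simp_all add: algebra_simps eq_neg_iff_add_eq_0)
  have "\<alpha> * ((m2 - \<phi> * m1) * (n1 - \<phi> * n0) - (m1 - \<phi> * m0) * (n2 - \<phi> * n1)) =
      (\<alpha> * m2 - \<phi> * \<alpha> * m1) * (n1 - \<phi> * n0) - (m1 - \<phi> * m0) * (\<alpha> * n2 - \<phi> * \<alpha> * n1)"
    by (simp add: algebra_simps)
  then show ?thesis
    unfolding * by (simp add: algebra_simps power2_eq_square)
qed

text \<open>The double series \<open>\<Sum>j k. t j * u k * (lam q a j - a / b * lam q (b\<^sup>2 / a) k)\<close>, where
  \<open>t\<close> and \<open>u\<close> are the terms of the two very-well-poised series.\<close>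

definition bil :: "complex \<Rightarrow> complex \<Rightarrow> complex \<Rightarrow> complex \<Rightarrow> complex \<Rightarrow> complex \<Rightarrow> complex \<Rightarrow> complex" where
  "bil q a b c d e f =
     vmom q a [b, c, d, e, f] 1 * vmom q (b\<^sup>2/a) [b, b*c/a, b*d/a, b*e/a, b*f/a] 0
     - a / b * (vmom q a [b, c, d, e, f] 0 * vmom q (b\<^sup>2/a) [b, b*c/a, b*d/a, b*e/a, b*f/a] 1)"

lemma bil_swap: "bil q a b c d e f = bil q a b d c e f"
  by (simp add: bil_def vmom_def vterm_def vwp_arg_def mult_ac)

text \<open>These are conditions on q, a and b alone, which stay fixed while c runs through c/q^n.
  What both series demand of each further parameter is collected in \<open>good\<close> and survives
  this motion (\<open>good_power\<close>).\<close>

locale base =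
  fixes q a b :: complex
  assumes q: "norm q < 1" "q \<noteq> 0" and a: "a \<noteq> 0" "a \<noteq> 1" and b: "b \<noteq> 0" "b\<^sup>2 \<noteq> a"
    and ab: "nonres q (a * q / b)" and ba: "nonres q (b * q / a)"
begin

definition good :: "complex \<Rightarrow> bool" where
  "good p \<longleftrightarrow> p \<noteq> 0 \<and> nonres q (a * q / p) \<and> nonres q (b * q / p)"

lemma good_nonzero: "good p \<Longrightarrow> p \<noteq> 0"
  by (simp add: good_def)

lemma good_power: "good p \<Longrightarrow> good (p / q ^ n)"
  using q nonres_mult_power[of q "a * q / p" n] nonres_mult_power[of q "b * q / p" n]
  by (simp add: good_def)

lemma reflect:
  "b\<^sup>2 / a \<noteq> 0" "b\<^sup>2 / a \<noteq> 1" "b\<^sup>2 / a * q / b = b * q / a"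
  "b\<^sup>2 / a * q / (b * p / a) = b * q / p"
  using a b by (auto simp: power2_eq_square)

lemma arg_reflect:
  "vwp_arg q (b\<^sup>2/a) [b, b*c/a, b*d/a, b*e/a, b*f/a] = vwp_arg q a [b, c, d, e, f]"
  using a b by (simp add: vwp_arg_def field_simps power2_eq_square)

text \<open>The moments at c are those at x = c/q with X - \<phi> inserted, \<phi> = x + a/x, so
  \<open>det_mod_quad\<close> and \<open>quad_root\<close> give the ratio of the determinants. At x
  the argument carries an extra factor q, which makes the second moments converge.\<close>

lemma bil_shift:
  assumes good: "good c" "good d" "good e" "good f"
    and z: "norm (vwp_arg q a [b, c, d, e, f]) < norm q"
    and c: "c \<noteq> q" "b * c \<noteq> a * q"
  shows "bil q a b c d e f * ((1 - a*q/c) * (1 - b*q/c) * (1 - vwp_arg q a [b, c, d, e, f] / q)) =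
    (1 - a*q/(d*c)) * (1 - a*q/(e*c)) * (1 - a*q/(f*c)) * bil q a b (c/q) d e f"
proof -
  define x where "x = c / q"
  define r where "r = b / a"
  define \<phi> where "\<phi> = x + a / x"
  define m where "m = vmom q a [b, x, d, e, f]"
  define n where "n = vmom q (b\<^sup>2/a) [b, b*x/a, b*d/a, b*e/a, b*f/a]"
  define M where "M = vmom q a [b, c, d, e, f]"
  define N where "N = vmom q (b\<^sup>2/a) [b, b*c/a, b*d/a, b*e/a, b*f/a]"
  define \<alpha> \<beta> \<gamma> where "\<alpha> = quad2 a b x d e f" and "\<beta> = quad1 a b x d e f" and "\<gamma> = quad0 a b x d e f"
  note nz = good_nonzero[OF good(1)] good_nonzero[OF good(2)] good_nonzero[OF good(3)] good_nonzero[OF good(4)]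
  have x: "x \<noteq> 0" "c = x * q"
    using nz q by (simp_all add: x_def)
  have r0: "r \<noteq> 0"
    using a b by (simp add: r_def)
  have good_x: "good x"
    using good_power[OF good(1), of 1] by (simp add: x_def)
  have arg: "vwp_arg q a [b, x, d, e, f] = vwp_arg q a [b, c, d, e, f] * q"
    using q by (simp add: vwp_arg_def x)
  have zx: "norm (vwp_arg q a [b, x, d, e, f]) < norm q ^ 2"
    unfolding arg norm_mult power2_eq_square using z q by simp
  have z0: "norm (vwp_arg q a [b, c, d, e, f]) < 1"
    using z q by linarith
  have M: "M i * ((1 - x) * (1 - a / x)) = m (Suc i) - \<phi> * m i" if "i < 2" for i
  proof -
    have "norm (vwp_arg q a (c # [b, d, e, f])) < norm q ^ i"
      using that z z0 by (auto simp: less_2_cases_iff vwp_arg_def mult_ac)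
    then have "vmom q a (c # [b, d, e, f]) i * ((1 - c / q) * (1 - a * q / c)) =
      vmom q a (c / q # [b, d, e, f]) (Suc i) - (c / q + a * q / c) * vmom q a (c / q # [b, d, e, f]) i"
      by (intro vmom_shift q nz) (use good ab in \<open>auto simp: good_def\<close>)
    then show ?thesis
      using q x unfolding M_def m_def \<phi>_def by (simp add: vmom_swap[of q a b])
  qed
  have N: "N i * ((1 - b*x/a) * (1 - b/x)) = n (Suc i) - r * \<phi> * n i" if "i < 2" for i
  proof -
    have "vwp_arg q (b\<^sup>2/a) (b*c/a # [b, b*d/a, b*e/a, b*f/a]) = vwp_arg q a [b, c, d, e, f]"
      using arg_reflect[of c d e f] by (simp add: vwp_arg_def mult_ac)
    then have "norm (vwp_arg q (b\<^sup>2/a) (b*c/a # [b, b*d/a, b*e/a, b*f/a])) < norm q ^ i"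
      using that z z0 by (auto simp: less_2_cases_iff)
    moreover have "\<forall>p\<in>set (b*c/a # [b, b*d/a, b*e/a, b*f/a]). nonres q (b\<^sup>2/a * q / p)"
      unfolding list.set ball_simps reflect using good ba by (auto simp: good_def)
    ultimately have "vmom q (b\<^sup>2/a) (b*c/a # [b, b*d/a, b*e/a, b*f/a]) i * ((1 - b*c/a / q) * (1 - b\<^sup>2/a * q / (b*c/a))) =
      vmom q (b\<^sup>2/a) (b*c/a / q # [b, b*d/a, b*e/a, b*f/a]) (Suc i) -
      (b*c/a / q + b\<^sup>2/a * q / (b*c/a)) * vmom q (b\<^sup>2/a) (b*c/a / q # [b, b*d/a, b*e/a, b*f/a]) i"
      by (intro vmom_shift q) (use nz a b in auto)
    moreover have "b*c/a / q = b*x/a" "b\<^sup>2/a * q / (b*c/a) = b/x" "b*c/a / q + b\<^sup>2/a * q / (b*c/a) = r * \<phi>"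
      using a b q x by (simp_all add: r_def \<phi>_def power2_eq_square field_simps)
    ultimately show ?thesis
      unfolding N_def n_def by (simp add: vmom_swap[of q "b\<^sup>2/a" b])
  qed
  have qm: "\<alpha> * m 2 + \<beta> * m 1 + \<gamma> * m 0 = 0"
    unfolding m_def \<alpha>_def \<beta>_def \<gamma>_def
    by (rule vmom_quad[OF q a _ zx]) (use good good_x ab b in \<open>auto simp: good_def\<close>)
  have "\<forall>p\<in>{b, b*x/a, b*d/a, b*e/a, b*f/a}. p \<noteq> 0 \<and> nonres q (b\<^sup>2/a * q / p)"
    unfolding ball_simps reflect using good good_x ba a b by (auto simp: good_def)
  from vmom_quad[OF q reflect(1,2) this] zx
  have qn: "\<alpha> * (n 2 / r\<^sup>2) + \<beta> * (n 1 / r) + \<gamma> * n 0 = 0"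
    unfolding arg_reflect quad_reflect[OF a(1) b(1)]
    unfolding n_def[symmetric] \<alpha>_def[symmetric] \<beta>_def[symmetric] \<gamma>_def[symmetric] r_def[symmetric]
    using r0 by (simp add: field_simps power2_eq_square)
  have "\<alpha> * (bil q a b c d e f * (((1 - x) * (1 - a / x)) * ((1 - b*x/a) * (1 - b/x)))) =
     \<alpha> * ((M 1 * ((1 - x) * (1 - a / x))) * (N 0 * ((1 - b*x/a) * (1 - b/x)))
       - 1 / r * ((M 0 * ((1 - x) * (1 - a / x))) * (N 1 * ((1 - b*x/a) * (1 - b/x)))))"
  proof -
    have "a / b = 1 / r"
      by (simp add: r_def)
    then show ?thesis
      unfolding bil_def M_def[symmetric] N_def[symmetric] by (simp only: left_diff_distrib mult_ac)
  qed
  also have "\<dots> = \<alpha> * ((m 2 - \<phi> * m 1) * (n 1 - r * \<phi> * n 0) - 1 / r * ((m 1 - \<phi> * m 0) * (n 2 - r * \<phi> * n 1)))"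
    using M[of 0] M[of 1] N[of 0] N[of 1] by (simp add: numeral_2_eq_2)
  also have "\<dots> = r * (\<alpha> * ((m 2 - \<phi> * m 1) * (n 1 / r - \<phi> * n 0) - (m 1 - \<phi> * m 0) * (n 2 / r\<^sup>2 - \<phi> * (n 1 / r))))"
    using r0 by (simp add: field_simps power2_eq_square)
  also have "\<dots> = r * ((\<alpha> * \<phi>\<^sup>2 + \<beta> * \<phi> + \<gamma>) * (m 1 * n 0 - m 0 * (n 1 / r)))"
    by (simp only: det_mod_quad[OF qm qn])
  also have "\<alpha> * \<phi>\<^sup>2 + \<beta> * \<phi> + \<gamma> =
      - ((1 - x) * (1 - b*x/a) * (d*x - a) * (e*x - a) * (f*x - a) / (a * x\<^sup>2))"
    unfolding \<alpha>_def \<beta>_def \<gamma>_def \<phi>_def using nz x a b by (intro quad_root) auto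
  also have "m 1 * n 0 - m 0 * (n 1 / r) = bil q a b x d e f"
    unfolding bil_def m_def[symmetric] n_def[symmetric] r_def by simp
  finally have 1: "\<alpha> * (bil q a b c d e f * (((1 - x) * (1 - a / x)) * ((1 - b*x/a) * (1 - b/x)))) =
      r * (- ((1 - x) * (1 - b*x/a) * (d*x - a) * (e*x - a) * (f*x - a) / (a * x\<^sup>2)) * bil q a b x d e f)" .
  \<comment> \<open>These factors stand on both sides: on the left from the two shift relations, on
    the right from the value of the quadratic at \<phi>. Cancelling them excludes c = q and b c = a
    q.\<close>
  define K where "K = (1 - x) * (1 - b*x/a)"
  have "x \<noteq> 1" "b * x \<noteq> a"
    using c x by auto
  then have K: "K \<noteq> 0"
    using a by (simp add: K_def eq_divide_eq)
  have "K * (\<alpha> * (bil q a b c d e f * ((1 - a / x) * (1 - b/x)))) =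
      K * (- (r * ((d*x - a) * (e*x - a) * (f*x - a) / (a * x\<^sup>2)) * bil q a b x d e f))"
    using 1 unfolding K_def[symmetric] by (simp add: K_def mult_ac)
  then have 2: "\<alpha> * (bil q a b c d e f * ((1 - a / x) * (1 - b/x))) =
      - (r * ((d*x - a) * (e*x - a) * (f*x - a) / (a * x\<^sup>2)) * bil q a b x d e f)"
    by (rule mult_left_cancel[OF K, THEN iffD1])
  \<comment> \<open>Since 1/\<kappa> is the argument divided by q, - \<alpha> = \<kappa> (1 -
    1/\<kappa>) yields the third factor on the left of the claim.\<close>
  define \<kappa> where "\<kappa> = b*x*d*e*f / a\<^sup>2"
  have \<kappa>: "\<kappa> \<noteq> 0" "\<alpha> = 1 - \<kappa>" "vwp_arg q a [b, c, d, e, f] / q = 1 / \<kappa>"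
    using nz x a b q by (simp_all add: \<kappa>_def \<alpha>_def quad2_def vwp_arg_def field_simps power2_eq_square)
  have \<kappa>_prod: "r * ((d*x - a) * (e*x - a) * (f*x - a) / (a * x\<^sup>2)) = \<kappa> * ((1 - a/(d*x)) * (1 - a/(e*x)) * (1 - a/(f*x)))"
  proof -
    have "1 - a/(d*x) = (d*x - a)/(d*x)" "1 - a/(e*x) = (e*x - a)/(e*x)" "1 - a/(f*x) = (f*x - a)/(f*x)"
      using nz x by (simp_all add: field_simps)
    then show ?thesis
      using nz x a by (simp add: r_def \<kappa>_def power2_eq_square)
  qed
  have "\<kappa> * (bil q a b c d e f * ((1 - a / x) * (1 - b/x) * (1 - 1 / \<kappa>))) =
      (\<kappa> * (1 - 1 / \<kappa>)) * (bil q a b c d e f * ((1 - a / x) * (1 - b/x)))"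
    by (simp only: mult_ac)
  also have "\<kappa> * (1 - 1 / \<kappa>) = - \<alpha>"
    unfolding \<kappa>(2) using \<kappa>(1) by (simp add: right_diff_distrib)
  also have "- \<alpha> * (bil q a b c d e f * ((1 - a / x) * (1 - b/x))) =
      \<kappa> * ((1 - a/(d*x)) * (1 - a/(e*x)) * (1 - a/(f*x))) * bil q a b x d e f"
    using 2 unfolding \<kappa>_prod mult_minus_left[of \<alpha>] by simp
  finally have "\<kappa> * (bil q a b c d e f * ((1 - a / x) * (1 - b/x) * (1 - 1 / \<kappa>))) =
      \<kappa> * ((1 - a/(d*x)) * (1 - a/(e*x)) * (1 - a/(f*x)) * bil q a b x d e f)"
    by (simp only: mult.assoc)
  then show ?thesis
    using \<kappa>(1) unfolding \<kappa>(3) using q x by simp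
qed

end

subsection \<open>Evaluation of the bilinear form\<close>

text \<open>With v = 1/c, (c)_k (x/c)^k is x^k times the product of v - q^j for j < k, a polynomial
  in v. The term ratio tends to v x, so the series is continuous at v = 0, and its value there is
  the limit for every starting point c; hence the quantifier order.\<close>

lemma hyp_confluent_limit:
  assumes q: "norm q < 1" "q \<noteq> 0" and ws: "\<forall>w\<in>set ws. nonres q w"
  shows "\<exists>L. \<forall>c. c \<noteq> 0 \<longrightarrow>
    (\<lambda>n. hyp q ((c / q ^ n) # us) (a * q / (c / q ^ n) # ws) (x / (c / q ^ n))) \<longlonglongrightarrow> L"
proof (intro exI allI impI)
  define f where "f = (\<lambda>k v. (\<Prod>j<k. v - q ^ j) / qpoch q (a * q * v) k * (qpochs q us k / qpochs q ws k * x ^ k))"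
  define S where "S = {v. nonres q (a * q * v)} \<inter> {v. norm (v * x) < 1}"
  define \<rho> where "\<rho> = (\<lambda>k v. (v - q ^ k) * ((\<Prod>u\<leftarrow>map (\<lambda>u _. u) us. 1 - u v * q ^ k) /
      (\<Prod>w\<leftarrow>(\<lambda>v. a * q * v) # map (\<lambda>w _. w) ws. 1 - w v * q ^ k) * x))"
  have S: "open S"
  proof -
    have "open ((\<lambda>v. a * q * v) -` {v. nonres q v})"
      by (intro open_vimage open_nonres q continuous_intros)
    moreover have "open {v. norm (v * x) < 1}"
      by (intro open_Collect_less continuous_intros)
    ultimately show ?thesis
      by (auto simp: S_def vimage_def)
  qed
  have "0 \<in> S"
    by (simp add: S_def nonres_def)
  have "continuous_on S (\<lambda>v. \<Sum>k. f k v)"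
  proof (rule cont.series[OF S])
    show "continuous_on S (f k)" for k
      unfolding f_def by (intro continuous_intros cont.qpoch) (auto simp: S_def qpoch_nonzero)
    show "f (Suc k) v = f k v * \<rho> k v" for k v
      by (simp add: f_def \<rho>_def qpoch_Suc qpochs_Suc o_def mult_ac)
    show "((\<lambda>p. \<rho> (fst p) (snd p)) \<longlongrightarrow> v * x) (sequentially \<times>\<^sub>F nhds v)" for v
    proof -
      have "((\<lambda>p. (\<lambda>v. v) (snd p) - q ^ fst p) \<longlongrightarrow> v - 0) (sequentially \<times>\<^sub>F nhds v)"
        by (intro tendsto_intros filterlim_compose[OF _ filterlim_snd]
            filterlim_compose[OF LIMSEQ_power_zero filterlim_fst] q) (simp add: filterlim_ident)
      moreover have "((\<lambda>p. (\<Prod>u\<leftarrow>map (\<lambda>u _. u) us. 1 - u (snd p) * q ^ fst p) /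
          (\<Prod>w\<leftarrow>(\<lambda>v. a * q * v) # map (\<lambda>w _. w) ws. 1 - w (snd p) * q ^ fst p) * (\<lambda>_. x) (snd p))
          \<longlongrightarrow> (\<lambda>_. x) v) (sequentially \<times>\<^sub>F nhds v)"
        by (rule hyp_ratio_tendsto[OF q(1), where z = "\<lambda>_. x"]) (auto intro!: tendsto_intros simp: filterlim_ident)
      ultimately have "((\<lambda>p. \<rho> (fst p) (snd p)) \<longlongrightarrow> (v - 0) * x) (sequentially \<times>\<^sub>F nhds v)"
        unfolding \<rho>_def by (intro tendsto_mult)
      then show ?thesis by simp
    qed
  qed (simp add: S_def)
  then have cont: "isCont (\<lambda>v. \<Sum>k. f k v) 0"
    using S \<open>0 \<in> S\<close> continuous_on_eq_continuous_at by blast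
  have hyp: "hyp q (c # us) (a * q / c # ws) (x / c) = (\<Sum>k. f k (1 / c))" if "c \<noteq> 0" for c
  proof -
    have "qpoch q c k * (1 / c) ^ k = (\<Prod>j<k. 1 / c - q ^ j)" for k
      using that by (induction k) (simp_all add: qpoch_Suc field_simps)
    then have "(\<Prod>j<k. 1 / c - q ^ j) * x ^ k = qpoch q c k * (x / c) ^ k" for k
      by (simp add: power_divide flip: \<open>\<And>k. qpoch q c k * (1 / c) ^ k = _\<close>)
    then have "f k (1 / c) = qpochs q (c # us) k / qpochs q (a * q / c # ws) k * (x / c) ^ k" for k
      unfolding f_def by (simp add: mult.left_commute[of _ "x ^ k"] mult.commute[of _ "x ^ k"]) (simp add: mult_ac)
    then show ?thesis
      by (simp only: hyp_def)
  qed
  show "(\<lambda>n. hyp q ((c / q ^ n) # us) (a * q / (c / q ^ n) # ws) (x / (c / q ^ n))) \<longlonglongrightarrow> (\<Sum>k. f k 0)"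
    if c: "c \<noteq> 0" for c
  proof -
    have "(\<lambda>n. q ^ n * (1 / c)) \<longlonglongrightarrow> 0 * (1 / c)"
      by (intro tendsto_intros LIMSEQ_power_zero q)
    then have "(\<lambda>n. 1 / (c / q ^ n)) \<longlonglongrightarrow> 0"
      by simp
    then have "(\<lambda>n. \<Sum>k. f k (1 / (c / q ^ n))) \<longlonglongrightarrow> (\<Sum>k. f k 0)"
      by (rule isCont_tendsto_compose[OF cont])
    moreover have "hyp q ((c / q ^ n) # us) (a * q / (c / q ^ n) # ws) (x / (c / q ^ n)) =
        (\<Sum>k. f k (1 / (c / q ^ n)))" for n
      by (rule hyp) (use c q in simp)
    ultimately show ?thesis
      by presburger
  qed
qed

lemma vwp_arg_Cons: "vwp_arg q a (c # ps) = vwp_arg q a ps / c"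
  by (simp add: vwp_arg_def)

lemma norm_div_power_le:
  fixes z q :: complex
  assumes "norm q < 1" "q \<noteq> 0"
  shows "norm (z * q ^ n) \<le> norm z"
  using assms by (auto simp: norm_mult norm_power intro!: mult_left_le power_le_one)

text \<open>\<open>vmom_hyp\<close> needs the confluent limit at four arguments, so a limit is
  chosen for every x at once; independence of c is inherited.\<close>

lemma vmom_confluent_limit:
  assumes q: "norm q < 1" "q \<noteq> 0" and ps: "\<forall>p\<in>set ps. nonres q (a * q / p)"
  obtains L where "\<And>c i. c \<noteq> 0 \<Longrightarrow> nonres q (a * q / c) \<Longrightarrow> norm (vwp_arg q a (c # ps)) < norm q \<Longrightarrow> i < 2 \<Longrightarrow>
    (\<lambda>n. vmom q a (c / q ^ n # ps) i) \<longlonglongrightarrow> L i"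
proof -
  define us where "us = a # ps"
  define ws where "ws = q # map (\<lambda>p. a * q / p) ps"
  define h where "h = (\<lambda>c. hyp q (c # us) (a * q / c # ws))"
  define Z where "Z = vwp_arg q a ps"
  have ws: "\<forall>w\<in>set ws. nonres q w"
    unfolding ws_def by (rule lower_nonres[OF q(1) ps])
  have "\<forall>x. \<exists>l. \<forall>c. c \<noteq> 0 \<longrightarrow> (\<lambda>n. h (c / q ^ n) (x / (c / q ^ n))) \<longlonglongrightarrow> l"
    unfolding h_def by (intro allI hyp_confluent_limit q ws)
  from choice[OF this] obtain L where L: "\<And>x c. c \<noteq> 0 \<Longrightarrow> (\<lambda>n. h (c / q ^ n) (x / (c / q ^ n))) \<longlonglongrightarrow> L x"
    by blast
  have mom: "vmom q a (c # ps) 0 = (h c (Z / c) - a * h c (Z * q\<^sup>2 / c)) / (1 - a)"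
    "vmom q a (c # ps) (Suc 0) = (h c (Z / q / c) - a\<^sup>2 * h c (Z * q ^ 3 / c)) / (1 - a)"
    if "nonres q (a * q / c)" "norm (vwp_arg q a (c # ps)) < norm q" for c
  proof -
    have "hyp q (a # c # ps) (q # map (\<lambda>p. a * q / p) (c # ps)) = h c"
      by (simp add: h_def us_def ws_def hyp_def fun_eq_iff mult_ac)
    moreover have "\<forall>p\<in>set (c # ps). nonres q (a * q / p)"
      using ps that by simp
    ultimately show "vmom q a (c # ps) 0 = (h c (Z / c) - a * h c (Z * q\<^sup>2 / c)) / (1 - a)"
      "vmom q a (c # ps) (Suc 0) = (h c (Z / q / c) - a\<^sup>2 * h c (Z * q ^ 3 / c)) / (1 - a)"
      using vmom_hyp[OF q _ that(2)] by (simp_all add: vwp_arg_Cons Z_def mult_ac)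
  qed
  define M where "M = (\<lambda>i::nat. if i = 0 then (L Z - a * L (Z * q\<^sup>2)) / (1 - a)
    else (L (Z / q) - a\<^sup>2 * L (Z * q ^ 3)) / (1 - a))"
  show thesis
  proof (rule that[of M])
    fix c and i :: nat
    assume c: "c \<noteq> 0" "nonres q (a * q / c)" "norm (vwp_arg q a (c # ps)) < norm q" and i: "i < 2"
    have nonres: "nonres q (a * q / (c / q ^ n))" for n
      using nonres_mult_power[OF c(2), of n] by simp
    have "norm (vwp_arg q a (c / q ^ n # ps)) < norm q" for n
      using c(3) norm_div_power_le[OF q, of "vwp_arg q a (c # ps)" n] by (simp add: vwp_arg_Cons)
    note mom' = mom[OF nonres this]
    show "(\<lambda>n. vmom q a (c / q ^ n # ps) i) \<longlonglongrightarrow> M i"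
    proof (cases "i = 0")
      case True
      have "(\<lambda>n. (h (c / q ^ n) (Z / (c / q ^ n)) - a * h (c / q ^ n) (Z * q\<^sup>2 / (c / q ^ n))) / (1 - a)) \<longlonglongrightarrow>
          (L Z - a * L (Z * q\<^sup>2)) / (1 - a)"
        unfolding divide_inverse[of _ "1 - a"] by (intro tendsto_intros L c)
      then show ?thesis
        by (simp only: True mom' M_def if_True simp_thms)
    next
      case False
      then have i: "i = Suc 0"
        using i by simp
      have "(\<lambda>n. (h (c / q ^ n) (Z / q / (c / q ^ n)) - a\<^sup>2 * h (c / q ^ n) (Z * q ^ 3 / (c / q ^ n))) / (1 - a)) \<longlonglongrightarrow>
          (L (Z / q) - a\<^sup>2 * L (Z * q ^ 3)) / (1 - a)"
        unfolding divide_inverse[of _ "1 - a"] by (intro tendsto_intros L c)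
      then show ?thesis
        by (simp only: i mom' M_def if_False nat.distinct not_False_eq_True)
    qed
  qed
qed

context base
begin

lemma bil_confluent_limit:
  assumes good: "good d" "good e" "good f"
  obtains L where "\<And>c. good c \<Longrightarrow> norm (vwp_arg q a [b, c, d, e, f]) < norm q \<Longrightarrow>
    (\<lambda>n. bil q a b (c / q ^ n) d e f) \<longlonglongrightarrow> L"
proof -
  have 1: "\<forall>p\<in>set [b, d, e, f]. nonres q (a * q / p)"
    using good ab by (simp add: good_def)
  obtain L where L: "\<And>c i. c \<noteq> 0 \<Longrightarrow> nonres q (a * q / c) \<Longrightarrow>
      norm (vwp_arg q a (c # [b, d, e, f])) < norm q \<Longrightarrow> i < 2 \<Longrightarrow>
      (\<lambda>n. vmom q a (c / q ^ n # [b, d, e, f]) i) \<longlonglongrightarrow> L i"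
    using vmom_confluent_limit[OF q 1] by blast
  have 2: "\<forall>p\<in>set [b, b*d/a, b*e/a, b*f/a]. nonres q (b\<^sup>2/a * q / p)"
    unfolding list.set ball_simps reflect using good ba by (simp add: good_def)
  obtain L' where L': "\<And>c i. c \<noteq> 0 \<Longrightarrow> nonres q (b\<^sup>2/a * q / c) \<Longrightarrow>
      norm (vwp_arg q (b\<^sup>2/a) (c # [b, b*d/a, b*e/a, b*f/a])) < norm q \<Longrightarrow> i < 2 \<Longrightarrow>
      (\<lambda>n. vmom q (b\<^sup>2/a) (c / q ^ n # [b, b*d/a, b*e/a, b*f/a]) i) \<longlonglongrightarrow> L' i"
    using vmom_confluent_limit[OF q 2] by blast
  show thesis
  proof (rule that[of "L 1 * L' 0 - a / b * (L 0 * L' 1)"])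
    fix c assume c: "good c" "norm (vwp_arg q a [b, c, d, e, f]) < norm q"
    have z: "norm (vwp_arg q a (c # [b, d, e, f])) < norm q"
      using c(2) by (simp add: vwp_arg_def mult_ac)
    have "vwp_arg q (b\<^sup>2/a) (b*c/a # [b, b*d/a, b*e/a, b*f/a]) = vwp_arg q a [b, c, d, e, f]"
      using arg_reflect[of c d e f] by (simp add: vwp_arg_def mult_ac)
    then have z': "norm (vwp_arg q (b\<^sup>2/a) (b*c/a # [b, b*d/a, b*e/a, b*f/a])) < norm q"
      using c(2) by simp
    have lim: "(\<lambda>n. vmom q a [b, c / q ^ n, d, e, f] i) \<longlonglongrightarrow> L i" if "i < 2" for i
      using L[OF _ _ z that] c(1) by (simp add: good_def vmom_swap[of q a b])
    have "nonres q (b\<^sup>2/a * q / (b*c/a))" "b*c/a \<noteq> 0"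
      unfolding reflect using c(1) a b by (auto simp: good_def)
    from L'[OF this(2,1) z']
    have lim': "(\<lambda>n. vmom q (b\<^sup>2/a) [b, b * (c / q ^ n) / a, b*d/a, b*e/a, b*f/a] i) \<longlonglongrightarrow> L' i" if "i < 2" for i
      using that by (simp add: vmom_swap[of q "b\<^sup>2/a" b] mult.commute)
    show "(\<lambda>n. bil q a b (c / q ^ n) d e f) \<longlonglongrightarrow> L 1 * L' 0 - a / b * (L 0 * L' 1)"
      unfolding bil_def by (intro tendsto_intros lim lim') auto
  qed
qed

text \<open>\<open>bil_shift\<close> is iterated towards c = infinity, the argument shrinking by q
  each time. The excluded values of c are those for which some c/q^n meets an exception of a single
  step. The constant may depend on d, e, f but not on c.\<close>

lemma bil_product:
  assumes good: "good d" "good e" "good f"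
  obtains L where "\<And>c. good c \<Longrightarrow> norm (vwp_arg q a [b, c, d, e, f]) < norm q \<Longrightarrow>
    (\<And>n. c \<noteq> q ^ Suc n \<and> b * c \<noteq> a * q ^ Suc n) \<Longrightarrow>
    bil q a b c d e f * (qpoch_inf q (a*q/c) * qpoch_inf q (b*q/c) * qpoch_inf q (vwp_arg q a [b, c, d, e, f] / q)) =
    qpoch_inf q (a*q/(d*c)) * qpoch_inf q (a*q/(e*c)) * qpoch_inf q (a*q/(f*c)) * L"
proof -
  obtain L where L: "\<And>c. good c \<Longrightarrow> norm (vwp_arg q a [b, c, d, e, f]) < norm q \<Longrightarrow>
    (\<lambda>n. bil q a b (c / q ^ n) d e f) \<longlonglongrightarrow> L"
    using bil_confluent_limit[OF good] by blast
  show thesis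
  proof (rule that[of L])
    fix c assume c: "good c" "norm (vwp_arg q a [b, c, d, e, f]) < norm q"
      and c_generic: "\<And>n. c \<noteq> q ^ Suc n \<and> b * c \<noteq> a * q ^ Suc n"
    define Z where "Z = vwp_arg q a [b, c, d, e, f]"
    have "bil q a b c d e f * (qpoch q (a*q/c) n * qpoch q (b*q/c) n * qpoch q (Z / q) n) =
        qpoch q (a*q/(d*c)) n * qpoch q (a*q/(e*c)) n * qpoch q (a*q/(f*c)) n * bil q a b (c / q ^ n) d e f" for n
    proof (induction n)
      case (Suc n)
      define c' where "c' = c / q ^ n"
      have Z: "vwp_arg q a [b, c', d, e, f] = Z * q ^ n"
        using q by (simp add: Z_def vwp_arg_def c'_def)
      have "norm (vwp_arg q a [b, c', d, e, f]) < norm q"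
        unfolding Z using norm_div_power_le[OF q, of Z n] c(2) by (simp add: Z_def)
      moreover have "c' \<noteq> q" "b * c' \<noteq> a * q"
        using c_generic[of n] q by (auto simp: c'_def field_simps)
      ultimately have "bil q a b c' d e f * ((1 - a*q/c') * (1 - b*q/c') * (1 - vwp_arg q a [b, c', d, e, f] / q)) =
          (1 - a*q/(d*c')) * (1 - a*q/(e*c')) * (1 - a*q/(f*c')) * bil q a b (c'/q) d e f"
        by (intro bil_shift good) (use good_power[OF c(1)] in \<open>auto simp: c'_def\<close>)
      then have step: "bil q a b c' d e f * ((1 - a*q/c * q^n) * (1 - b*q/c * q^n) * (1 - Z/q * q^n)) =
          (1 - a*q/(d*c) * q^n) * (1 - a*q/(e*c) * q^n) * (1 - a*q/(f*c) * q^n) * bil q a b (c / q ^ Suc n) d e f"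
        unfolding Z by (simp add: c'_def mult.commute)
      have "bil q a b c d e f * (qpoch q (a*q/c) (Suc n) * qpoch q (b*q/c) (Suc n) * qpoch q (Z / q) (Suc n)) =
          (bil q a b c d e f * (qpoch q (a*q/c) n * qpoch q (b*q/c) n * qpoch q (Z / q) n)) *
          ((1 - a*q/c * q^n) * (1 - b*q/c * q^n) * (1 - Z/q * q^n))"
        by (simp only: qpoch_Suc mult_ac)
      also have "\<dots> = qpoch q (a*q/(d*c)) n * qpoch q (a*q/(e*c)) n * qpoch q (a*q/(f*c)) n *
          (bil q a b c' d e f * ((1 - a*q/c * q^n) * (1 - b*q/c * q^n) * (1 - Z/q * q^n)))"
        unfolding Suc c'_def by (simp only: mult.assoc)
      finally show ?case
        unfolding step by (simp only: qpoch_Suc mult_ac)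
    qed simp
    moreover have "(\<lambda>n. bil q a b c d e f * (qpoch q (a*q/c) n * qpoch q (b*q/c) n * qpoch q (Z / q) n)) \<longlonglongrightarrow>
        bil q a b c d e f * (qpoch_inf q (a*q/c) * qpoch_inf q (b*q/c) * qpoch_inf q (Z / q))"
      by (intro tendsto_intros qpoch_tendsto q)
    moreover have "(\<lambda>n. qpoch q (a*q/(d*c)) n * qpoch q (a*q/(e*c)) n * qpoch q (a*q/(f*c)) n * bil q a b (c / q ^ n) d e f) \<longlonglongrightarrow>
        qpoch_inf q (a*q/(d*c)) * qpoch_inf q (a*q/(e*c)) * qpoch_inf q (a*q/(f*c)) * L"
      by (intro tendsto_intros qpoch_tendsto q L c)
    ultimately show "bil q a b c d e f * (qpoch_inf q (a*q/c) * qpoch_inf q (b*q/c) *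
        qpoch_inf q (vwp_arg q a [b, c, d, e, f] / q)) =
      qpoch_inf q (a*q/(d*c)) * qpoch_inf q (a*q/(e*c)) * qpoch_inf q (a*q/(f*c)) * L"
      unfolding Z_def by (auto intro: LIMSEQ_unique)
  qed
qed

end

text \<open>(1)_k = 0 for k > 0, so only the term k = 0 survives.\<close>

lemma vmom_unit:
  assumes "1 \<in> set ps" "a \<noteq> 1"
  shows "vmom q a ps i = (1 + a) ^ i"
proof -
  have "qpochs q ps k = 0" if "k > 0" for k
    using assms(1) by (induction ps) (auto simp: qpoch_1[OF that])
  then have "vterm q a ps k = 0" if "k > 0" for k
    using that by (simp add: vterm_def)
  then have "vmom q a ps i = (\<Sum>k\<in>{0}. vterm q a ps k * lam q a k ^ i)"
    unfolding vmom_def by (intro suminf_finite) auto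
  then show ?thesis
    using assms(2) by (simp add: vterm_def lam_def)
qed

text \<open>For c = 1 and d = a/b the first series stops because of c, the second because b d/a =
  1.\<close>

lemma (in base) bil_unit: "bil q a b 1 (a/b) e f = (1 - b) * (1 - a/b)"
proof -
  have 1: "vmom q a [b, 1, a/b, e, f] i = (1 + a) ^ i" for i
    using a by (intro vmom_unit) auto
  have 2: "vmom q (b\<^sup>2/a) [b, b*1/a, b*(a/b)/a, b*e/a, b*f/a] i = (1 + b\<^sup>2/a) ^ i" for i
    using a b reflect by (intro vmom_unit) auto
  show ?thesis
    unfolding bil_def 1 2 using a b by (simp add: field_simps power2_eq_square)
qed

text \<open>The path is (c, d) to (1, d) to (1, a/b): \<open>L1\<close> links c with 1 for fixed d,
  and by the symmetry in c and d, \<open>L2\<close> links d with a/b for c = 1. The three bounds on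
  the argument belong to these three points.\<close>

lemma (in base) bil_eval:
  assumes good: "good c" "good d" "good e" "good f"
    and nonres: "nonres q a" "nonres q b" "nonres q (b / a)" "nonres q (b\<^sup>2 * q / a)"
    and generic: "\<And>n. c \<noteq> q ^ Suc n \<and> b * c \<noteq> a * q ^ Suc n" "\<And>n. d \<noteq> q ^ Suc n \<and> b * d \<noteq> a * q ^ Suc n"
    and z: "norm (vwp_arg q a [b, c, d, e, f]) < norm q" "norm (vwp_arg q a [b, 1, d, e, f]) < norm q"
      "norm (vwp_arg q a [b, 1, a/b, e, f]) < norm q"
  shows "bil q a b c d e f * (qpochs_inf q [a*q/c, a*q/d, a*q/e, a*q/f, b*q/c, b*q/d, b*q/e, b*q/f] *
       qpoch_inf q (vwp_arg q a [b, c, d, e, f] / q)) =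
    (1 - a/b) * qpochs_inf q [a*q, b, b\<^sup>2*q/a, a*q/(d*e), a*q/(c*e), a*q/(c*d), a*q/(c*f), a*q/(d*f), a*q/(e*f)]"
proof -
  let ?P = "qpoch_inf q"
  have good_1: "good 1"
    using nonres_mult[OF nonres(1)] nonres_mult[OF nonres(2)] by (simp add: good_def)
  have good_ab: "good (a/b)"
    using nonres_mult[OF nonres(2)] nonres(4) a b by (simp add: good_def power2_eq_square mult_ac)
  have q_Suc: "q ^ Suc n \<noteq> 1" for n
    using nonres_imp[OF nonres_norm_less_1[OF q(1) q(1)], of n] by simp
  have gen_1: "1 \<noteq> q ^ Suc n \<and> b * 1 \<noteq> a * q ^ Suc n" for n
    using q_Suc[of n] nonres_imp[OF ab, of n] b by (auto simp: mult_ac)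
  have gen_ab: "a/b \<noteq> q ^ Suc n \<and> b * (a/b) \<noteq> a * q ^ Suc n" for n
    using q_Suc[of n] nonres_imp[OF nonres(3), of "Suc n"] a b by (auto simp: field_simps)
  have nz: "?P (a*q/p) \<noteq> 0" "?P (b*q/p) \<noteq> 0" if "good p" for p
    using that by (auto simp: good_def qpoch_inf_eq_0_iff q)
  obtain L1 where L1: "\<And>c. good c \<Longrightarrow> norm (vwp_arg q a [b, c, d, e, f]) < norm q \<Longrightarrow>
    (\<And>n. c \<noteq> q ^ Suc n \<and> b * c \<noteq> a * q ^ Suc n) \<Longrightarrow>
    bil q a b c d e f * (?P (a*q/c) * ?P (b*q/c) * ?P (vwp_arg q a [b, c, d, e, f] / q)) =
    ?P (a*q/(d*c)) * ?P (a*q/(e*c)) * ?P (a*q/(f*c)) * L1"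
    using bil_product[OF good(2-4)] by blast
  obtain L2 where L2: "\<And>c. good c \<Longrightarrow> norm (vwp_arg q a [b, c, 1, e, f]) < norm q \<Longrightarrow>
    (\<And>n. c \<noteq> q ^ Suc n \<and> b * c \<noteq> a * q ^ Suc n) \<Longrightarrow>
    bil q a b c 1 e f * (?P (a*q/c) * ?P (b*q/c) * ?P (vwp_arg q a [b, c, 1, e, f] / q)) =
    ?P (a*q/(1*c)) * ?P (a*q/(e*c)) * ?P (a*q/(f*c)) * L2"
    using bil_product[OF good_1 good(3-4)] by blast
  define D where "D = bil q a b 1 d e f"
  define Z where "Z = ?P (vwp_arg q a [b, 1, d, e, f] / q)"
  have Z: "Z \<noteq> 0"
    unfolding Z_def qpoch_inf_eq_0_iff[OF q(1)] not_not
    using z(2) q by (intro nonres_norm_less_1) (auto simp: norm_divide)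
  have swap: "vwp_arg q a [b, x, 1, e, f] = vwp_arg q a [b, 1, x, e, f]" for x
    by (simp add: vwp_arg_def)
  have 1: "bil q a b c d e f * (?P (a*q/c) * ?P (b*q/c) * ?P (vwp_arg q a [b, c, d, e, f] / q)) =
    ?P (a*q/(c*d)) * ?P (a*q/(c*e)) * ?P (a*q/(c*f)) * L1"
    using L1[OF good(1) z(1) generic(1)] by (simp only: mult.commute[of c])
  have 2: "D * (?P (a*q) * ?P (b*q) * Z) = ?P (a*q/d) * ?P (a*q/e) * ?P (a*q/f) * L1"
    using L1[OF good_1 z(2) gen_1] by (simp only: D_def Z_def div_by_1 mult_1_right)
  have "D * (?P (a*q/d) * ?P (b*q/d) * Z) = ?P (a*q/d) * ?P (a*q/(d*e)) * ?P (a*q/(d*f)) * L2"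
    using L2[OF good(2) _ generic(2)] z(2) unfolding swap bil_swap[of q a b d 1]
    by (simp only: D_def Z_def mult_1 mult.commute[of d])
  \<comment> \<open>With the other parameter equal to 1, the factor (a q/d)_infinity appears on both
    sides.\<close>
  then have 3: "D * (?P (b*q/d) * Z) = ?P (a*q/(d*e)) * ?P (a*q/(d*f)) * L2"
    using nz(1)[OF good(2)] by simp
  have arg: "vwp_arg q a [b, 1, a/b, e, f] / q = a*q/(e*f)"
    using a b q by (simp add: vwp_arg_def field_simps power2_eq_square)
  have eqs: "a*q/(a/b) = b*q" "b*q/(a/b) = b\<^sup>2*q/a" "a*q/(1*(a/b)) = b*q"
    "a*q/(e*(a/b)) = b*q/e" "a*q/(f*(a/b)) = b*q/f"
    using a b by (simp_all add: power2_eq_square)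
  have "bil q a b (a/b) 1 e f * (?P (a*q/(a/b)) * ?P (b*q/(a/b)) * ?P (vwp_arg q a [b, a/b, 1, e, f] / q)) =
    ?P (a*q/(1*(a/b))) * ?P (a*q/(e*(a/b))) * ?P (a*q/(f*(a/b))) * L2"
    using L2[OF good_ab _ gen_ab] z(3) unfolding swap by blast
  then have "(1 - b) * (1 - a/b) * (?P (b*q) * ?P (b\<^sup>2*q/a) * ?P (a*q/(e*f))) =
      ?P (b*q) * ?P (b*q/e) * ?P (b*q/f) * L2"
    unfolding swap bil_swap[of q a b "a/b" 1] bil_unit arg eqs .
  then have 4: "(1 - b) * (1 - a/b) * (?P (b\<^sup>2*q/a) * ?P (a*q/(e*f))) = ?P (b*q/e) * ?P (b*q/f) * L2"
    using nz(2)[OF good_1] by (simp add: mult.assoc)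
  have Pb: "?P b = (1 - b) * ?P (b*q)"
    by (rule qpoch_inf_rec[OF q(1)])
  \<comment> \<open>The extra factors in the claim complete the combinations in which
    \<open>L1\<close> and \<open>L2\<close> occur, so both are substituted without being solved
    for.\<close>
  have "bil q a b c d e f * (qpochs_inf q [a*q/c, a*q/d, a*q/e, a*q/f, b*q/c, b*q/d, b*q/e, b*q/f] *
       ?P (vwp_arg q a [b, c, d, e, f] / q)) =
     (bil q a b c d e f * (?P (a*q/c) * ?P (b*q/c) * ?P (vwp_arg q a [b, c, d, e, f] / q))) *
     (?P (a*q/d) * ?P (a*q/e) * ?P (a*q/f)) * (?P (b*q/d) * ?P (b*q/e) * ?P (b*q/f))"
    by (simp add: mult_ac)
  also have "\<dots> = ?P (a*q/(c*d)) * ?P (a*q/(c*e)) * ?P (a*q/(c*f)) *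
      (?P (a*q/d) * ?P (a*q/e) * ?P (a*q/f) * L1) * (?P (b*q/d) * ?P (b*q/e) * ?P (b*q/f))"
    unfolding 1 by (simp only: mult_ac)
  also have "\<dots> = ?P (a*q/(c*d)) * ?P (a*q/(c*e)) * ?P (a*q/(c*f)) * ?P (a*q) * ?P (b*q) *
      (D * (?P (b*q/d) * Z)) * (?P (b*q/e) * ?P (b*q/f))"
    unfolding 2[symmetric] by (simp only: mult_ac)
  also have "\<dots> = ?P (a*q/(c*d)) * ?P (a*q/(c*e)) * ?P (a*q/(c*f)) * ?P (a*q) * ?P (b*q) *
      (?P (a*q/(d*e)) * ?P (a*q/(d*f))) * (?P (b*q/e) * ?P (b*q/f) * L2)"
    unfolding 3 by (simp only: mult_ac)
  finally show ?thesis
    unfolding 4[symmetric] by (simp add: Pb mult_ac)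
qed

subsection \<open>The Casoratian in the region of convergence\<close>

definition casoratian :: "complex \<Rightarrow> complex \<Rightarrow> complex \<Rightarrow> complex \<Rightarrow> complex \<Rightarrow> complex \<Rightarrow> complex \<Rightarrow> complex" where
  "casoratian q a b c d e f = (let s = a ^ 3 * q ^ 3 / (b * c * d * e * f) in
    (1 - q) * ((S1 q a b c d e f s - S3 q a b c d e f s) * W87 q (params1 q a b c d e f) * W87 q (params3 q a b c d e f)
      - T1 q a b c d e f s * W87 q (params1p q a b c d e f) * W87 q (params3 q a b c d e f)
      + T3 q a b c d e f s * W87 q (params1 q a b c d e f) * W87 q (params3p q a b c d e f)))"

text \<open>Multiplying by these products keeps infinite products out of denominators, so both sides
  of the identity stay regular during the extension. The last factor is (s/(aq))_infinity.\<close>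

definition weight :: "complex \<Rightarrow> complex \<Rightarrow> complex \<Rightarrow> complex \<Rightarrow> complex \<Rightarrow> complex \<Rightarrow> complex \<Rightarrow> complex" where
  "weight q a b c d e f = qpochs_inf q [a*q/c, a*q/d, a*q/e, a*q/f, b*q/c, b*q/d, b*q/e, b*q/f] *
     qpoch_inf q (a\<^sup>2 * q\<^sup>2 / (b * c * d * e * f))"

definition closed_form :: "complex \<Rightarrow> complex \<Rightarrow> complex \<Rightarrow> complex \<Rightarrow> complex \<Rightarrow> complex \<Rightarrow> complex \<Rightarrow> complex" where
  "closed_form q a b c d e f = - q * (1 - a/b) *
     qpochs_inf q [a*q, b, b\<^sup>2*q/a, a*q/(d*e), a*q/(c*e), a*q/(c*d), a*q/(c*f), a*q/(d*f), a*q/(e*f)]"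

lemma W87_eq_vwp_series:
  assumes "norm q < 1" "q \<noteq> 0" "(a, b, c, d, e, f) \<in> W87_dom q" "norm (vwp_arg q a [b, c, d, e, f]) < 1"
  shows "W87 q (a, b, c, d, e, f) = vwp_series q a [b, c, d, e, f]"
  using is_W87_continuation_W87[OF assms(1,2)] assms(3,4) unfolding is_W87_continuation_def by fast

lemma vwp_arg_5: "vwp_arg q a [b, c, d, e, f] = a\<^sup>2 * q\<^sup>2 / (b * c * d * e * f)"
  by (simp add: vwp_arg_def mult.assoc)

context base
begin

lemma nonsingular_dom:
  assumes good: "good c" "good d" "good e" "good f" and a2: "a * q\<^sup>2 \<noteq> 1" and b2: "nonres q (b\<^sup>2 * q / a)"
    and z: "nonres q (a\<^sup>2 * q / (b * c * d * e * f))"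
  shows "params1 q a b c d e f \<in> W87_dom q" "params1p q a b c d e f \<in> W87_dom q"
    "params3 q a b c d e f \<in> W87_dom q" "params3p q a b c d e f \<in> W87_dom q"
proof -
  note nz = good_nonzero[OF good(1)] good_nonzero[OF good(2)] good_nonzero[OF good(3)] good_nonzero[OF good(4)]
  define s where "s = a ^ 3 * q ^ 3 / (b * c * d * e * f)"
  note args = vwp_args[OF q(2) a(1) b(1) nz s_def]
  have s: "s / (a * q\<^sup>2) = a\<^sup>2 * q / (b * c * d * e * f)"
    using a q by (simp add: s_def power2_eq_square power3_eq_cube mult.assoc)
  have s': "s / (a * q) = s / (a * q\<^sup>2) * q"
    using q by (simp add: power2_eq_square)
  have z1: "nonres q (s / (a * q\<^sup>2))"
    unfolding s by (rule z)
  have z0: "nonres q (s / (a * q))"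
    unfolding s' by (rule nonres_mult[OF z1])
  have A: "nonres q (a * q / p) \<and> nonres q (a * q\<^sup>2 * q / (p * q))" if "p = b \<or> good p" for p
  proof -
    have "nonres q (a * q / p)"
      using that ab by (auto simp: good_def)
    moreover have "a * q\<^sup>2 * q / (p * q) = a * q / p * q"
      using q by (simp add: power2_eq_square)
    ultimately show ?thesis
      using nonres_mult by presburger
  qed
  have B: "nonres q (b\<^sup>2 / a * q / (b * p / a)) \<and> nonres q (b\<^sup>2 * q\<^sup>2 / a * q / (b * p * q / a))" if "good p" for p
  proof -
    have "nonres q (b * q / p)"
      using that by (auto simp: good_def)
    moreover have "b\<^sup>2 * q\<^sup>2 / a * q / (b * p * q / a) = b * q / p * q"
      using q a b by (simp add: power2_eq_square)
    ultimately show ?thesis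
      unfolding reflect using nonres_mult by presburger
  qed
  have B': "nonres q (b\<^sup>2 / a * q / b)" "nonres q (b\<^sup>2 * q\<^sup>2 / a * q / (b * q))"
  proof -
    show "nonres q (b\<^sup>2 / a * q / b)"
      unfolding reflect by (rule ba)
    have "b\<^sup>2 * q\<^sup>2 / a * q / (b * q) = b * q / a * q"
      using q b by (simp add: power2_eq_square)
    then show "nonres q (b\<^sup>2 * q\<^sup>2 / a * q / (b * q))"
      using nonres_mult[OF ba] by simp
  qed
  show "params1 q a b c d e f \<in> W87_dom q"
    unfolding params1_def W87_dom_iff args using a b nz A good z0 by auto
  show "params1p q a b c d e f \<in> W87_dom q"
    unfolding params1p_def W87_dom_iff args using a a2 b q nz A good z1 by auto
  show "params3 q a b c d e f \<in> W87_dom q"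
    unfolding params3_def W87_dom_iff args using a b nz B B' good z0 reflect(1,2) by auto
  have "b\<^sup>2 * q\<^sup>2 / a \<noteq> 1"
    using nonres_imp[OF b2, of 1] by (simp add: power2_eq_square mult_ac)
  then show "params3p q a b c d e f \<in> W87_dom q"
    unfolding params3p_def W87_dom_iff args using a b q nz B B' good z1 by auto
qed

text \<open>With Z = s/(aq), (1 - q)(S1 - S3) = (Z - q)(1 - b)(1 - a/b), while (1 - q) T1 and (1 -
  q) T3 are -(Z - q) and -(a/b)(Z - q) times the prefactors of \<open>vwp_series_shift\<close>. The
  products of two zeroth moments then cancel, and the mixed ones form \<open>bil\<close>.\<close>

lemma casoratian_eq_bil:
  assumes good: "good c" "good d" "good e" "good f" and a2: "a * q\<^sup>2 \<noteq> 1" and b2: "nonres q (b\<^sup>2 * q / a)"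
    and z: "norm (vwp_arg q a [b, c, d, e, f]) < norm q"
  shows "casoratian q a b c d e f = (vwp_arg q a [b, c, d, e, f] - q) * bil q a b c d e f"
proof -
  note nz = good_nonzero[OF good(1)] good_nonzero[OF good(2)] good_nonzero[OF good(3)] good_nonzero[OF good(4)]
  define s where "s = a ^ 3 * q ^ 3 / (b * c * d * e * f)"
  define Z where "Z = vwp_arg q a [b, c, d, e, f]"
  define ps where "ps = [b, c, d, e, f]"
  define A where "A = b\<^sup>2/a"
  define rs where "rs = [b, b*c/a, b*d/a, b*e/a, b*f/a]"
  note args = vwp_args[OF q(2) a(1) b(1) nz s_def]
  have s: "s = Z * a * q" "s / (a * q) = Z" "s / (a * q\<^sup>2) = Z / q"
    using args(1) a q by (simp_all add: Z_def power2_eq_square)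
  have Z: "norm Z < norm q" "norm Z < 1" "norm (Z / q) < 1"
    using z q by (auto simp: Z_def norm_divide)
  have arg_rs: "vwp_arg q A rs = Z"
    unfolding A_def rs_def Z_def by (rule arg_reflect)
  have arg_ps: "vwp_arg q a ps = Z"
    by (simp add: ps_def Z_def)
  have "nonres q (a\<^sup>2 * q / (b * c * d * e * f))"
  proof -
    have "a\<^sup>2 * q / (b * c * d * e * f) = Z / q"
      using q by (simp add: Z_def vwp_arg_5 power2_eq_square mult.assoc)
    then show ?thesis
      using nonres_norm_less_1[OF q(1) Z(3)] by simp
  qed
  note dom = nonsingular_dom[OF good a2 b2 this]
  have W1: "W87 q (params1 q a b c d e f) = vmom q a ps 0"
    unfolding vmom_0 params1_def ps_def
    by (rule W87_eq_vwp_series[OF q dom(1)[unfolded params1_def]]) (use Z in \<open>simp only: args s(2,3)\<close>)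
  have W3: "W87 q (params3 q a b c d e f) = vmom q A rs 0"
    unfolding vmom_0 params3_def rs_def A_def
    by (rule W87_eq_vwp_series[OF q dom(3)[unfolded params3_def]]) (use Z in \<open>simp only: args s(2,3)\<close>)
  have W1p: "W87 q (params1p q a b c d e f) = vwp_series q (a * q\<^sup>2) (map (\<lambda>p. p * q) ps)"
    unfolding params1p_def ps_def list.map
    by (rule W87_eq_vwp_series[OF q dom(2)[unfolded params1p_def]]) (use Z in \<open>simp only: args s(2,3)\<close>)
  have "W87 q (params3p q a b c d e f) = vwp_series q (b\<^sup>2 * q\<^sup>2 / a)
      [b * q, b * c * q / a, b * d * q / a, b * e * q / a, b * f * q / a]"
    unfolding params3p_def
    by (rule W87_eq_vwp_series[OF q dom(4)[unfolded params3p_def]]) (use Z in \<open>simp only: args s(2,3)\<close>)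
  then have W3p: "W87 q (params3p q a b c d e f) = vwp_series q (A * q\<^sup>2) (map (\<lambda>p. p * q) rs)"
    by (simp add: A_def rs_def)
  have ps: "\<forall>p\<in>set ps. p \<noteq> 0 \<and> nonres q (a * q / p)" "length ps = 5"
    using good ab b by (auto simp: ps_def good_def)
  have shift1: "Z / q * (1 - a * q) * (1 - a * q\<^sup>2) * (\<Prod>p\<leftarrow>ps. 1 - p) / (\<Prod>p\<leftarrow>ps. 1 - a * q / p)
      * W87 q (params1p q a b c d e f) = vmom q a ps 1 - (1 + a) * vmom q a ps 0"
    using vwp_series_shift[OF q a(2) a2 ps] Z(1) unfolding W1p arg_ps by blast
  have rs: "\<forall>p\<in>set rs. p \<noteq> 0 \<and> nonres q (A * q / p)" "length rs = 5"
    unfolding rs_def A_def list.set ball_simps reflect using good ba a b by (auto simp: good_def)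
  have "A * q\<^sup>2 \<noteq> 1"
    using nonres_imp[OF b2, of 1] by (simp add: A_def power2_eq_square mult_ac)
  moreover have "A \<noteq> 1"
    unfolding A_def by (rule reflect)
  moreover have "norm (vwp_arg q A rs) < norm q"
    unfolding arg_rs by (rule Z)
  ultimately
  have shift3: "Z / q * (1 - A * q) * (1 - A * q\<^sup>2) * (\<Prod>p\<leftarrow>rs. 1 - p) / (\<Prod>p\<leftarrow>rs. 1 - A * q / p)
      * W87 q (params3p q a b c d e f) = vmom q A rs 1 - (1 + A) * vmom q A rs 0"
    unfolding W3p arg_rs[symmetric] by (intro vwp_series_shift q rs)
  have q1: "1 - q \<noteq> 0"
    using q by auto
  have S: "(1 - q) * (S1 q a b c d e f s - S3 q a b c d e f s) = (Z - q) * ((1 - b) * (1 - a / b))"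
  proof -
    have "(1 - q) * (S1 q a b c d e f s - S3 q a b c d e f s) =
      (s / q + s / (a * q) + a * q / b + a * q / c + a * q / d + a * q / e + a * q / f - a * q) -
      (a * q / c + a * q / d + a * q / e + a * q / f + b * s / (a * q) + q + s / (b * q) - b * q)"
      unfolding S1_def S3_def right_diff_distrib using q1 by simp
    also have "\<dots> = (Z - q) * ((1 - b) * (1 - a / b))"
      using a b q unfolding s(1) by (simp add: field_simps)
    finally show ?thesis .
  qed
  have T1: "(1 - q) * T1 q a b c d e f s = - (Z - q) * (Z / q * (1 - a * q) * (1 - a * q\<^sup>2) *
      (\<Prod>p\<leftarrow>ps. 1 - p) / (\<Prod>p\<leftarrow>ps. 1 - a * q / p))"
  proof -
    define C where "C = (1 - a * q) * (1 - a * q\<^sup>2) * (\<Prod>p\<leftarrow>ps. 1 - p) / (\<Prod>p\<leftarrow>ps. 1 - a * q / p)"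
    have ZZ: "Z * (1 - Z / q) = - (Z - q) * (Z / q)"
      using q by (simp add: field_simps)
    have "(1 - q) * T1 q a b c d e f s = Z * (1 - Z / q) * C"
      unfolding T1_def s(2,3) C_def using q1 by (simp add: ps_def mult_ac)
    also have "\<dots> = - (Z - q) * (Z / q * C)"
      unfolding ZZ by (simp only: mult.assoc)
    also have "Z / q * C = Z / q * (1 - a * q) * (1 - a * q\<^sup>2) * (\<Prod>p\<leftarrow>ps. 1 - p) / (\<Prod>p\<leftarrow>ps. 1 - a * q / p)"
      by (simp add: C_def mult.assoc)
    finally show ?thesis .
  qed
  have T3: "(1 - q) * T3 q a b c d e f s = - (a / b) * (Z - q) * (Z / q * (1 - A * q) * (1 - A * q\<^sup>2) *
      (\<Prod>p\<leftarrow>rs. 1 - p) / (\<Prod>p\<leftarrow>rs. 1 - A * q / p))"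
  proof -
    define C where "C = (1 - A * q) * (1 - A * q\<^sup>2) * (\<Prod>p\<leftarrow>rs. 1 - p) / (\<Prod>p\<leftarrow>rs. 1 - A * q / p)"
    have sb: "s / (b * q) = a / b * Z"
      using q unfolding s(1) by simp
    have ZZ: "Z * (1 - Z / q) = - (Z - q) * (Z / q)"
      using q by (simp add: field_simps)
    have "(\<Prod>p\<leftarrow>rs. 1 - A * q / p) =
        (1 - b * q / a) * ((1 - b * q / c) * ((1 - b * q / d) * ((1 - b * q / e) * (1 - b * q / f))))"
      by (simp only: rs_def A_def list.map prod_list.Cons prod_list.Nil reflect mult_1_right)
    then have "(1 - q) * T3 q a b c d e f s = s / (b * q) * (1 - Z / q) * C"
      unfolding T3_def s(3) C_def using q1 by (simp add: rs_def A_def mult_ac)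
    also have "\<dots> = a / b * (Z * (1 - Z / q)) * C"
      unfolding sb by (simp only: mult.assoc)
    also have "\<dots> = - (a / b) * (Z - q) * (Z / q * C)"
      unfolding ZZ by (simp only: mult_ac mult_minus_left mult_minus_right)
    also have "Z / q * C = Z / q * (1 - A * q) * (1 - A * q\<^sup>2) * (\<Prod>p\<leftarrow>rs. 1 - p) / (\<Prod>p\<leftarrow>rs. 1 - A * q / p)"
      by (simp add: C_def mult.assoc)
    finally show ?thesis .
  qed
  define r where "r = a / b"
  define X1 X3 W1' W3' where "X1 = vmom q a ps 1" and "X3 = vmom q A rs 1"
    and "W1' = vmom q a ps 0" and "W3' = vmom q A rs 0"
  have "casoratian q a b c d e f = ((1 - q) * (S1 q a b c d e f s - S3 q a b c d e f s)) * W1' * W3'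
      - ((1 - q) * T1 q a b c d e f s * W87 q (params1p q a b c d e f)) * W3'
      + ((1 - q) * T3 q a b c d e f s * W87 q (params3p q a b c d e f)) * W1'"
    unfolding casoratian_def s_def[symmetric] Let_def W1 W3 W1'_def W3'_def by (simp add: algebra_simps)
  also have "(1 - q) * T1 q a b c d e f s * W87 q (params1p q a b c d e f) = - (Z - q) * (X1 - (1 + a) * W1')"
    unfolding T1 X1_def W1'_def shift1[symmetric] by (simp only: mult.assoc)
  also have "(1 - q) * T3 q a b c d e f s * W87 q (params3p q a b c d e f) =
      - (a / b) * (Z - q) * (X3 - (1 + A) * W3')"
    unfolding T3 X3_def W3'_def shift3[symmetric] by (simp only: mult.assoc)
  also have "((1 - q) * (S1 q a b c d e f s - S3 q a b c d e f s)) * W1' * W3'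
      - - (Z - q) * (X1 - (1 + a) * W1') * W3'
      + - (a / b) * (Z - q) * (X3 - (1 + A) * W3') * W1' =
      (Z - q) * (((1 - b) * (1 - a / b) - (1 + a) + a / b * (1 + A)) * W1' * W3' + (X1 * W3' - a / b * (W1' * X3)))"
    unfolding S r_def[symmetric] by algebra
  also have "(1 - b) * (1 - a / b) - (1 + a) + a / b * (1 + A) = 0"
    using a b by (simp add: A_def field_simps power2_eq_square)
  also have "X1 * W3' - a / b * (W1' * X3) = bil q a b c d e f"
    by (simp add: bil_def X1_def X3_def W1'_def W3'_def ps_def rs_def A_def)
  finally show ?thesis
    by (simp add: Z_def)
qed

lemma casoratian_convergent:
  assumes good: "good c" "good d" "good e" "good f"
    and nonres: "nonres q a" "nonres q b" "nonres q (b / a)" "nonres q (b\<^sup>2 * q / a)"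
    and generic: "\<And>n. c \<noteq> q ^ Suc n \<and> b * c \<noteq> a * q ^ Suc n" "\<And>n. d \<noteq> q ^ Suc n \<and> b * d \<noteq> a * q ^ Suc n"
    and z: "norm (vwp_arg q a [b, c, d, e, f]) < norm q" "norm (vwp_arg q a [b, 1, d, e, f]) < norm q"
      "norm (vwp_arg q a [b, 1, a/b, e, f]) < norm q"
  shows "casoratian q a b c d e f * weight q a b c d e f = closed_form q a b c d e f"
proof -
  define Z where "Z = vwp_arg q a [b, c, d, e, f]"
  have "a * q\<^sup>2 \<noteq> 1"
    using nonres_imp[OF nonres(1), of 2] .
  from casoratian_eq_bil[OF good this nonres(4) z(1)]
  have cas: "casoratian q a b c d e f = (Z - q) * bil q a b c d e f"
    by (simp add: Z_def)
  \<comment> \<open>\<open>weight\<close> contains (Z)_infinity but \<open>bil_eval\<close> has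
    (Z/q)_infinity; the factor Z - q supplies the difference and leaves the constant -q of
    \<open>closed_form\<close>.\<close>
  have Z_shift: "(Z - q) * qpoch_inf q Z = - q * qpoch_inf q (Z / q)"
    using qpoch_inf_rec[OF q(1), of "Z / q"] q by (simp add: field_simps)
  define N where "N = qpochs_inf q [a*q/c, a*q/d, a*q/e, a*q/f, b*q/c, b*q/d, b*q/e, b*q/f]"
  have "casoratian q a b c d e f * weight q a b c d e f = ((Z - q) * qpoch_inf q Z) * (bil q a b c d e f * N)"
    unfolding cas weight_def vwp_arg_5[symmetric] Z_def[symmetric] N_def[symmetric] by (simp only: mult_ac)
  also have "\<dots> = - q * (bil q a b c d e f * (N * qpoch_inf q (Z / q)))"
    unfolding Z_shift by (simp only: mult_ac)
  also have "\<dots> = closed_form q a b c d e f"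
    unfolding Z_def N_def bil_eval[OF good nonres generic z] closed_form_def by (simp only: mult.assoc)
  finally show ?thesis .
qed

end

subsection \<open>Extension to all nonsingular parameters\<close>

lemma base_good_iff:
  "base q a b \<Longrightarrow> base.good q a b p \<longleftrightarrow> p \<noteq> 0 \<and> nonres q (a * q / p) \<and> nonres q (b * q / p)"
  by (rule base.good_def)

lemma base_goodI:
  assumes q: "norm q < 1" "q \<noteq> 0"
    and dom: "params1 q a b c d e f \<in> W87_dom q" "params3 q a b c d e f \<in> W87_dom q"
  shows "base q a b" "p \<in> {c, d, e, f} \<Longrightarrow> base.good q a b p"
proof -
  have 1: "a \<noteq> 0" "a \<noteq> 1" "\<forall>p\<in>{b, c, d, e, f}. p \<noteq> 0 \<and> nonres q (a * q / p)"
    using dom(1) unfolding params1_def W87_dom_iff by auto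
  have 3: "b\<^sup>2 / a \<noteq> 1" "\<forall>p\<in>{b, b*c/a, b*d/a, b*e/a, b*f/a}. nonres q (b\<^sup>2 / a * q / p)"
    using dom(2) unfolding params3_def W87_dom_iff by auto
  have eq: "b\<^sup>2 / a * q / b = b * q / a" "b\<^sup>2 / a * q / (b * x / a) = b * q / x" for x
    using 1 by (auto simp: power2_eq_square)
  show base: "base q a b"
    by unfold_locales (use 1 3 q eq in auto)
  show "base.good q a b p" if "p \<in> {c, d, e, f}"
    unfolding base_good_iff[OF base] using 1 3(2) that unfolding ball_simps eq by auto
qed

context regular_functions
begin

text \<open>Regularity of the four \<open>W87\<close> values is assumed because its source differs:
  slices in f for holomorphy, the joint continuity of \<open>W87\<close> for continuity.\<close>

lemma casoratian:
  assumes q: "norm q < 1" "q \<noteq> 0"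
    and H: "H S a" "H S b" "H S c" "H S d" "H S e" "H S f"
    and base: "\<And>x. x \<in> S \<Longrightarrow> base q (a x) (b x)"
    and good: "\<And>x p. x \<in> S \<Longrightarrow> p \<in> {c x, d x, e x, f x} \<Longrightarrow> base.good q (a x) (b x) p"
    and W: "H S (\<lambda>x. W87 q (params1 q (a x) (b x) (c x) (d x) (e x) (f x)))"
      "H S (\<lambda>x. W87 q (params1p q (a x) (b x) (c x) (d x) (e x) (f x)))"
      "H S (\<lambda>x. W87 q (params3 q (a x) (b x) (c x) (d x) (e x) (f x)))"
      "H S (\<lambda>x. W87 q (params3p q (a x) (b x) (c x) (d x) (e x) (f x)))"
  shows "H S (\<lambda>x. casoratian q (a x) (b x) (c x) (d x) (e x) (f x))"
proof -
  have q1: "1 - q \<noteq> 0"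
    using q by auto
  have nz: "a x \<noteq> 0" "b x \<noteq> 0" "c x \<noteq> 0" "d x \<noteq> 0" "e x \<noteq> 0" "f x \<noteq> 0" if "x \<in> S" for x
    using base[OF that] good[OF that] by (auto simp: base_def base_good_iff)
  have neq: "1 - w \<noteq> 0" if "nonres q w" for w
    using nonres_neq_1[OF that] by simp
  have gd: "p \<noteq> 0 \<and> nonres q (a x * q / p) \<and> nonres q (b x * q / p)"
    if "x \<in> S" "p \<in> {c x, d x, e x, f x}" for x p
    using good[OF that] base_good_iff[OF base[OF that(1)]] by simp
  have nz1: "1 - a x * q / b x \<noteq> 0" "1 - a x * q / c x \<noteq> 0" "1 - a x * q / d x \<noteq> 0"
    "1 - a x * q / e x \<noteq> 0" "1 - a x * q / f x \<noteq> 0" if "x \<in> S" for x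
    using gd[OF that] base[OF that] by (intro neq; simp add: base_def)+
  have nz3: "1 - b x * q / a x \<noteq> 0" "1 - b x * q / c x \<noteq> 0" "1 - b x * q / d x \<noteq> 0"
    "1 - b x * q / e x \<noteq> 0" "1 - b x * q / f x \<noteq> 0" if "x \<in> S" for x
    using gd[OF that] base[OF that] by (intro neq; simp add: base_def)+
  define s where "s = (\<lambda>x. a x ^ 3 * q ^ 3 / (b x * c x * d x * e x * f x))"
  have s: "H S s"
    unfolding s_def by (intro divide mult power const H) (simp add: nz)
  have "H S (\<lambda>x. S1 q (a x) (b x) (c x) (d x) (e x) (f x) (s x))"
    unfolding S1_def by (intro mult add diff divide const H s) (simp_all add: nz q1 q)
  moreover have "H S (\<lambda>x. S3 q (a x) (b x) (c x) (d x) (e x) (f x) (s x))"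
    unfolding S3_def by (intro mult add diff divide const H s) (simp_all add: nz q1 q)
  moreover have "H S (\<lambda>x. T1 q (a x) (b x) (c x) (d x) (e x) (f x) (s x))"
    unfolding T1_def
    by (intro mult diff divide const power H s)
      (simp_all only: mult_eq_0_iff power_eq_0_iff nz nz1 q1 q simp_thms zero_neq_numeral)
  moreover have "H S (\<lambda>x. T3 q (a x) (b x) (c x) (d x) (e x) (f x) (s x))"
    unfolding T3_def
    by (intro mult diff divide const power H s)
      (simp_all only: mult_eq_0_iff power_eq_0_iff nz nz3 q1 q simp_thms zero_neq_numeral)
  ultimately show ?thesis
    unfolding casoratian_def Let_def s_def[symmetric] by (intro mult add diff const W) (simp_all add: s_def)
qed

lemma weight_closed_form:
  assumes q: "norm q < 1" and S: "open S"
    and H: "H S a" "H S b" "H S c" "H S d" "H S e" "H S f"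
    and nz: "\<And>x. x \<in> S \<Longrightarrow> a x \<noteq> 0 \<and> b x \<noteq> 0 \<and> c x \<noteq> 0 \<and> d x \<noteq> 0 \<and> e x \<noteq> 0 \<and> f x \<noteq> 0"
  shows "H S (\<lambda>x. weight q (a x) (b x) (c x) (d x) (e x) (f x))"
    and "H S (\<lambda>x. closed_form q (a x) (b x) (c x) (d x) (e x) (f x))"
  unfolding weight_def closed_form_def qpochs_inf_Cons qpochs_inf_Nil
  by (intro mult diff divide const power uminus qpoch_inf q S H; use nz in simp)+

end

text \<open>Only the last entry moves: in all four parameter tuples f occurs there alone, up to a
  constant factor, so the chain rule for one slice is enough.\<close>

lemma W87_holomorphic:
  assumes q: "norm q < 1" "q \<noteq> 0" and S: "open S" and h: "h holomorphic_on S"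
    and dom: "\<And>x. x \<in> S \<Longrightarrow> (A, B, C, D, E, h x) \<in> W87_dom q"
  shows "(\<lambda>x. W87 q (A, B, C, D, E, h x)) holomorphic_on S"
  unfolding holomorphic_on_def
proof
  fix x assume x: "x \<in> S"
  have "(\<lambda>w. W87 q (A, B, C, D, E, w)) field_differentiable at (h x)"
    using is_W87_continuation_W87[OF q] dom[OF x]
    unfolding is_W87_continuation_def holomorphic6_on_def by fast
  moreover have "h field_differentiable at x"
    using holomorphic_on_imp_differentiable_at[OF h S x] .
  ultimately have "(\<lambda>w. W87 q (A, B, C, D, E, w)) \<circ> h field_differentiable at x"
    by (intro field_differentiable_compose)
  then show "(\<lambda>x. W87 q (A, B, C, D, E, h x)) field_differentiable at x within S"
    unfolding o_def by (rule field_differentiable_at_within)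
qed

section \<open>Identity theorem in f and removal of countable exceptional sets\<close>

lemma uncountable_open_complex:
  fixes U :: "complex set"
  assumes "open U" "x \<in> U"
  shows "uncountable U"
proof -
  obtain r where "r > 0" "ball x r \<subseteq> U"
    using assms open_contains_ball by blast
  then show ?thesis
    using uncountable_ball countable_subset by blast
qed

text \<open>A nonzero value would persist on a nonempty open set, which is uncountable.\<close>

lemma continuous_zero_off_countable:
  fixes h :: "complex \<Rightarrow> complex"
  assumes U: "open U" and h: "continuous_on U h" and B: "countable B"
    and zero: "\<And>u. u \<in> U \<Longrightarrow> u \<notin> B \<Longrightarrow> h u = 0" and x: "x \<in> U"
  shows "h x = 0"
proof (rule ccontr)
  assume "h x \<noteq> 0"
  moreover have "open (U \<inter> h -` (- {0}))"
    by (rule continuous_open_preimage[OF h U]) auto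
  ultimately have "uncountable (U \<inter> h -` (- {0}))"
    using x by (intro uncountable_open_complex[of _ x]) auto
  moreover have "U \<inter> h -` (- {0}) \<subseteq> B"
    using zero by auto
  ultimately show False
    using B countable_subset by blast
qed

text \<open>In the variable f the admissible set is the complement of a countable set, hence
  connected. All three arguments in \<open>casoratian_convergent\<close> are inversely proportional
  to f, so they are small enough for large f.\<close>

lemma (in base) casoratian_generic:
  assumes good: "good c" "good d" "good e" "good f"
    and nonres: "nonres q a" "nonres q b" "nonres q (b / a)" "nonres q (b\<^sup>2 * q / a)"
    and generic: "\<And>n. c \<noteq> q ^ Suc n \<and> b * c \<noteq> a * q ^ Suc n" "\<And>n. d \<noteq> q ^ Suc n \<and> b * d \<noteq> a * q ^ Suc n"
    and z: "nonres q (a\<^sup>2 * q / (b * c * d * e * f))"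
  shows "casoratian q a b c d e f * weight q a b c d e f = closed_form q a b c d e f"
proof -
  \<comment> \<open>For f = x the argument of the two shifted series is K / x.\<close>
  define K where "K = a\<^sup>2 * q / (b * c * d * e)"
  define \<Omega> where "\<Omega> = {x. x \<noteq> 0 \<and> nonres q (a * q / x) \<and> nonres q (b * q / x) \<and> nonres q (K / x)}"
  define M where "M = norm (vwp_arg q a [b, c, d, e, 1]) + norm (vwp_arg q a [b, 1, d, e, 1])
    + norm (vwp_arg q a [b, 1, a/b, e, 1])"
  define U where "U = \<Omega> \<inter> {x. M / norm q < norm x}"
  note nz = good_nonzero[OF good(1)] good_nonzero[OF good(2)] good_nonzero[OF good(3)]
  have a2: "a * q\<^sup>2 \<noteq> 1"
    using nonres_imp[OF nonres(1), of 2] .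
  have mem: "x \<in> \<Omega> \<longleftrightarrow> good x \<and> nonres q (a\<^sup>2 * q / (b * c * d * e * x))" for x
    by (auto simp: \<Omega>_def good_def K_def)
  have \<Omega>_eq: "\<Omega> = - ({0} \<union> (\<Union>y\<in>{a * q, b * q, K}. range (\<lambda>n. y * q ^ n)))"
    unfolding \<Omega>_def nonres_def by (auto simp: field_simps)
  have connected: "connected \<Omega>"
    unfolding \<Omega>_eq by (intro path_connected_imp_connected path_connected_complement_countable) auto
  have open_\<Omega>: "open \<Omega>"
  proof -
    have "open ((- {0}) \<inter> (\<lambda>x. y / x) -` {w. nonres q w})" for y
      by (intro continuous_open_preimage open_nonres q continuous_intros) auto
    from open_Int[OF this[of "a * q"] open_Int[OF this[of "b * q"] this[of K]]]
    show ?thesis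
      by (rule back_subst[where P = "open"]) (auto simp: \<Omega>_def)
  qed
  have good': "good p" if "x \<in> \<Omega>" "p \<in> {c, d, e, x}" for x p
    using that good mem by auto
  have W: "(\<lambda>x. W87 q (params1 q a b c d e x)) holomorphic_on \<Omega>"
      "(\<lambda>x. W87 q (params1p q a b c d e x)) holomorphic_on \<Omega>"
      "(\<lambda>x. W87 q (params3 q a b c d e x)) holomorphic_on \<Omega>"
      "(\<lambda>x. W87 q (params3p q a b c d e x)) holomorphic_on \<Omega>"
    unfolding params1_def params1p_def params3_def params3p_def
    using nonsingular_dom[OF good(1-3) _ a2 nonres(4)] mem
    by (intro W87_holomorphic q open_\<Omega> holomorphic_intros a;
        simp add: params1_def params1p_def params3_def params3p_def a)+
  have lhs: "(\<lambda>x. casoratian q a b c d e x * weight q a b c d e x) holomorphic_on \<Omega>"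
    by (intro holomorphic_on_mult holo.casoratian holo.weight_closed_form q open_\<Omega> W base_axioms good')
      (use a b nz in \<open>auto simp: \<Omega>_def\<close>)
  have rhs: "(\<lambda>x. closed_form q a b c d e x) holomorphic_on \<Omega>"
    by (intro holo.weight_closed_form q open_\<Omega>) (use a b nz in \<open>auto simp: \<Omega>_def\<close>)
  have large: "casoratian q a b c d e x * weight q a b c d e x = closed_form q a b c d e x" if "x \<in> U" for x
  proof -
    have x: "good x" "M < norm q * norm x" "norm x > 0"
      using that mem q by (auto simp: U_def field_simps good_def)
    have "norm (vwp_arg q a [b, y, w, e, x]) < norm q" if "norm (vwp_arg q a [b, y, w, e, 1]) \<le> M" for y w
    proof -
      have "vwp_arg q a [b, y, w, e, x] = vwp_arg q a [b, y, w, e, 1] / x"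
        by (simp add: vwp_arg_def)
      then have "norm (vwp_arg q a [b, y, w, e, x]) \<le> M / norm x"
        using that by (simp add: norm_divide divide_right_mono)
      also have "\<dots> < norm q"
        using x by (simp add: pos_divide_less_eq)
      finally show ?thesis .
    qed
    then show ?thesis
      by (intro casoratian_convergent good x nonres generic) (auto simp: M_def)
  qed
  have open_U: "open U"
    unfolding U_def by (intro open_Int open_\<Omega> open_Collect_less continuous_intros)
  have "U \<noteq> {}"
  proof
    assume "U = {}"
    then have "{x. M / norm q < norm x} \<subseteq> - \<Omega>"
      by (auto simp: U_def)
    moreover have "countable (- \<Omega>)"
      unfolding \<Omega>_eq by simp
    ultimately have "countable {x :: complex. M / norm q < norm x}"
      using countable_subset by blast
    moreover have "open {x :: complex. M / norm q < norm x}"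
      by (intro open_Collect_less continuous_intros)
    moreover have "M / norm q < norm (of_real (\<bar>M / norm q\<bar> + 1) :: complex)"
      unfolding norm_of_real by linarith
    ultimately show False
      using uncountable_open_complex by blast
  qed
  moreover have "f \<in> \<Omega>"
    using good(4) z mem by simp
  ultimately show ?thesis
    by (intro analytic_continuation_open[OF open_U open_\<Omega> _ connected _ lhs rhs large]) (auto simp: U_def)
qed

lemma W87_continuous:
  assumes q: "norm q < 1" "q \<noteq> 0" and h: "continuous_on S h" and dom: "h ` S \<subseteq> W87_dom q"
  shows "continuous_on S (\<lambda>x. W87 q (h x))"
  by (rule continuous_on_compose2[OF _ h dom])
    (use is_W87_continuation_W87[OF q] in \<open>auto simp: is_W87_continuation_def holomorphic6_on_def\<close>)

lemma countable_resonant_square: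
  fixes a :: complex
  shows "countable {u. \<exists>n. a * u\<^sup>2 * q ^ n = 1}"
proof -
  have "u \<in> {csqrt w, - csqrt w}" if "a * u\<^sup>2 * q ^ n = 1" "w = 1 / (a * q ^ n)" for u n w
  proof -
    have "a * q ^ n \<noteq> 0"
    proof
      assume "a * q ^ n = 0"
      then have "a * u\<^sup>2 * q ^ n = 0"
        by auto
      then show False
        using that(1) by simp
    qed
    then have "u\<^sup>2 = w"
      unfolding that(2) using that(1) by (simp add: eq_divide_eq mult_ac)
    then have "u\<^sup>2 = (csqrt w)\<^sup>2"
      by simp
    then show ?thesis
      unfolding power2_eq_iff by simp
  qed
  then have "{u. \<exists>n. a * u\<^sup>2 * q ^ n = 1} \<subseteq> (\<Union>n. {csqrt (1 / (a * q ^ n)), - csqrt (1 / (a * q ^ n))})"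
    by blast
  then show ?thesis
    by (rule countable_subset) auto
qed

text \<open>The evaluation requires \<open>a\<close>, \<open>c\<close> and \<open>d\<close> to be generic. All exceptional values are avoided along
  \<open>(a * u\<^sup>2, c * u, d * u)\<close>, except for countably many \<open>u\<close>.\<close>

lemma casoratian_nonsingular:
  assumes q: "norm q < 1" "q \<noteq> 0" and sing: "nonsingular q a b c d e f"
  shows "casoratian q a b c d e f * weight q a b c d e f = closed_form q a b c d e f"
proof -
  \<comment> \<open>These conditions may be violated at u = 1. Each equation p u = q^(n+1) or b p u
    = a u^2 q^(n+1) has a single nonzero solution u, so only countably many u are lost.\<close>
  define B where "B = {0} \<union> {u. \<exists>n. a * u\<^sup>2 * q ^ n = 1} \<union>
    (\<Union>p\<in>{c, d}. range (\<lambda>n. q ^ Suc n / p) \<union> range (\<lambda>n. b * p / (a * q ^ Suc n)))"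
  define p1 p1p p3 p3p :: "complex \<Rightarrow> params"
    where "p1 = (\<lambda>u. params1 q (a * u\<^sup>2) b (c * u) (d * u) e f)"
      and "p1p = (\<lambda>u. params1p q (a * u\<^sup>2) b (c * u) (d * u) e f)"
      and "p3 = (\<lambda>u. params3 q (a * u\<^sup>2) b (c * u) (d * u) e f)"
      and "p3p = (\<lambda>u. params3p q (a * u\<^sup>2) b (c * u) (d * u) e f)"
  \<comment> \<open>These conditions hold at u = 1 and are open, so they persist nearby.\<close>
  define U where "U = (- {0} \<inter> p1 -` W87_dom q) \<inter> (- {0} \<inter> p1p -` W87_dom q) \<inter>
      (- {0} \<inter> p3 -` W87_dom q) \<inter> (- {0} \<inter> p3p -` W87_dom q) \<inter>
      (- {0} \<inter> (\<lambda>u. b / (a * u\<^sup>2)) -` {x. nonres q x}) \<inter>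
      (- {0} \<inter> (\<lambda>u. b\<^sup>2 * q / (a * u\<^sup>2)) -` {x. nonres q x})"
  have dom: "params1 q a b c d e f \<in> W87_dom q" "params1p q a b c d e f \<in> W87_dom q"
    "params3 q a b c d e f \<in> W87_dom q" "params3p q a b c d e f \<in> W87_dom q"
    using sing by (simp_all add: nonsingular_def)
  have nonres: "nonres q b" "nonres q (b / a)" "nonres q (b\<^sup>2 * q / a)"
    using sing by (simp_all add: nonsingular_def L3_denom_def nonres_def)
  have nz: "a \<noteq> 0" "b \<noteq> 0" "c \<noteq> 0" "d \<noteq> 0" "e \<noteq> 0" "f \<noteq> 0"
    using dom(1) unfolding params1_def W87_dom_iff by auto
  have cont: "continuous_on (- {0}) p1" "continuous_on (- {0}) p1p"
    "continuous_on (- {0}) p3" "continuous_on (- {0}) p3p"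
    unfolding p1_def p1p_def p3_def p3p_def params1_def params1p_def params3_def params3p_def
    by (intro continuous_intros; simp add: nz)+
  have open_U: "open U"
    unfolding U_def
    by (intro open_Int continuous_open_preimage[OF _ _ open_W87_dom[OF q(1)]] cont
        continuous_open_preimage[OF _ _ open_nonres[OF q(1)]] continuous_on_divide continuous_on_mult
        continuous_on_power continuous_on_id continuous_on_const open_Compl closed_singleton)
      (use nz in auto)
  have U: "u \<noteq> 0" "p1 u \<in> W87_dom q" "p1p u \<in> W87_dom q" "p3 u \<in> W87_dom q" "p3p u \<in> W87_dom q"
    "nonres q (b / (a * u\<^sup>2))" "nonres q (b\<^sup>2 * q / (a * u\<^sup>2))" if "u \<in> U" for u
    using that by (auto simp: U_def)
  have base: "base q (a * u\<^sup>2) b" if "u \<in> U" for u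
    using base_goodI(1)[OF q] U[OF that] unfolding p1_def p3_def by blast
  have good: "base.good q (a * u\<^sup>2) b p" if "u \<in> U" "p \<in> {c * u, d * u, e, f}" for u p
    using base_goodI(2)[OF q] U[OF that(1)] that(2) unfolding p1_def p3_def by blast
  have "countable B"
    unfolding B_def using countable_resonant_square[of a q] by simp
  define h where "h = (\<lambda>u. casoratian q (a * u\<^sup>2) b (c * u) (d * u) e f *
    weight q (a * u\<^sup>2) b (c * u) (d * u) e f - closed_form q (a * u\<^sup>2) b (c * u) (d * u) e f)"
  have "h u = 0" if u: "u \<in> U" "u \<notin> B" for u
  proof -
    have generic: "p * u \<noteq> q ^ Suc n \<and> b * (p * u) \<noteq> a * u\<^sup>2 * q ^ Suc n" if "p \<in> {c, d}" for p n
    proof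
      have p: "p \<noteq> 0"
        using that nz by auto
      have "u \<noteq> q ^ Suc n / p" "u \<noteq> b * p / (a * q ^ Suc n)"
        using u(2) that unfolding B_def by blast+
      then show "p * u \<noteq> q ^ Suc n" "b * (p * u) \<noteq> a * u\<^sup>2 * q ^ Suc n"
        using p nz q U(1)[OF u(1)] by (auto simp: field_simps power2_eq_square)
    qed
    have na: "nonres q (a * u\<^sup>2)"
      using u(2) by (auto simp: B_def nonres_def)
    have nz': "nonres q ((a * u\<^sup>2)\<^sup>2 * q / (b * (c * u) * (d * u) * e * f))"
    proof -
      have "nonres q (vwp_arg q (a * u\<^sup>2 * q\<^sup>2) [b * q, c * u * q, d * u * q, e * q, f * q])"
        using U(3)[OF u(1)] unfolding p1p_def params1p_def W87_dom_iff by blast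
      also have "vwp_arg q (a * u\<^sup>2 * q\<^sup>2) [b * q, c * u * q, d * u * q, e * q, f * q] =
          (a * u\<^sup>2)\<^sup>2 * q / (b * (c * u) * (d * u) * e * f)"
        using q nz U(1)[OF u(1)] by (simp add: vwp_arg_5 field_simps power2_eq_square)
      finally show ?thesis .
    qed
    note gd = good[OF u(1)]
    have "casoratian q (a * u\<^sup>2) b (c * u) (d * u) e f * weight q (a * u\<^sup>2) b (c * u) (d * u) e f =
      closed_form q (a * u\<^sup>2) b (c * u) (d * u) e f"
      by (rule base.casoratian_generic[OF base[OF u(1)] gd gd gd gd na nonres(1) U(6,7)[OF u(1)]
            generic generic nz']) simp_all
    then show ?thesis
      by (simp add: h_def)
  qed
  moreover have "continuous_on U h"
    unfolding h_def
  proof (intro continuous_on_diff continuous_on_mult cont.casoratian cont.weight_closed_form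
      q open_U base good continuous_on_const continuous_on_power continuous_on_id)
    have "U \<subseteq> - {0}"
      using U(1) by blast
    note cont_U = cont[THEN continuous_on_subset[OF _ this]]
    have "continuous_on U (\<lambda>u. W87 q (p1 u))" "continuous_on U (\<lambda>u. W87 q (p1p u))"
      "continuous_on U (\<lambda>u. W87 q (p3 u))" "continuous_on U (\<lambda>u. W87 q (p3p u))"
      by (rule W87_continuous[OF q cont_U(1)], use U in blast,
          rule W87_continuous[OF q cont_U(2)], use U in blast,
          rule W87_continuous[OF q cont_U(3)], use U in blast,
          rule W87_continuous[OF q cont_U(4)], use U in blast)
    then show "continuous_on U (\<lambda>u. W87 q (params1 q (a * u\<^sup>2) b (c * u) (d * u) e f))"
      "continuous_on U (\<lambda>u. W87 q (params1p q (a * u\<^sup>2) b (c * u) (d * u) e f))"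
      "continuous_on U (\<lambda>u. W87 q (params3 q (a * u\<^sup>2) b (c * u) (d * u) e f))"
      "continuous_on U (\<lambda>u. W87 q (params3p q (a * u\<^sup>2) b (c * u) (d * u) e f))"
      unfolding p1_def p1p_def p3_def p3p_def by simp_all
  qed (use nz U in auto)
  moreover have "1 \<in> U"
    using dom nonres unfolding U_def p1_def p1p_def p3_def p3p_def by simp
  ultimately have "h 1 = 0"
    by (intro continuous_zero_off_countable[OF open_U _ \<open>countable B\<close>, of h 1])
  then show ?thesis
    by (simp add: h_def)
qed

section \<open>Division by the weight and comparison with the stated products\<close>

theorem mainTheorem8:
  fixes q a b c d e f s W1 W1p W3 W3p :: complex
  assumes "0 < norm q" and "norm q < 1"
    and "a \<noteq> 0" and "b \<noteq> 0" and "c \<noteq> 0" and "d \<noteq> 0" and "e \<noteq> 0" and "f \<noteq> 0"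
    and "s = a ^ 3 * q ^ 3 / (b * c * d * e * f)"
    and "nonsingular q a b c d e f"
    and "W1 = W87 q (params1 q a b c d e f)"
    and "W1p = W87 q (params1p q a b c d e f)"
    and "W3 = W87 q (params3 q a b c d e f)"
    and "W3p = W87 q (params3p q a b c d e f)"
  shows "L3' q a b c d e f s * (1 - q) *
           ((S1 q a b c d e f s - S3 q a b c d e f s) * W1 * W3
             - T1 q a b c d e f s * W1p * W3 + T3 q a b c d e f s * W1 * W3p)
         = - (a * q\<^sup>2 / s) *
             (qpochs_inf q [a * q, s / (b * q), b * q\<^sup>2 / s, a * q / (d * e), a * q / (c * e),
                            a * q / (c * d), a * q / (c * f), a * q / (d * f), a * q / (e * f)]
              / qpochs_inf q [a * q / b, a * q / c, a * q / d, a * q / e, a * q / f,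
                              b * c / a, b * d / a, b * e / a, b * f / a])"
proof -
  let ?P = "qpoch_inf q"
  have q: "norm q < 1" "q \<noteq> 0"
    using assms(1,2) by auto
  note nz = assms(3-8)
  have s0: "s \<noteq> 0"
    using nz q assms(9) by simp
  have dom: "params1 q a b c d e f \<in> W87_dom q" "params3 q a b c d e f \<in> W87_dom q"
    using assms(10) by (simp_all add: nonsingular_def)
  have L3: "\<forall>x\<in>set (L3_denom q a b c d e f). ?P x \<noteq> 0"
    using assms(10) by (simp add: nonsingular_def qpoch_inf_eq_0_iff[OF q(1)] nonres_def)
  interpret base q a b
    by (rule base_goodI[OF q dom])
  have good: "good c" "good d" "good e" "good f"
    using base_goodI(2)[OF q dom] by auto
  have P_good: "?P (a*q/p) \<noteq> 0" "?P (b*q/p) \<noteq> 0" if "good p" for p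
    using that by (auto simp: good_def qpoch_inf_eq_0_iff q)
  define z where "z = s / (a * q)"
  have z: "a\<^sup>2 * q\<^sup>2 / (b * c * d * e * f) = z"
    using nz q by (simp add: z_def assms(9) field_simps eval_nat_numeral)
  have "nonres q z"
    using dom(1) unfolding params1_def W87_dom_iff vwp_arg_5 z by blast
  then have Pz: "?P z \<noteq> 0"
    by (simp add: qpoch_inf_eq_0_iff q)
  define E where "E = ?P (a*q/(d*e)) * ?P (a*q/(c*e)) * ?P (a*q/(c*d)) * ?P (a*q/(c*f)) * ?P (a*q/(d*f)) * ?P (a*q/(e*f))"
  define Aw where "Aw = ?P (a*q/c) * ?P (a*q/d) * ?P (a*q/e) * ?P (a*q/f)"
  define Bw where "Bw = ?P (b*q/c) * ?P (b*q/d) * ?P (b*q/e) * ?P (b*q/f)"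
  define Cw where "Cw = ?P (b*c/a) * ?P (b*d/a) * ?P (b*e/a) * ?P (b*f/a)"
  define V where "V = casoratian q a b c d e f"
  have V: "V * (Aw * Bw * ?P z) = - q * (1 - a/b) * (?P (a*q) * ?P b * ?P (b\<^sup>2*q/a) * E)"
    using casoratian_nonsingular[OF q assms(10)]
    unfolding V_def weight_def closed_form_def z Aw_def Bw_def E_def
    by (simp add: mult_ac)
  have nonzero: "Aw \<noteq> 0" "Bw \<noteq> 0"
    using P_good[OF good(1)] P_good[OF good(2)] P_good[OF good(3)] P_good[OF good(4)]
    unfolding Aw_def Bw_def by simp_all
  have nonzero': "Cw \<noteq> 0" "?P (b\<^sup>2*q/a) \<noteq> 0" "?P b \<noteq> 0" "?P (b/a) \<noteq> 0" "?P (a*q/b) \<noteq> 0"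
    using L3 by (simp_all add: Cw_def L3_denom_def)
  \<comment> \<open>L3' has (b/a)_infinity below and (b q/a)_infinity above; the surviving 1 - b/a
    cancels the same factor of \<open>V\<close> in the form given by \<open>qab\<close>.\<close>
  have Pba: "?P (b/a) = (1 - b/a) * ?P (b*q/a)"
    using qpoch_inf_rec[OF q(1), of "b/a"] by simp
  have ba: "?P (b*q/a) \<noteq> 0" "1 - b/a \<noteq> 0"
    using nonzero'(4) unfolding Pba by auto
  define t where "t = 1 - b/a"
  define \<theta> where "\<theta> = ?P (b*q/s) * ?P (s/b)"
  \<comment> \<open>One factor is moved between the two pairs of products. Since 1 - s/(bq) = -
    (s/(bq)) (1 - bq/s), they differ by a monomial, which accounts for the prefactor of the
    claim.\<close>
  have theta: "- (a*q\<^sup>2/s) * (?P (s/(b*q)) * ?P (b*q\<^sup>2/s)) = a*q/b * \<theta>"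
  proof -
    have 1: "?P (s/(b*q)) = (1 - s/(b*q)) * ?P (s/b)"
      using qpoch_inf_rec[OF q(1), of "s/(b*q)"] q by simp
    have 2: "?P (b*q/s) = (1 - b*q/s) * ?P (b*q\<^sup>2/s)"
      using qpoch_inf_rec[OF q(1), of "b*q/s"] by (simp add: power2_eq_square mult.assoc)
    have "- (a*q\<^sup>2/s) * (1 - s/(b*q)) = a*q/b * (1 - b*q/s)"
      using nz q s0 by (simp add: field_simps power2_eq_square)
    then have "- (a*q\<^sup>2/s) * (1 - s/(b*q)) * (?P (s/b) * ?P (b*q\<^sup>2/s)) = a*q/b * (1 - b*q/s) * (?P (s/b) * ?P (b*q\<^sup>2/s))"
      by (rule arg_cong)
    then show ?thesis
      unfolding 1 \<theta>_def 2 by (simp only: mult_ac)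
  qed
  have qab: "- q * (1 - a/b) = a*q/b * (1 - b/a)"
    using nz by (simp add: field_simps)
  have "Aw * Bw * ?P z \<noteq> 0"
    using nonzero Pz by simp
  then have V': "V = a*q/b * (1 - b/a) * (?P (a*q) * ?P b * ?P (b\<^sup>2*q/a) * E) / (Aw * Bw * ?P z)"
    using V unfolding qab by (rule nonzero_eq_divide_eq[THEN iffD2])
  have "L3' q a b c d e f s * V = ?P z * Bw * ?P (b*q/a) * \<theta> /
      (?P (b\<^sup>2*q/a) * Cw * ?P b * ?P (b/a) * ?P (a*q/b)) * V"
    by (simp add: L3'_def L3_denom_def z_def Bw_def Cw_def \<theta>_def mult_ac)
  also have "\<dots> = a*q/b * \<theta> * (?P (a*q) * E) / (?P (a*q/b) * Aw * Cw)"
    unfolding V' Pba using nonzero nonzero'(1,2,3,5) Pz ba[folded t_def] unfolding t_def[symmetric] by (simp add: mult_ac)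
  also have "\<dots> = - (a*q\<^sup>2/s) * (?P (s/(b*q)) * ?P (b*q\<^sup>2/s)) * (?P (a*q) * E) / (?P (a*q/b) * Aw * Cw)"
    unfolding theta ..
  also have "\<dots> = - (a * q\<^sup>2 / s) *
             (qpochs_inf q [a * q, s / (b * q), b * q\<^sup>2 / s, a * q / (d * e), a * q / (c * e),
                            a * q / (c * d), a * q / (c * f), a * q / (d * f), a * q / (e * f)]
              / qpochs_inf q [a * q / b, a * q / c, a * q / d, a * q / e, a * q / f,
                              b * c / a, b * d / a, b * e / a, b * f / a])"
    by (simp add: E_def Aw_def Cw_def mult_ac)
  finally show ?thesis
    unfolding V_def casoratian_def Let_def assms(9)[symmetric] assms(11-14) by (simp only: mult.assoc)
qed

end
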